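(* Let $k$ be a field. Every vaguely commutative $k$-algebra is a modest algebra.
   Context: Affine algebra: finitely generated associative unital (not necessarily commutative) $k$-algebra. Modules are left modules; $A\text{-}\mathsf{mod}$ is the category of finitely generated $A$-modules. For $A$ affine, $V\subset A$ a finite-dimensional generating subspace with $1\in V$, and $M$ generated by a finite-dimensional subspace $F$, $\mathrm{GK}(M)=\limsup_{n\to\infty}\log_n \dim_k(V^nF)$ (independent of choices). Convention: $\mathrm{GK}(0)=-\infty$. A filtration on $A$ is an increasing chain of subspaces $\mathcal{F}=\{F_i\}_{i\ge 0}$ with $1\in F_0$, $F_iF_j\subset F_{i+j}$, $A=\bigcup_i F_i$; it is finite-dimensional if every $F_i$ is. $\mathrm{gr}_{\mathcal F}A=\bigoplus_{i\ge0}F_i/F_{i-1}$ with $F_{-1}=0$. An affine algebra $A$ is vaguely commutative if it has a finite-dimensional filtration $\mathcal F$ such that $\mathrm{gr}_{\mathcal F}A$ is affine and commutative (where $F_0$ is allowed to be strictly larger than $k$). An affine algebra $A$ is modest if: (i) $\mathrm{GK}(M)=\max\{\mathrm{GK}(M'),\mathrm{GK}(M'')\}$ for every short exact sequence $0\to M'\to M\to M''\to0$ of finitely generated $A$-modules; (ii) $\mathrm{GK}(M)$ is a non-negative integer for every nonzero finitely generated $A$-module $M$; (iii) there is a function $e:A\text{-}\mathsf{mod}\to\mathbb{Q}_{\ge0}$ such that for every short exact sequence $0\to M'\to M\to M''\to 0$ of finitely generated $A$-modules: (a) if $\mathrm{GK}(M')<\mathrm{GK}(M)=\mathrm{GK}(M'')$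 then $e(M)=e(M'')$; (b) if $\mathrm{GK}(M')=\mathrm{GK}(M)>\mathrm{GK}(M'')$ then $e(M)=e(M')$; (c) if $\mathrm{GK}(M')=\mathrm{GK}(M)=\mathrm{GK}(M'')$ then $e(M)=e(M')+e(M'')$; and (d) $e(M)=0$ if and only if $M=0$. *)

theory Defs
  imports
    Complex_Main
    "HOL-Library.Extended_Real"
    "HOL-Library.Liminf_Limsup"
    "HOL-Algebra.Subrings"
    "HOL-Algebra.QuotRing"
    "Jordan_Normal_Form.Missing_VectorSpace"
begin

section \<open>Associative algebras and left modules\<close>

text \<open>The locales \<open>algebra\<close> and \<open>module\<close> of HOL-Algebra require commutativity (of the algebra,
  respectively of the coefficient ring), which must not be assumed here.  The zero ring is allowed.\<close>

locale assoc_algebra = V: vectorspace K A + A: ring A for K and A (structure) +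
  assumes smult_mult_left:
      "\<lbrakk>c \<in> carrier K; x \<in> carrier A; y \<in> carrier A\<rbrakk> \<Longrightarrow> c \<odot> (x \<otimes> y) = (c \<odot> x) \<otimes> y"
    and smult_mult_right:
      "\<lbrakk>c \<in> carrier K; x \<in> carrier A; y \<in> carrier A\<rbrakk> \<Longrightarrow> c \<odot> (x \<otimes> y) = x \<otimes> (c \<odot> y)"

locale left_module = A: ring A + M: abelian_group M
  for A :: "('a, 'y) ring_scheme" and M :: "('a, 'm, 'z) module_scheme" (structure) +
  assumes smult_closed:
      "\<lbrakk>a \<in> carrier A; x \<in> carrier M\<rbrakk> \<Longrightarrow> a \<odot> x \<in> carrier M"
    and smult_l_distr:
      "\<lbrakk>a \<in> carrier A; b \<in> carrier A; x \<in> carrier M\<rbrakk>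
        \<Longrightarrow> (a \<oplus>\<^bsub>A\<^esub> b) \<odot> x = a \<odot> x \<oplus> b \<odot> x"
    and smult_r_distr:
      "\<lbrakk>a \<in> carrier A; x \<in> carrier M; y \<in> carrier M\<rbrakk>
        \<Longrightarrow> a \<odot> (x \<oplus> y) = a \<odot> x \<oplus> a \<odot> y"
    and smult_assoc:
      "\<lbrakk>a \<in> carrier A; b \<in> carrier A; x \<in> carrier M\<rbrakk>
        \<Longrightarrow> (a \<otimes>\<^bsub>A\<^esub> b) \<odot> x = a \<odot> (b \<odot> x)"
    and smult_one:
      "x \<in> carrier M \<Longrightarrow> \<one>\<^bsub>A\<^esub> \<odot> x = x"

text \<open>\<open>Module.submodule\<close> (unlike the homonymous locale of the theory \<open>LinearCombinations\<close>) makes no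
  commutativity assumption, so it is also the right notion for left modules.\<close>

definition alg_generates :: "('k, 'x) ring_scheme \<Rightarrow> ('k, 'a) module \<Rightarrow> 'a set \<Rightarrow> bool" where
  "alg_generates K A S \<longleftrightarrow> S \<subseteq> carrier A \<and>
     (\<forall>B. subring B A \<and> Module.submodule B K A \<and> S \<subseteq> B \<longrightarrow> B = carrier A)"

definition mod_generates :: "('k, 'a) module \<Rightarrow> ('a, 'm) module \<Rightarrow> 'm set \<Rightarrow> bool" where
  "mod_generates A M S \<longleftrightarrow> S \<subseteq> carrier M \<and>
     (\<forall>N. Module.submodule N A M \<and> S \<subseteq> N \<longrightarrow> N = carrier M)"

definition affine_algebra :: "('k, 'x) ring_scheme \<Rightarrow> ('k, 'a) module \<Rightarrow> bool" where
  "affine_algebra K A \<longleftrightarrow> assoc_algebra K A \<and> (\<exists>S. finite S \<and> alg_generates K A S)"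

definition fg_modules :: "('k, 'a) module \<Rightarrow> ('a, 'm) module set" where
  "fg_modules A = {M. left_module A M \<and> (\<exists>S. finite S \<and> mod_generates A M S)}"

definition short_exact ::
  "('k, 'a) module \<Rightarrow> ('a, 'l) module \<Rightarrow> ('a, 'm) module \<Rightarrow> ('a, 'n) module \<Rightarrow> bool" where
  "short_exact A M' M M'' \<longleftrightarrow>
     (\<exists>f \<in> LinearCombinations.module_hom A M' M. \<exists>g \<in> LinearCombinations.module_hom A M M''.
        inj_on f (carrier M') \<and>
        f ` carrier M' = a_kernel M M'' g \<and>
        g ` carrier M = carrier M'')"


section \<open>Gelfand-Kirillov dimension\<close>

definition fin_dim_subspace :: "('k, 'x) ring_scheme \<Rightarrow> 'v set \<Rightarrow> ('k, 'v) module \<Rightarrow> bool" where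
  "fin_dim_subspace K W V \<longleftrightarrow>
     VectorSpace.subspace K W V \<and> vectorspace.fin_dim K (V\<lparr>carrier := W\<rparr>)"

text \<open>Restriction of scalars along \<open>c \<mapsto> c \<odot> 1\<close>; the fields \<open>mult\<close> and \<open>one\<close> of a module record
  are irrelevant.\<close>

definition restrict_scalars :: "('k, 'a) module \<Rightarrow> ('a, 'm) module \<Rightarrow> ('k, 'm) module" where
  "restrict_scalars A M =
     \<lparr>carrier = carrier M, mult = mult M, one = one M, zero = zero M, add = add M,
      smult = (\<lambda>c x. (c \<odot>\<^bsub>A\<^esub> \<one>\<^bsub>A\<^esub>) \<odot>\<^bsub>M\<^esub> x)\<rparr>"

primrec alg_power ::
  "('k, 'x) ring_scheme \<Rightarrow> ('k, 'a) module \<Rightarrow> 'a set \<Rightarrow> nat \<Rightarrow> 'a set" where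
  "alg_power K A V 0 = module.span K A {\<one>\<^bsub>A\<^esub>}"
| "alg_power K A V (Suc n) = module.span K A {x \<otimes>\<^bsub>A\<^esub> y | x y. x \<in> V \<and> y \<in> alg_power K A V n}"

definition act_space ::
  "('k, 'x) ring_scheme \<Rightarrow> ('k, 'a) module \<Rightarrow> ('a, 'm) module \<Rightarrow> 'a set \<Rightarrow> 'm set \<Rightarrow> 'm set" where
  "act_space K A M W F =
     module.span K (restrict_scalars A M) {w \<odot>\<^bsub>M\<^esub> x | w x. w \<in> W \<and> x \<in> F}"

definition GK_growth ::
  "('k, 'x) ring_scheme \<Rightarrow> ('k, 'a) module \<Rightarrow> ('a, 'm) module \<Rightarrow> 'a set \<Rightarrow> 'm set \<Rightarrow> ereal" where
  "GK_growth K A M V F =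
     limsup (\<lambda>n. ereal (log (real n) (real (vectorspace.dim K
       ((restrict_scalars A M)\<lparr>carrier := act_space K A M (alg_power K A V n) F\<rparr>)))))"

text \<open>The zero module is treated separately because \<open>log\<close> of \<open>0\<close> is not \<open>-\<infinity>\<close> in HOL.\<close>

definition GK :: "('k, 'x) ring_scheme \<Rightarrow> ('k, 'a) module \<Rightarrow> ('a, 'm) module \<Rightarrow> ereal" where
  "GK K A M =
     (if carrier M = {\<zero>\<^bsub>M\<^esub>} then -\<infinity>
      else (THE g. \<exists>V F.
        fin_dim_subspace K V A \<and> \<one>\<^bsub>A\<^esub> \<in> V \<and> alg_generates K A V \<and>
        fin_dim_subspace K F (restrict_scalars A M) \<and> mod_generates A M F \<and>
        g = GK_growth K A M V F))"


section \<open>Filtrations and vaguely commutative algebras\<close>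

definition filtration :: "('k, 'x) ring_scheme \<Rightarrow> ('k, 'a) module \<Rightarrow> (nat \<Rightarrow> 'a set) \<Rightarrow> bool" where
  "filtration K A F \<longleftrightarrow>
     (\<forall>i. VectorSpace.subspace K (F i) A) \<and>
     (\<forall>i. F i \<subseteq> F (Suc i)) \<and>
     \<one>\<^bsub>A\<^esub> \<in> F 0 \<and>
     (\<forall>i j. \<forall>x \<in> F i. \<forall>y \<in> F j. x \<otimes>\<^bsub>A\<^esub> y \<in> F (i + j)) \<and>
     (\<Union>i. F i) = carrier A"

definition fin_dim_filtration ::
  "('k, 'x) ring_scheme \<Rightarrow> ('k, 'a) module \<Rightarrow> (nat \<Rightarrow> 'a set) \<Rightarrow> bool" where
  "fin_dim_filtration K A F \<longleftrightarrow> filtration K A F \<and> (\<forall>i. fin_dim_subspace K (F i) A)"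

primrec filt_pred :: "('k, 'a) module \<Rightarrow> (nat \<Rightarrow> 'a set) \<Rightarrow> nat \<Rightarrow> 'a set" where
  "filt_pred A F 0 = {\<zero>\<^bsub>A\<^esub>}"
| "filt_pred A F (Suc i) = F i"

text \<open>An element of the associated graded algebra is a finitely supported sequence \<open>x\<close> whose \<open>i\<close>-th
  component is a coset of \<open>F\<^sub>i\<^sub>-\<^sub>1\<close> in \<open>F\<^sub>i\<close>; the zero coset is \<open>F\<^sub>i\<^sub>-\<^sub>1\<close> itself.  The product of the
  classes of \<open>a \<in> F\<^sub>i\<close> and \<open>b \<in> F\<^sub>j\<close> is the class of \<open>ab\<close> modulo \<open>F\<^sub>i\<^sub>+\<^sub>j\<^sub>-\<^sub>1\<close>, which is what
  \<open>rcoset_mult\<close> computes; the components of degree \<open>n\<close> are summed (by \<open>finprod\<close>) in the quotient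
  of the additive group of \<open>A\<close> by \<open>F\<^sub>n\<^sub>-\<^sub>1\<close>.\<close>

definition assoc_graded :: "('k, 'a) module \<Rightarrow> (nat \<Rightarrow> 'a set) \<Rightarrow> ('k, nat \<Rightarrow> 'a set) module" where
  "assoc_graded A F =
     \<lparr>carrier = {x. (\<forall>i. x i \<in> a_rcosets\<^bsub>A\<lparr>carrier := F i\<rparr>\<^esub> (filt_pred A F i)) \<and>
                    finite {i. x i \<noteq> filt_pred A F i}},
      mult = (\<lambda>x y n. finprod (A A_Mod (filt_pred A F n))
                (\<lambda>i. rcoset_mult A (filt_pred A F n) (x i) (y (n - i))) {..n}),
      one = (\<lambda>i. if i = 0 then filt_pred A F 0 +>\<^bsub>A\<^esub> \<one>\<^bsub>A\<^esub> else filt_pred A F i),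
      zero = filt_pred A F,
      add = (\<lambda>x y i. x i <+>\<^bsub>A\<^esub> y i),
      smult = (\<lambda>c x i. \<Union>a \<in> x i. filt_pred A F i +>\<^bsub>A\<^esub> (c \<odot>\<^bsub>A\<^esub> a))\<rparr>"

definition vaguely_commutative :: "('k, 'x) ring_scheme \<Rightarrow> ('k, 'a) module \<Rightarrow> bool" where
  "vaguely_commutative K A \<longleftrightarrow> affine_algebra K A \<and>
     (\<exists>F. fin_dim_filtration K A F \<and>
          affine_algebra K (assoc_graded A F) \<and> cring (assoc_graded A F))"


section \<open>Modest algebras\<close>

text \<open>The type argument \<open>'m\<close> is the universe in which the underlying sets of modules live; HOL
  cannot quantify over it inside a definition, so statements about modest algebras are to be made
  for arbitrary \<open>'m\<close>.  A single choice such as \<open>(nat \<Rightarrow> 'a) set\<close> already contains a copy of every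
  finitely generated module (a quotient of some power of \<open>A\<close>).\<close>

definition modest_algebra ::
  "'m itself \<Rightarrow> ('k, 'x) ring_scheme \<Rightarrow> ('k, 'a) module \<Rightarrow> bool" where
  "modest_algebra (_ :: 'm itself) K A \<longleftrightarrow> affine_algebra K A \<and>
     (\<forall>M' \<in> fg_modules A. \<forall>M \<in> fg_modules A. \<forall>M'' \<in> fg_modules A.
        short_exact A M' M (M'' :: ('a, 'm) module) \<longrightarrow>
          GK K A (M :: ('a, 'm) module) = max (GK K A (M' :: ('a, 'm) module)) (GK K A M'')) \<and>
     (\<forall>M \<in> fg_modules A. carrier (M :: ('a, 'm) module) \<noteq> {\<zero>\<^bsub>M\<^esub>} \<longrightarrow>
          (\<exists>d :: nat. GK K A M = ereal (real d))) \<and>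
     (\<exists>e :: ('a, 'm) module \<Rightarrow> rat.
        (\<forall>M \<in> fg_modules A. e M \<ge> 0) \<and>
        (\<forall>M' \<in> fg_modules A. \<forall>M \<in> fg_modules A. \<forall>M'' \<in> fg_modules A.
           short_exact A M' M M'' \<longrightarrow>
             (GK K A M' < GK K A M \<and> GK K A M = GK K A M'' \<longrightarrow> e M = e M'') \<and>
             (GK K A M' = GK K A M \<and> GK K A M > GK K A M'' \<longrightarrow> e M = e M') \<and>
             (GK K A M' = GK K A M \<and> GK K A M = GK K A M'' \<longrightarrow> e M = e M' + e M'')) \<and>
        (\<forall>M \<in> fg_modules A. e M = 0 \<longleftrightarrow> carrier M = {\<zero>\<^bsub>M\<^esub>}))"

end

theory Submission
  imports Defs "HOL-Library.Multiset_Order" "HOL-Library.Product_Lexorder"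
begin

text \<open>
  Since the associated graded algebra is commutative and generated in degrees at most \<open>D\<close>, every
  module \<open>M\<close> generated by a finite set \<open>S\<close> is filtered by the spaces \<open>F\<^sub>n S\<close>, and these are
  spanned by ordered monomials of weight at most \<open>n\<close> applied to finitely many vectors; reordering
  the factors costs only terms of smaller weight.  For a well-order on monomials that refines the
  weight, Groebner basis theory therefore works in \<open>M\<close> itself, without passing to the
  associated graded module.  The dimension of \<open>F\<^sub>n S\<close> counts standard monomials, which are closed
  under divisibility; hence it is asymptotic to \<open>c n\<^sup>d\<close> with \<open>c\<close> a positive rational, where
  \<open>d\<close> is the Gelfand-Kirillov dimension and \<open>c\<close> serves as multiplicity.  The filtration that \<open>M\<close>
  induces on a submodule agrees up to a shift with the one given by a Groebner basis of the
  submodule, so rank-nullity yields the behaviour of \<open>d\<close> and \<open>c\<close> on exact sequences.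
\<close>

section \<open>Polynomial growth\<close>

text \<open>Dimensions of \<open>F n S\<close> are counted up to weight n, and this is what makes a
  limit exist. With generators of several degrees, the number of standard monomials of weight
  exactly n may oscillate (a single variable of weight 2 gives 1, 0, 1, 0, ...), while the number of
  those of weight at most n is asymptotic to a monomial in n. The coefficient is rational because it
  arises from recurrences h(n) = g(n) + h(n - e), each of which divides it by e(d + 1). A leading
  coefficient, unlike a Hilbert function, does not see a shift of the argument. The choice of
  generators and the discrepancy between two filtrations of a submodule are therefore dealt with by
  the same estimate. Since \<open>F 0\<close> may be larger than k, its elements cannot serve as
  variables: weight 0 would allow infinitely many monomials of bounded weight. They are absorbed
  into the generators of the module instead. The condition c > 0 makes the pair (d, c) unique but
  rules out the zero function, hence the separate treatment of the zero module throughout.\<close>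

definition has_growth :: "(nat \<Rightarrow> nat) \<Rightarrow> nat \<Rightarrow> rat \<Rightarrow> bool" where
  "has_growth h d c \<longleftrightarrow> c > 0 \<and> (\<lambda>n. real (h n) / real n ^ d) \<longlonglongrightarrow> of_rat c"

lemma LIMSEQ_cong_pos:
  fixes X Y :: "nat \<Rightarrow> real"
  assumes "X \<longlonglongrightarrow> L" "\<And>n. 0 < n \<Longrightarrow> X n = Y n" "L = L'"
  shows "Y \<longlonglongrightarrow> L'"
proof -
  have "eventually (\<lambda>n. X n = Y n) sequentially"
    by (rule eventually_mono[OF eventually_gt_at_top[of 0]]) (rule assms(2))
  thus ?thesis using assms by (auto intro: Lim_transform_eventually)
qed

lemma ratio_power_tendsto_1:
  "(\<lambda>n. (real (n + s) / real n) ^ d) \<longlonglongrightarrow> 1"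
proof -
  have "(\<lambda>n. 1 + real s * inverse (real n)) \<longlonglongrightarrow> 1 + real s * 0"
    by (intro tendsto_intros lim_inverse_n)
  hence "(\<lambda>n. real (n + s) / real n) \<longlonglongrightarrow> 1"
  proof (rule LIMSEQ_cong_pos)
    show "1 + real s * inverse (real n) = real (n + s) / real n" if "0 < n" for n
      using that by (simp add: field_simps)
  qed simp
  from tendsto_power[OF this, of d] show ?thesis by simp
qed

lemma has_growth_shift:
  assumes "has_growth h d c"
  shows "(\<lambda>n. real (h (n + s)) / real n ^ d) \<longlonglongrightarrow> of_rat c"
proof -
  have "(\<lambda>n. real (h n) / real n ^ d) \<longlonglongrightarrow> of_rat c"
    using assms by (simp add: has_growth_def)
  from LIMSEQ_ignore_initial_segment[OF this, of s] ratio_power_tendsto_1[of s d]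
  have "(\<lambda>n. real (h (n + s)) / real (n + s) ^ d * (real (n + s) / real n) ^ d)
      \<longlonglongrightarrow> of_rat c * 1"
    by (rule tendsto_mult)
  thus ?thesis
  proof (rule LIMSEQ_cong_pos)
    show "real (h (n + s)) / real (n + s) ^ d * (real (n + s) / real n) ^ d
        = real (h (n + s)) / real n ^ d" if "0 < n" for n
      using that by (simp add: field_simps)
  qed simp
qed

text \<open>Squeezing k(n + s) between h(n) and h(n + 2s) fixes its leading term, and undoing the
  offset changes n^d only by a factor tending to 1. Independence of generators and the comparison of
  filtrations both rest on this.\<close>

lemma has_growth_sandwich:
  assumes g: "has_growth h d c" and 1: "\<And>n. k n \<le> h (n + s)" and 2: "\<And>n. h n \<le> k (n + s)"
  shows "has_growth k d c"
proof -
  have "c > 0" using g by (simp add: has_growth_def)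
  have up: "(\<lambda>n. real (h (n + s + s)) / real n ^ d) \<longlonglongrightarrow> of_rat c"
    using has_growth_shift[OF g, of "s + s"] by (simp add: add.assoc)
  have lo: "(\<lambda>n. real (h n) / real n ^ d) \<longlonglongrightarrow> of_rat c"
    using g by (simp add: has_growth_def)
  have shifted: "(\<lambda>n. real (k (n + s)) / real n ^ d) \<longlonglongrightarrow> of_rat c"
    by (rule tendsto_sandwich[OF _ _ lo up])
      (use 1 2 in \<open>auto intro!: always_eventually divide_right_mono\<close>)
  have "(\<lambda>n. real (k (n + s)) / real n ^ d / (real (n + s) / real n) ^ d) \<longlonglongrightarrow> of_rat c / 1"
    by (intro tendsto_divide shifted ratio_power_tendsto_1) simp
  hence "(\<lambda>n. real (k (n + s)) / real (n + s) ^ d) \<longlonglongrightarrow> of_rat c"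
  proof (rule LIMSEQ_cong_pos)
    show "real (k (n + s)) / real n ^ d / (real (n + s) / real n) ^ d
        = real (k (n + s)) / real (n + s) ^ d" if "0 < n" for n
      using that by (simp add: field_simps)
  qed simp
  hence "(\<lambda>n. real (k n) / real n ^ d) \<longlonglongrightarrow> of_rat c"
    by (rule LIMSEQ_offset)
  thus ?thesis using \<open>c > 0\<close> by (simp add: has_growth_def)
qed

lemma has_growth_lower_order:
  assumes "has_growth f d c" "d < d'"
  shows "(\<lambda>n. real (f n) / real n ^ d') \<longlonglongrightarrow> 0"
proof -
  have "(\<lambda>n. inverse (real n) ^ (d' - d)) \<longlonglongrightarrow> 0 ^ (d' - d)"
    by (intro tendsto_power lim_inverse_n)
  hence "(\<lambda>n. inverse (real n) ^ (d' - d)) \<longlonglongrightarrow> 0"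
    using assms(2) by (simp add: power_0_left)
  moreover have "(\<lambda>n. real (f n) / real n ^ d) \<longlonglongrightarrow> of_rat c"
    using assms(1) by (simp add: has_growth_def)
  ultimately have "(\<lambda>n. real (f n) / real n ^ d * inverse (real n) ^ (d' - d)) \<longlonglongrightarrow> of_rat c * 0"
    by (intro tendsto_mult)
  moreover have "real (f n) / real n ^ d * inverse (real n) ^ (d' - d) = real (f n) / real n ^ d'" for n
  proof -
    have "real n ^ d' = real n ^ d * real n ^ (d' - d)"
      using assms(2) by (simp flip: power_add)
    thus ?thesis by (simp add: divide_simps)
  qed
  ultimately show ?thesis by simp
qed

lemma has_growth_add_eq:
  assumes "has_growth f d c" "has_growth g d c'"
  shows "has_growth (\<lambda>n. f n + g n) d (c + c')"
proof -
  have "(\<lambda>n. real (f n) / real n ^ d + real (g n) / real n ^ d) \<longlonglongrightarrow> of_rat c + of_rat c'"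
    using assms by (intro tendsto_add) (auto simp: has_growth_def)
  thus ?thesis using assms
    by (simp add: has_growth_def add_divide_distrib of_rat_add)
qed

lemma has_growth_add_less:
  assumes "has_growth f d c" "has_growth g d' c'" "d < d'"
  shows "has_growth (\<lambda>n. f n + g n) d' c'"
proof -
  have "(\<lambda>n. real (f n) / real n ^ d' + real (g n) / real n ^ d') \<longlonglongrightarrow> 0 + of_rat c'"
    using assms has_growth_lower_order[OF assms(1,3)]
    by (intro tendsto_add) (auto simp: has_growth_def)
  thus ?thesis using assms
    by (simp add: has_growth_def add_divide_distrib)
qed

lemma has_growth_add:
  assumes "has_growth f d c" "has_growth g d' c'"
  shows "\<exists>c''. has_growth (\<lambda>n. f n + g n) (max d d') c''"
proof (cases d d' rule: linorder_cases)
  case greater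
  with has_growth_add_less[OF assms(2,1)] show ?thesis
    by (auto simp: add.commute max_def)
qed (use has_growth_add_less[OF assms] has_growth_add_eq[OF assms(1)] assms(2) in \<open>auto simp: max_def\<close>)

lemma has_growth_unique:
  assumes "has_growth f d c" "has_growth f d' c'"
  shows "d = d' \<and> c = c'"
proof -
  have *: "\<not> d < d'" if f: "has_growth f d c" "has_growth f d' c'" for d d' c c'
  proof
    assume "d < d'"
    with f have "(\<lambda>n. real (f n) / real n ^ d') \<longlonglongrightarrow> 0"
      by (auto intro: has_growth_lower_order)
    moreover have "(\<lambda>n. real (f n) / real n ^ d') \<longlonglongrightarrow> of_rat c'"
      using f by (simp add: has_growth_def)
    ultimately have "(of_rat c' :: real) = 0" by (metis LIMSEQ_unique)
    thus False using f by (simp add: has_growth_def)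
  qed
  from *[OF assms] *[OF assms(2,1)] have d: "d = d'" by simp
  hence "(of_rat c :: real) = of_rat c'"
    using assms unfolding has_growth_def by (metis LIMSEQ_unique)
  thus ?thesis using d by simp
qed

text \<open>Discrete derivative of n^(d+1) with step e. Its leading coefficient e(d + 1) is the
  divisor that appears in \<open>has_growth_recurrence\<close>.\<close>

lemma power_difference_growth:
  "(\<lambda>n. (real n ^ Suc d - (real n - real e) ^ Suc d) / real n ^ d) \<longlonglongrightarrow> real e * real (Suc d)"
proof -
  have "(\<lambda>n. 1 - real e * inverse (real n)) \<longlonglongrightarrow> 1 - real e * 0"
    by (intro tendsto_intros lim_inverse_n)
  hence "(\<lambda>n. real e * (\<Sum>i<Suc d. (1 - real e * inverse (real n)) ^ (d - i))) \<longlonglongrightarrow>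
      real e * (\<Sum>i<Suc d. (1 - real e * 0) ^ (d - i))"
    by (rule tendsto_mult[OF tendsto_const tendsto_sum[OF tendsto_power]])
  hence *: "(\<lambda>n. real e * (\<Sum>i<Suc d. (1 - real e * inverse (real n)) ^ (d - i))) \<longlonglongrightarrow>
      real e * real (Suc d)" by simp
  thus ?thesis
  proof (rule LIMSEQ_cong_pos)
    fix n :: nat assume n: "0 < n"
    have "real n ^ Suc d - (real n - real e) ^ Suc d
        = real e * (\<Sum>i<Suc d. (real n - real e) ^ (d - i) * real n ^ i)"
      using power_diff_sumr2[of "real n" "Suc d" "real n - real e"] by simp
    moreover have "(real n - real e) ^ (d - i) * real n ^ i / real n ^ d
        = (1 - real e * inverse (real n)) ^ (d - i)" if "i < Suc d" for i
    proof -
      have "real n ^ d = real n ^ (d - i) * real n ^ i"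
        using that by (simp flip: power_add)
      hence "(real n - real e) ^ (d - i) * real n ^ i / real n ^ d = ((real n - real e) / real n) ^ (d - i)"
        using n by (simp add: power_divide)
      moreover have "(real n - real e) / real n = 1 - real e * inverse (real n)"
        using n by (simp add: field_simps)
      ultimately show ?thesis by simp
    qed
    ultimately show "real e * (\<Sum>i<Suc d. (1 - real e * inverse (real n)) ^ (d - i)) =
        (real n ^ Suc d - (real n - real e) ^ Suc d) / real n ^ d"
      by (simp add: sum_divide_distrib flip: times_divide_eq_right del: sum.lessThan_Suc)
  qed simp
qed

text \<open>Unrolling adds the values of g at n, n - e, n - 2e, ..., about one value in e, and
  summation raises the degree by one; hence the divisor e(d + 1).\<close>

lemma has_growth_recurrence:
  assumes g: "has_growth g d c" and e: "e \<ge> 1"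
    and rec: "\<And>n. h n = g n + (if n \<ge> e then h (n - e) else 0)"
  shows "has_growth h (Suc d) (c / (of_nat e * of_nat (Suc d)))"
proof -
  define c' where "c' = (of_rat c :: real) / (real e * real (Suc d))"
  \<comment> \<open>E is the error against the expected main term. The constant c' is chosen so that
    the limit in \<open>lim\<close> vanishes, that is, so that E changes only by o(n^d) from n - e
    to n.\<close>
  define E where "E n = real (h n) - c' * real n ^ Suc d" for n
  have lim: "(\<lambda>n. real (g n) / real n ^ d - c' * ((real n ^ Suc d - (real n - real e) ^ Suc d) / real n ^ d))
      \<longlonglongrightarrow> of_rat c - c' * (real e * real (Suc d))"
    using g by (intro tendsto_diff tendsto_mult tendsto_const power_difference_growth)
      (auto simp: has_growth_def)
  have zero: "of_rat c - c' * (real e * real (Suc d)) = 0"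
    using e by (simp add: c'_def)
  \<comment> \<open>Increments of at most \<epsilon> n^d accumulate to at most \<epsilon> n^(d+1).
    The constant C collects the finitely many errors before the estimate on increments takes
    effect.\<close>
  have small: "\<exists>C. \<forall>n. \<bar>E n\<bar> \<le> C + \<epsilon> * real n ^ Suc d" if \<epsilon>: "\<epsilon> > 0" for \<epsilon>
  proof -
    from LIMSEQ_D[OF lim \<epsilon>] obtain N where N: "\<And>n. n \<ge> N \<Longrightarrow>
      \<bar>real (g n) / real n ^ d - c' * ((real n ^ Suc d - (real n - real e) ^ Suc d) / real n ^ d)\<bar> < \<epsilon>"
      unfolding zero by auto
    define C where "C = (\<Sum>n<N + e. \<bar>E n\<bar>)"
    have "\<bar>E n\<bar> \<le> C + \<epsilon> * real n ^ Suc d" for n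
    proof (induction n rule: less_induct)
      case (less n)
      show ?case
      proof (cases "n < N + e")
        case True
        hence "\<bar>E n\<bar> \<le> C" unfolding C_def by (intro member_le_sum) auto
        moreover have "\<epsilon> * real n ^ Suc d \<ge> 0" using \<epsilon> by simp
        ultimately show ?thesis by linarith
      next
        case False
        hence n: "n \<ge> N" "n \<ge> e" "n > 0" using e by auto
        have "real (g n) / real n ^ d - c' * ((real n ^ Suc d - (real n - real e) ^ Suc d) / real n ^ d)
            = (real (g n) - c' * (real n ^ Suc d - (real n - real e) ^ Suc d)) / real n ^ d"
          by (simp only: diff_divide_distrib[of "real (g n)"] times_divide_eq_right)
        with N[OF n(1)] n(3) have
          "\<bar>real (g n) - c' * (real n ^ Suc d - (real n - real e) ^ Suc d)\<bar> \<le> \<epsilon> * real n ^ d"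
          by (simp add: abs_divide field_simps)
        moreover have "E n - E (n - e) = real (g n) - c' * (real n ^ Suc d - (real n - real e) ^ Suc d)"
          using rec[of n] n(2) by (simp add: E_def of_nat_diff algebra_simps)
        ultimately have "\<bar>E n\<bar> \<le> \<bar>E (n - e)\<bar> + \<epsilon> * real n ^ d" by linarith
        also have "\<bar>E (n - e)\<bar> \<le> C + \<epsilon> * real (n - e) ^ Suc d"
          using less[of "n - e"] n e by simp
        \<comment> \<open>Since e is at least 1, one of the n copies of n^d remains free and takes
          up the increment of this step.\<close>
        also have "real (n - e) ^ Suc d \<le> (real n - 1) * real n ^ d"
          using n e by (auto simp: of_nat_diff intro!: mult_mono power_mono)
        finally have "\<bar>E n\<bar> \<le> C + \<epsilon> * ((real n - 1) * real n ^ d) + \<epsilon> * real n ^ d"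
          using \<epsilon> by simp
        thus ?thesis by (simp add: algebra_simps)
      qed
    qed
    thus ?thesis by blast
  qed
  have "(\<lambda>n. E n / real n ^ Suc d) \<longlonglongrightarrow> 0"
  proof (rule LIMSEQ_I)
    fix r :: real assume r: "r > 0"
    from small[of "r / 2"] r obtain C where C: "\<And>n. \<bar>E n\<bar> \<le> C + r / 2 * real n ^ Suc d" by auto
    obtain N :: nat where N: "real N > 2 * \<bar>C\<bar> / r" using reals_Archimedean2 by blast
    show "\<exists>no. \<forall>n\<ge>no. norm (E n / real n ^ Suc d - 0) < r"
    proof (intro exI allI impI)
      fix n assume n: "n \<ge> Suc N"
      hence n0: "real n > 0" by simp
      have "2 * \<bar>C\<bar> < r * real N" using N r by (simp add: field_simps)
      also have "\<dots> \<le> r * real n ^ Suc d"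
      proof -
        have "real N \<le> real n" using n by simp
        also have "real n \<le> real n ^ Suc d"
          using n self_le_power[of "real n" "Suc d"] by simp
        finally show ?thesis using r by simp
      qed
      finally have "C < r / 2 * real n ^ Suc d" by simp
      with C[of n] have "\<bar>E n\<bar> < r * real n ^ Suc d" by (simp add: field_simps)
      thus "norm (E n / real n ^ Suc d - 0) < r"
        using n0 by (simp add: abs_divide field_simps)
    qed
  qed
  hence "(\<lambda>n. E n / real n ^ Suc d + c') \<longlonglongrightarrow> 0 + c'" by (intro tendsto_intros)
  hence "(\<lambda>n. real (h n) / real n ^ Suc d) \<longlonglongrightarrow> 0 + c'"
  proof (rule LIMSEQ_cong_pos)
    show "E n / real n ^ Suc d + c' = real (h n) / real n ^ Suc d" if "0 < n" for n
      using that by (simp add: E_def field_simps)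
  qed simp
  moreover have "c' = of_rat (c / (of_nat e * of_nat (Suc d)))"
    by (simp add: c'_def of_rat_divide of_rat_mult of_rat_add)
  ultimately show ?thesis using g e by (simp add: has_growth_def)
qed

section \<open>Logarithmic growth rates\<close>

lemma has_growth_eventually_bounds:
  assumes "has_growth h d c"
  shows "\<exists>C>0. eventually (\<lambda>n. real (h n) \<le> C * real n ^ d) sequentially"
    and "\<exists>C>0. eventually (\<lambda>n. C * real n ^ d \<le> real (h n)) sequentially"
proof -
  have c: "(of_rat c :: real) > 0" and lim: "(\<lambda>n. real (h n) / real n ^ d) \<longlonglongrightarrow> of_rat c"
    using assms by (auto simp: has_growth_def)
  have "eventually (\<lambda>n. real (h n) / real n ^ d < 2 * of_rat c \<and> n > 0) sequentially"
    by (intro eventually_conj order_tendstoD(2)[OF lim] eventually_gt_at_top) (use c in linarith)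
  hence "eventually (\<lambda>n. real (h n) \<le> 2 * of_rat c * real n ^ d) sequentially"
    by eventually_elim (auto simp: divide_less_eq intro: less_imp_le)
  thus "\<exists>C>0. eventually (\<lambda>n. real (h n) \<le> C * real n ^ d) sequentially"
    using c by (intro exI[of _ "2 * of_rat c"]) auto
  have "eventually (\<lambda>n. of_rat c / 2 < real (h n) / real n ^ d \<and> n > 0) sequentially"
    by (intro eventually_conj order_tendstoD(1)[OF lim] eventually_gt_at_top) (use c in linarith)
  hence "eventually (\<lambda>n. of_rat c / 2 * real n ^ d \<le> real (h n)) sequentially"
    by eventually_elim (auto simp: less_divide_eq intro: less_imp_le)
  thus "\<exists>C>0. eventually (\<lambda>n. C * real n ^ d \<le> real (h n)) sequentially"
    using c by (intro exI[of _ "of_rat c / 2"]) auto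
qed

text \<open>A constant factor B contributes ln B / ln n, which tends to 0, so only the exponent
  survives. Two-sided bounds turn the limes superior into a limit.\<close>

lemma limsup_log_polynomial_growth:
  fixes h :: "nat \<Rightarrow> real"
  assumes "C > 0" "C' > 0"
    and lo: "eventually (\<lambda>n. C * real n ^ d \<le> h n) sequentially"
    and up: "eventually (\<lambda>n. h n \<le> C' * real n ^ d) sequentially"
  shows "limsup (\<lambda>n. ereal (log (real n) (h n))) = ereal (real d)"
proof -
  have ln: "(\<lambda>n. inverse (ln (real n))) \<longlonglongrightarrow> 0"
    by (intro tendsto_inverse_0_at_top filterlim_compose[OF ln_at_top filterlim_real_sequentially])
  have lim: "(\<lambda>n. real d + ln B * inverse (ln (real n))) \<longlonglongrightarrow> real d" for B :: real
    using tendsto_add[OF tendsto_const tendsto_mult[OF tendsto_const ln]] by fastforce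
  have log: "log (real n) (B * real n ^ d) = real d + ln B * inverse (ln (real n))"
    if "B > 0" "n > 1" for B :: real and n :: nat
    using that by (simp add: log_def ln_mult ln_realpow field_simps)
  have "(\<lambda>n. log (real n) (h n)) \<longlonglongrightarrow> real d"
  proof (rule tendsto_sandwich[OF _ _ lim[of C] lim[of C']])
    show "\<forall>\<^sub>F n in sequentially. real d + ln C * inverse (ln (real n)) \<le> log (real n) (h n)"
      using lo eventually_gt_at_top[of 1]
    proof eventually_elim
      case (elim n)
      hence "log (real n) (C * real n ^ d) \<le> log (real n) (h n)"
        using assms(1) by (intro log_mono) auto
      thus ?case using log[OF assms(1)] elim by simp
    qed
    show "\<forall>\<^sub>F n in sequentially. log (real n) (h n) \<le> real d + ln C' * inverse (ln (real n))"
      using lo up eventually_gt_at_top[of 1]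
    proof eventually_elim
      case (elim n)
      have "0 < C * real n ^ d" using assms(1) elim by simp
      hence "log (real n) (h n) \<le> log (real n) (C' * real n ^ d)"
        using elim by (intro log_mono) auto
      thus ?case using log[OF assms(2)] elim by simp
    qed
  qed
  hence "(\<lambda>n. ereal (log (real n) (h n))) \<longlonglongrightarrow> ereal (real d)" by simp
  thus ?thesis by (intro lim_imp_Limsup) auto
qed

section \<open>Sets of monomials\<close>

text \<open>Induction on the set of variables. Deleting v from all members of U (the map T) leaves a
  family with a finite basis, whose lifts to U have bounded exponent of v. Members of U with a
  larger exponent are divisible by a lift; the others fall into finitely many slices of constant
  exponent, on which divisibility is decided after deletion of v.\<close>

lemma dickson:
  assumes "finite V" "U \<subseteq> {\<alpha>. set_mset \<alpha> \<subseteq> V}"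
  shows "\<exists>B. finite B \<and> B \<subseteq> U \<and> (\<forall>\<alpha>\<in>U. \<exists>\<beta>\<in>B. \<beta> \<subseteq># \<alpha>)"
  using assms
proof (induction V arbitrary: U rule: finite_induct)
  case empty
  hence "U \<subseteq> {{#}}" by auto
  thus ?case by (intro exI[of _ U]) (auto intro: finite_subset)
next
  case (insert v V)
  define T where "T = filter_mset ((\<noteq>) v)"
  have T_sub: "T ` U' \<subseteq> {\<alpha>. set_mset \<alpha> \<subseteq> V}" if "U' \<subseteq> U" for U'
    using insert.prems that by (fastforce simp: T_def)
  have count_T: "count (T \<alpha>) x = (if x = v then 0 else count \<alpha> x)" for \<alpha> x
    by (simp add: T_def)
  obtain BT where BT: "finite BT" "BT \<subseteq> T ` U" "\<And>\<alpha>. \<alpha> \<in> T ` U \<Longrightarrow> \<exists>\<beta>\<in>BT. \<beta> \<subseteq># \<alpha>"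
    using insert.IH[OF T_sub[OF order_refl]] by meson
  from BT(2) have "\<forall>\<beta>\<in>BT. \<exists>\<gamma>. \<gamma> \<in> U \<and> T \<gamma> = \<beta>" by blast
  then obtain g where g: "\<And>\<beta>. \<beta> \<in> BT \<Longrightarrow> g \<beta> \<in> U \<and> T (g \<beta>) = \<beta>" by metis
  \<comment> \<open>The sum serves as an upper bound for the exponents of v in the chosen lifts;
    slices are needed only below it.\<close>
  define k0 where "k0 = (\<Sum>\<beta>\<in>BT. count (g \<beta>) v)"
  have k0: "count (g \<beta>) v \<le> k0" if "\<beta> \<in> BT" for \<beta>
    unfolding k0_def using that BT(1) by (intro member_le_sum) auto
  define S where "S k = {\<alpha>\<in>U. count \<alpha> v = k}" for k
  have "\<forall>k. \<exists>B. finite B \<and> B \<subseteq> S k \<and> (\<forall>\<alpha>\<in>S k. \<exists>\<beta>\<in>B. \<beta> \<subseteq># \<alpha>)"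
  proof
    fix k
    have "T ` S k \<subseteq> {\<alpha>. set_mset \<alpha> \<subseteq> V}" by (rule T_sub) (auto simp: S_def)
    from insert.IH[OF this] obtain B
      where B: "finite B" "B \<subseteq> T ` S k" "\<And>\<alpha>. \<alpha> \<in> T ` S k \<Longrightarrow> \<exists>\<beta>\<in>B. \<beta> \<subseteq># \<alpha>"
      by meson
    then obtain B' where B': "finite B'" "B' \<subseteq> S k" "B = T ` B'"
      by (meson finite_subset_image)
    have "\<exists>\<beta>\<in>B'. \<beta> \<subseteq># \<alpha>" if \<alpha>: "\<alpha> \<in> S k" for \<alpha>
    proof -
      obtain \<beta> where \<beta>: "\<beta> \<in> B'" "T \<beta> \<subseteq># T \<alpha>" using B(3)[of "T \<alpha>"] \<alpha> B'(3) by auto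
      have "count \<beta> v = count \<alpha> v" using \<beta>(1) B'(2) \<alpha> by (auto simp: S_def)
      hence "count \<beta> x \<le> count \<alpha> x" for x
        using mset_subset_eq_count[OF \<beta>(2), of x] by (cases "x = v") (auto simp: count_T)
      thus ?thesis using \<beta>(1) by (auto simp: subseteq_mset_def)
    qed
    thus "\<exists>B. finite B \<and> B \<subseteq> S k \<and> (\<forall>\<alpha>\<in>S k. \<exists>\<beta>\<in>B. \<beta> \<subseteq># \<alpha>)"
      using B'(1,2) by blast
  qed
  then obtain B where B: "\<And>k. finite (B k)" "\<And>k. B k \<subseteq> S k"
    "\<And>k \<alpha>. \<alpha> \<in> S k \<Longrightarrow> \<exists>\<beta>\<in>B k. \<beta> \<subseteq># \<alpha>"
    by metis
  have "\<exists>\<beta>\<in>g ` BT \<union> (\<Union>k<k0. B k). \<beta> \<subseteq># \<alpha>" if \<alpha>: "\<alpha> \<in> U" for \<alpha>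
  proof (cases "count \<alpha> v < k0")
    case True
    thus ?thesis using B(3)[of \<alpha> "count \<alpha> v"] \<alpha> by (auto simp: S_def)
  next
    case False
    obtain \<beta> where \<beta>: "\<beta> \<in> BT" "\<beta> \<subseteq># T \<alpha>" using BT(3)[of "T \<alpha>"] \<alpha> by auto
    have "count (g \<beta>) x \<le> count \<alpha> x" for x
    proof (cases "x = v")
      case True
      thus ?thesis using k0[OF \<beta>(1)] False by simp
    next
      case neq: False
      have "count (g \<beta>) x = count \<beta> x" using g[OF \<beta>(1)] count_T[of "g \<beta>" x] neq by simp
      thus ?thesis using mset_subset_eq_count[OF \<beta>(2), of x] neq by (simp add: count_T)
    qed
    thus ?thesis using \<beta>(1) by (auto simp: subseteq_mset_def)
  qed
  moreover have "g ` BT \<union> (\<Union>k<k0. B k) \<subseteq> U" using g B(2) by (auto simp: S_def)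
  moreover have "finite (g ` BT \<union> (\<Union>k<k0. B k))" using BT(1) B(1) by auto
  ultimately show ?case by meson
qed

definition wt :: "('i \<Rightarrow> nat) \<Rightarrow> 'i multiset \<Rightarrow> nat" where
  "wt d \<alpha> = \<Sum>\<^sub># (image_mset d \<alpha>)"

lemma wt_empty [simp]: "wt d {#} = 0"
  and wt_add_mset [simp]: "wt d (add_mset i \<alpha>) = d i + wt d \<alpha>"
  and wt_union [simp]: "wt d (\<alpha> + \<beta>) = wt d \<alpha> + wt d \<beta>"
  by (simp_all add: wt_def)

lemma size_le_wt:
  assumes "\<And>i. i \<in># \<alpha> \<Longrightarrow> d i \<ge> 1"
  shows "size \<alpha> \<le> wt d \<alpha>"
  using assms
proof (induction \<alpha>)
  case (add i \<alpha>)
  have "d i \<ge> 1" "size \<alpha> \<le> wt d \<alpha>" using add.prems by (auto intro!: add.IH)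
  thus ?case by simp
qed simp

text \<open>Positive weights bound the number of factors by the weight. A variable of weight 0 would
  destroy this, which is why degree 0 of the filtration never contributes variables.\<close>

lemma finite_wt_le:
  assumes "finite V" "\<And>i. i \<in> V \<Longrightarrow> d i \<ge> 1"
  shows "finite {\<alpha>. set_mset \<alpha> \<subseteq> V \<and> wt d \<alpha> \<le> n}"
proof (rule finite_subset)
  show "{\<alpha>. set_mset \<alpha> \<subseteq> V \<and> wt d \<alpha> \<le> n} \<subseteq> mset ` {xs. set xs \<subseteq> V \<and> length xs \<le> n}"
  proof safe
    fix \<alpha> assume \<alpha>: "set_mset \<alpha> \<subseteq> V" "wt d \<alpha> \<le> n"
    have "size \<alpha> \<le> wt d \<alpha>" using \<alpha>(1) assms(2) by (intro size_le_wt) auto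
    moreover obtain xs where "mset xs = \<alpha>" using ex_mset by blast
    ultimately show "\<alpha> \<in> mset ` {xs. set xs \<subseteq> V \<and> length xs \<le> n}"
      using \<alpha> by (intro image_eqI[of _ _ xs]) auto
  qed
  show "finite (mset ` {xs. set xs \<subseteq> V \<and> length xs \<le> n})"
    using assms(1) by (intro finite_imageI finite_lists_length_le)
qed

text \<open>Here m is an exponent of v from which on membership in C no longer depends on further
  factors v. If m = 0, then C consists of all products of a v-free member with a power of v, and
  counting yields the recurrence of \<open>has_growth_recurrence\<close>. Otherwise C splits into
  its v-free part and v times the quotient set \<open>C1\<close>, for which m has dropped by
  one.\<close>

lemma has_growth_down_closed_step:
  fixes d :: "'i \<Rightarrow> nat" and C :: "'i multiset set"
  assumes V: "finite V" "v \<notin> V" and d: "\<And>i. i \<in> insert v V \<Longrightarrow> d i \<ge> 1"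
    and IH: "\<And>C. C \<subseteq> {\<alpha>. set_mset \<alpha> \<subseteq> V} \<Longrightarrow> (\<And>\<alpha> \<beta>. \<alpha> \<in> C \<Longrightarrow> \<beta> \<subseteq># \<alpha> \<Longrightarrow> \<beta> \<in> C) \<Longrightarrow>
      C \<noteq> {} \<Longrightarrow> \<exists>e c. has_growth (\<lambda>n. card {\<alpha>\<in>C. wt d \<alpha> \<le> n}) e c"
    and C: "C \<subseteq> {\<alpha>. set_mset \<alpha> \<subseteq> insert v V}"
    and down: "\<And>\<alpha> \<beta>. \<alpha> \<in> C \<Longrightarrow> \<beta> \<subseteq># \<alpha> \<Longrightarrow> \<beta> \<in> C"
    and "C \<noteq> {}"
    and stable: "\<And>\<alpha>. \<alpha> + replicate_mset m v \<in> C \<Longrightarrow> \<alpha> + replicate_mset (Suc m) v \<in> C"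
  shows "\<exists>e c. has_growth (\<lambda>n. card {\<alpha>\<in>C. wt d \<alpha> \<le> n}) e c"
  using C down \<open>C \<noteq> {}\<close> stable
proof (induction m arbitrary: C)
  case (0 C)
  define C0 where "C0 = {\<alpha>\<in>C. v \<notin># \<alpha>}"
  define h where "h n = card {\<alpha>\<in>C. wt d \<alpha> \<le> n}" for n
  define g where "g n = card {\<alpha>\<in>C0. wt d \<alpha> \<le> n}" for n
  have "{#} \<in> C0" using 0(2)[of _ "{#}"] 0(3) by (auto simp: C0_def)
  hence "C0 \<noteq> {}" by auto
  moreover have "C0 \<subseteq> {\<alpha>. set_mset \<alpha> \<subseteq> V}" using 0(1) by (auto simp: C0_def)
  moreover have "\<beta> \<in> C0" if "\<alpha> \<in> C0" "\<beta> \<subseteq># \<alpha>" for \<alpha> \<beta>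
    using that 0(2)[of \<alpha> \<beta>] by (auto simp: C0_def dest: mset_subset_eqD)
  ultimately have "\<exists>e c. has_growth g e c" unfolding g_def by (intro IH)
  then obtain e c where g: "has_growth g e c" by blast
  \<comment> \<open>C is closed under division and, for m = 0, under multiplication by v; so its
    members divisible by v are exactly v times all of C.\<close>
  have rec: "h n = g n + (if n \<ge> d v then h (n - d v) else 0)" for n
  proof -
    have fin: "finite {\<alpha>\<in>C. wt d \<alpha> \<le> n}" for n
      by (rule finite_subset[OF _ finite_wt_le[of "insert v V" d n]]) (use 0(1) V d in auto)
    have "{\<alpha>\<in>C. wt d \<alpha> \<le> n} = {\<alpha>\<in>C0. wt d \<alpha> \<le> n} \<union> {\<alpha>\<in>C. v \<in># \<alpha> \<and> wt d \<alpha> \<le> n}"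
      by (auto simp: C0_def)
    also have "card \<dots> = g n + card {\<alpha>\<in>C. v \<in># \<alpha> \<and> wt d \<alpha> \<le> n}"
      unfolding g_def by (rule card_Un_disjoint) (auto simp: C0_def intro: finite_subset[OF _ fin[of n]])
    also have "{\<alpha>\<in>C. v \<in># \<alpha> \<and> wt d \<alpha> \<le> n} = add_mset v ` {\<alpha>\<in>C. d v + wt d \<alpha> \<le> n}"
    proof safe
      fix \<alpha> assume \<alpha>: "\<alpha> \<in> C" "v \<in># \<alpha>" "wt d \<alpha> \<le> n"
      then obtain \<beta> where \<beta>: "\<alpha> = add_mset v \<beta>" by (meson multi_member_split)
      thus "\<alpha> \<in> add_mset v ` {\<alpha>\<in>C. d v + wt d \<alpha> \<le> n}" using \<alpha> 0(2)[OF \<alpha>(1), of \<beta>] by auto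
    next
      fix \<alpha> assume "\<alpha> \<in> C" thus "add_mset v \<alpha> \<in> C" using 0(4)[of \<alpha>] by simp
    qed auto
    also have "card \<dots> = card {\<alpha>\<in>C. d v + wt d \<alpha> \<le> n}"
      by (rule card_image) (auto simp: inj_on_def)
    also have "\<dots> = (if n \<ge> d v then h (n - d v) else 0)"
      by (auto simp: h_def intro: arg_cong[where f = card])
    finally show ?thesis unfolding h_def by simp
  qed
  from has_growth_recurrence[OF g _ rec] d have "\<exists>e c. has_growth h e c" by blast
  thus ?case unfolding h_def .
next
  case (Suc m C)
  define C0 where "C0 = {\<alpha>\<in>C. v \<notin># \<alpha>}"
  define C1 where "C1 = {\<alpha>. add_mset v \<alpha> \<in> C}"
  define h where "h n = card {\<alpha>\<in>C. wt d \<alpha> \<le> n}" for n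
  define g where "g n = card {\<alpha>\<in>C0. wt d \<alpha> \<le> n}" for n
  define g1 where "g1 n = card {\<alpha>\<in>C1. wt d \<alpha> \<le> n}" for n
  define g1' where "g1' n = card {\<alpha>\<in>C1. d v + wt d \<alpha> \<le> n}" for n
  have "{#} \<in> C0" using Suc(3)[of _ "{#}"] Suc(4) by (auto simp: C0_def)
  hence "C0 \<noteq> {}" by auto
  moreover have "C0 \<subseteq> {\<alpha>. set_mset \<alpha> \<subseteq> V}" using Suc(2) by (auto simp: C0_def)
  moreover have "\<beta> \<in> C0" if "\<alpha> \<in> C0" "\<beta> \<subseteq># \<alpha>" for \<alpha> \<beta>
    using that Suc(3)[of \<alpha> \<beta>] by (auto simp: C0_def dest: mset_subset_eqD)
  ultimately have "\<exists>e c. has_growth g e c" unfolding g_def by (intro IH)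
  then obtain e c where g: "has_growth g e c" by blast
  have C1: "C1 \<subseteq> {\<alpha>. set_mset \<alpha> \<subseteq> insert v V}" using Suc(2) by (fastforce simp: C1_def)
  have fin: "finite {\<alpha>\<in>C. wt d \<alpha> \<le> n}" "finite {\<alpha>\<in>C1. wt d \<alpha> \<le> n}" for n
    by (rule finite_subset[OF _ finite_wt_le[of "insert v V" d n]]; use Suc(2) C1 V d in auto)+
  have sum: "h n = g n + g1' n" for n
  proof -
    have "{\<alpha>\<in>C. wt d \<alpha> \<le> n} = {\<alpha>\<in>C0. wt d \<alpha> \<le> n} \<union> {\<alpha>\<in>C. v \<in># \<alpha> \<and> wt d \<alpha> \<le> n}"
      by (auto simp: C0_def)
    also have "card \<dots> = g n + card {\<alpha>\<in>C. v \<in># \<alpha> \<and> wt d \<alpha> \<le> n}"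
      unfolding g_def by (rule card_Un_disjoint) (auto simp: C0_def intro: finite_subset[OF _ fin(1)[of n]])
    also have "{\<alpha>\<in>C. v \<in># \<alpha> \<and> wt d \<alpha> \<le> n} = add_mset v ` {\<alpha>\<in>C1. d v + wt d \<alpha> \<le> n}"
    proof safe
      fix \<alpha> assume \<alpha>: "\<alpha> \<in> C" "v \<in># \<alpha>" "wt d \<alpha> \<le> n"
      then obtain \<beta> where \<beta>: "\<alpha> = add_mset v \<beta>" by (meson multi_member_split)
      thus "\<alpha> \<in> add_mset v ` {\<alpha>\<in>C1. d v + wt d \<alpha> \<le> n}" using \<alpha> by (auto simp: C1_def)
    qed (auto simp: C1_def)
    also have "card \<dots> = g1' n"
      unfolding g1'_def by (rule card_image) (auto simp: inj_on_def)
    finally show ?thesis unfolding h_def by simp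
  qed
  show ?case
  proof (cases "C1 = {}")
    case True
    hence "h = g" by (intro ext) (simp add: sum g1'_def)
    with g show ?thesis unfolding h_def by blast
  next
    case False
    have "\<exists>e c. has_growth g1 e c" unfolding g1_def
    proof (rule Suc.IH[OF C1])
      show "\<beta> \<in> C1" if "\<alpha> \<in> C1" "\<beta> \<subseteq># \<alpha>" for \<alpha> \<beta>
        using that Suc(3)[of "add_mset v \<alpha>" "add_mset v \<beta>"] by (auto simp: C1_def)
      show "\<alpha> + replicate_mset (Suc m) v \<in> C1" if "\<alpha> + replicate_mset m v \<in> C1" for \<alpha>
        using that Suc(5)[of \<alpha>] by (simp add: C1_def)
    qed (rule False)
    then obtain e' c' where g1: "has_growth g1 e' c'" by blast
    \<comment> \<open>\<open>g1'\<close> is \<open>g1\<close> delayed by the weight of v, which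
      leaves the leading term unchanged.\<close>
    have "has_growth g1' e' c'"
    proof (rule has_growth_sandwich[OF g1])
      show "g1' n \<le> g1 (n + d v)" for n
        unfolding g1'_def g1_def by (intro card_mono fin) auto
      have "finite {\<alpha>\<in>C1. d v + wt d \<alpha> \<le> n + d v}" for n
        by (rule finite_subset[OF _ fin(2)[of n]]) auto
      thus "g1 n \<le> g1' (n + d v)" for n
        unfolding g1'_def g1_def by (intro card_mono) auto
    qed
    from has_growth_add[OF g this] show ?thesis unfolding sum[symmetric] h_def by blast
  qed
qed

text \<open>This replaces the Hilbert--Serre theorem: the standard monomials of a module form such a
  set for each generator.\<close>

theorem has_growth_down_closed:
  fixes d :: "'i \<Rightarrow> nat"
  assumes "finite V" "\<And>i. i \<in> V \<Longrightarrow> d i \<ge> 1" "C \<subseteq> {\<alpha>. set_mset \<alpha> \<subseteq> V}"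
    and "\<And>\<alpha> \<beta>. \<alpha> \<in> C \<Longrightarrow> \<beta> \<subseteq># \<alpha> \<Longrightarrow> \<beta> \<in> C" and "C \<noteq> {}"
  shows "\<exists>e c. has_growth (\<lambda>n. card {\<alpha>\<in>C. wt d \<alpha> \<le> n}) e c"
  using assms
proof (induction V arbitrary: C rule: finite_induct)
  case empty
  hence "C = {{#}}" by auto
  hence "{\<alpha>\<in>C. wt d \<alpha> \<le> n} = {{#}}" for n by auto
  hence "has_growth (\<lambda>n. card {\<alpha>\<in>C. wt d \<alpha> \<le> n}) 0 1" by (simp add: has_growth_def)
  thus ?case by blast
next
  case (insert v V)
  define U where "U = {\<alpha>. set_mset \<alpha> \<subseteq> insert v V} - C"
  have "finite (insert v V)" "U \<subseteq> {\<alpha>. set_mset \<alpha> \<subseteq> insert v V}"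
    using insert.hyps(1) by (auto simp: U_def)
  from dickson[OF this] obtain B
    where B: "finite B" "B \<subseteq> U" "\<And>\<alpha>. \<alpha> \<in> U \<Longrightarrow> \<exists>\<beta>\<in>B. \<beta> \<subseteq># \<alpha>"
    by meson
  \<comment> \<open>m bounds the exponent of v in the finitely many minimal obstructions to
    membership in C. Beyond it, a further factor v cannot make an obstruction divide.\<close>
  define m where "m = (\<Sum>\<beta>\<in>B. count \<beta> v)"
  have m: "count \<beta> v \<le> m" if "\<beta> \<in> B" for \<beta>
    unfolding m_def using that B(1) by (intro member_le_sum) auto
  show ?case
  proof (rule has_growth_down_closed_step[OF insert.hyps(1,2) insert.prems(1) _ insert.prems(2,3,4)])
    show "\<exists>e c. has_growth (\<lambda>n. card {\<alpha>\<in>C. wt d \<alpha> \<le> n}) e c"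
      if "C \<subseteq> {\<alpha>. set_mset \<alpha> \<subseteq> V}" "\<And>\<alpha> \<beta>. \<alpha> \<in> C \<Longrightarrow> \<beta> \<subseteq># \<alpha> \<Longrightarrow> \<beta> \<in> C" "C \<noteq> {}" for C
      by (rule insert.IH[OF _ that]) (use insert.prems(1) in auto)
    show "\<alpha> + replicate_mset (Suc m) v \<in> C" if \<alpha>: "\<alpha> + replicate_mset m v \<in> C" for \<alpha>
    proof (rule ccontr)
      assume "\<alpha> + replicate_mset (Suc m) v \<notin> C"
      moreover have "set_mset (\<alpha> + replicate_mset m v) \<subseteq> insert v V" using \<alpha> insert.prems(2) by blast
      ultimately have "\<alpha> + replicate_mset (Suc m) v \<in> U" by (auto simp: U_def)
      then obtain \<beta> where \<beta>: "\<beta> \<in> B" "\<beta> \<subseteq># \<alpha> + replicate_mset (Suc m) v" using B(3) by blast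
      have "\<beta> \<subseteq># \<alpha> + replicate_mset m v"
        unfolding subseteq_mset_def
      proof
        fix x show "count \<beta> x \<le> count (\<alpha> + replicate_mset m v) x"
          using mset_subset_eq_count[OF \<beta>(2), of x] m[OF \<beta>(1)] by (cases "x = v") auto
      qed
      hence "\<beta> \<in> C" using insert.prems(3)[OF \<alpha>] by blast
      thus False using \<beta>(1) B(2) by (auto simp: U_def)
    qed
  qed
qed

section \<open>Dimensions of subspaces\<close>

text \<open>The expression that occurs in \<open>GK_growth\<close>. It is informative for
  finite-dimensional W only, hence the finite spanning sets in the hypotheses below.\<close>

definition sdim :: "('k, 'x) ring_scheme \<Rightarrow> ('k, 'v, 'y) module_scheme \<Rightarrow> 'v set \<Rightarrow> nat" where
  "sdim K V W = vectorspace.dim K (V\<lparr>carrier := W\<rparr>)"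

context vectorspace
begin

lemma subspaceI:
  assumes "W \<subseteq> carrier V" "\<zero>\<^bsub>V\<^esub> \<in> W" "\<And>x y. x \<in> W \<Longrightarrow> y \<in> W \<Longrightarrow> x \<oplus>\<^bsub>V\<^esub> y \<in> W"
    "\<And>c x. c \<in> carrier K \<Longrightarrow> x \<in> W \<Longrightarrow> c \<odot>\<^bsub>V\<^esub> x \<in> W"
  shows "subspace K W V"
  using assms by (simp add: subspace_def LinearCombinations.submodule_def vectorspace_axioms module_axioms)

lemma subspaceD:
  assumes "subspace K W V"
  shows "W \<subseteq> carrier V" "\<zero>\<^bsub>V\<^esub> \<in> W" "\<And>x y. x \<in> W \<Longrightarrow> y \<in> W \<Longrightarrow> x \<oplus>\<^bsub>V\<^esub> y \<in> W"
    "\<And>c x. c \<in> carrier K \<Longrightarrow> x \<in> W \<Longrightarrow> c \<odot>\<^bsub>V\<^esub> x \<in> W"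
  using assms by (simp_all add: subspace_def LinearCombinations.submodule_def)

lemma subspace_minus:
  assumes W: "subspace K W V" and "x \<in> W" "y \<in> W"
  shows "\<ominus>\<^bsub>V\<^esub> x \<in> W" "x \<ominus>\<^bsub>V\<^esub> y \<in> W"
proof -
  have *: "\<ominus>\<^bsub>V\<^esub> z \<in> W" if "z \<in> W" for z
    using subspaceD(4)[OF W, of "\<ominus>\<^bsub>K\<^esub> \<one>\<^bsub>K\<^esub>" z] subspaceD(1)[OF W] that
    by (auto simp: smult_minus_1)
  show "\<ominus>\<^bsub>V\<^esub> x \<in> W" "x \<ominus>\<^bsub>V\<^esub> y \<in> W"
    using * subspaceD(3)[OF W] assms by (auto simp: a_minus_def)
qed

lemma span_least:
  assumes "subspace K W V" "S \<subseteq> W"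
  shows "span S \<subseteq> W"
  using assms by (intro span_is_subset) (auto simp: subspace_def)

lemma span_insert_cong:
  assumes "v \<in> carrier V" "S \<subseteq> carrier V" "S' \<subseteq> carrier V" "span S = span S'"
  shows "span (insert v S) = span (insert v S')"
proof -
  have *: "span (insert v T) \<subseteq> span (insert v T')"
    if "T \<subseteq> carrier V" "T' \<subseteq> carrier V" "span T = span T'" for T T'
  proof (rule span_least)
    show "subspace K (span (insert v T')) V" using that assms by (intro span_is_subspace) auto
    have "T \<subseteq> span T'" using that(3) in_own_span[OF that(1)] by simp
    also have "\<dots> \<subseteq> span (insert v T')" by (intro span_is_monotone) auto
    finally show "insert v T \<subseteq> span (insert v T')"
      using in_own_span[of "insert v T'"] that assms by auto
  qed
  show ?thesis using *[of S S'] *[of S' S] assms by auto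
qed

lemma span_basis_exists:
  assumes "finite S" "S \<subseteq> carrier V"
  shows "\<exists>B. finite B \<and> B \<subseteq> carrier V \<and> lin_indpt B \<and> span B = span S"
  using assms
proof (induction S rule: finite_induct)
  case empty
  have "lin_indpt {}" by (auto simp: lin_dep_def)
  thus ?case by blast
next
  case (insert v S)
  then obtain B where B: "finite B" "B \<subseteq> carrier V" "lin_indpt B" "span B = span S" by auto
  have eq: "span (insert v B) = span (insert v S)"
    using insert.prems B by (intro span_insert_cong) auto
  show ?case
  proof (cases "v \<in> span B")
    case True
    hence "span B = span (insert v S)" using already_in_span[OF B(2) True] eq by simp
    thus ?thesis using B by blast
  next
    case False
    hence "v \<notin> B" using in_own_span[OF B(2)] by blast
    hence "lin_indpt (insert v B)"
      using lin_dep_iff_in_span[OF B(2,3), of v] False insert.prems by auto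
    thus ?thesis using B eq insert.prems by (intro exI[of _ "insert v B"]) auto
  qed
qed

lemma sdim_span_lin_indpt:
  assumes "finite B" "B \<subseteq> carrier V" "lin_indpt B"
  shows "sdim K V (span B) = card B"
proof -
  have sub: "subspace K (span B) V" using assms by (intro span_is_subspace)
  hence subm: "LinearCombinations.submodule K (span B) V" by simp
  interpret W: vectorspace K "vs (span B)" by (rule subspace_is_vs[OF sub])
  have "W.span B = span B" "W.lin_indpt B"
    using span_li_not_depend[OF in_own_span[OF assms(2)] subm] assms(3) by auto
  hence "W.basis B"
    unfolding W.basis_def using in_own_span[OF assms(2)] by simp
  thus ?thesis unfolding sdim_def by (rule W.dim_basis[OF assms(1)])
qed

lemma sdim_span_insert:
  assumes "finite S" "S \<subseteq> carrier V" "v \<in> carrier V"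
  shows "sdim K V (span (insert v S)) = sdim K V (span S) + (if v \<in> span S then 0 else 1)"
proof -
  obtain B where B: "finite B" "B \<subseteq> carrier V" "lin_indpt B" "span B = span S"
    using span_basis_exists[OF assms(1,2)] by metis
  show ?thesis
  proof (cases "v \<in> span S")
    case True
    thus ?thesis using already_in_span[OF assms(2) True] by simp
  next
    case False
    hence v: "v \<notin> B" using in_own_span[OF B(2)] B(4) by blast
    hence "lin_indpt (insert v B)"
      using lin_dep_iff_in_span[OF B(2,3), of v] False B(4) assms by auto
    hence "sdim K V (span (insert v B)) = card (insert v B)"
      using B assms by (intro sdim_span_lin_indpt) auto
    moreover have "span (insert v B) = span (insert v S)"
      using assms B by (intro span_insert_cong) auto
    moreover have "sdim K V (span S) = card B" using sdim_span_lin_indpt[OF B(1-3)] B(4) by simp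
    ultimately show ?thesis using False v B(1) by simp
  qed
qed

lemma sdim_zero: "sdim K V {\<zero>\<^bsub>V\<^esub>} = 0"
  using sdim_span_lin_indpt[of "{}"] by (simp add: span_empty lin_dep_def)

lemma card_le_sdim_span:
  assumes "finite S" "S \<subseteq> carrier V" "B \<subseteq> span S" "lin_indpt B"
  shows "finite B \<and> card B \<le> sdim K V (span S)"
proof -
  have sub: "subspace K (span S) V" using assms by (intro span_is_subspace)
  hence subm: "LinearCombinations.submodule K (span S) V" by simp
  interpret W: vectorspace K "vs (span S)" by (rule subspace_is_vs[OF sub])
  have "W.fin_dim"
    unfolding W.fin_dim_def using span_li_not_depend[OF in_own_span[OF assms(2)] subm]
      in_own_span[OF assms(2)] assms by auto
  moreover have "W.lin_indpt B" using span_li_not_depend(2)[OF assms(3) subm] assms(4) by simp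
  ultimately show ?thesis using W.li_le_dim[of B] assms(3) by (simp add: sdim_def)
qed

text \<open>Independent subsets of W have at most as many elements as the dimension of
  \<open>span S\<close>, so a largest one exists; a vector of W outside its span would enlarge
  it.\<close>

lemma subspace_of_span_finite:
  assumes "finite S" "S \<subseteq> carrier V" "subspace K W V" "W \<subseteq> span S"
  shows "\<exists>B. finite B \<and> B \<subseteq> carrier V \<and> lin_indpt B \<and> W = span B"
proof -
  define P where "P n \<longleftrightarrow> (\<exists>B. B \<subseteq> W \<and> lin_indpt B \<and> card B = n \<and> finite B)" for n
  have "P 0" unfolding P_def by (intro exI[of _ "{}"]) (auto simp: lin_dep_def)
  moreover have bound: "n \<le> sdim K V (span S)" if "P n" for n
    using card_le_sdim_span[OF assms(1,2)] assms(4) that unfolding P_def by blast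
  ultimately obtain n where n: "P n" "\<And>m. P m \<Longrightarrow> m \<le> n"
    using Greatest_le_nat[of P] GreatestI_nat[of P] by metis
  then obtain B where B: "B \<subseteq> W" "lin_indpt B" "card B = n" "finite B" by (auto simp: P_def)
  have BV: "B \<subseteq> carrier V" using B(1) subspaceD(1)[OF assms(3)] by blast
  have "W \<subseteq> span B"
  proof (rule subsetI, rule ccontr)
    fix v assume v: "v \<in> W" "v \<notin> span B"
    have "v \<notin> B" using v in_own_span[OF BV] by blast
    moreover have "v \<in> carrier V" using v subspaceD(1)[OF assms(3)] by blast
    ultimately have "lin_indpt (insert v B)"
      using lin_dep_iff_in_span[OF BV B(2), of v] v by auto
    hence "P (Suc n)" unfolding P_def using B v \<open>v \<notin> B\<close> by (intro exI[of _ "insert v B"]) auto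
    with n(2) show False by fastforce
  qed
  thus ?thesis using B BV span_least[OF assms(3) B(1)] by blast
qed

lemma sdim_mono:
  assumes "finite S" "S \<subseteq> carrier V" "subspace K W V" "W \<subseteq> span S"
  shows "sdim K V W \<le> sdim K V (span S)"
proof -
  obtain B where B: "finite B" "B \<subseteq> carrier V" "lin_indpt B" "W = span B"
    using subspace_of_span_finite[OF assms] by metis
  have "B \<subseteq> span S" using in_own_span[OF B(2)] B(4) assms(4) by blast
  from card_le_sdim_span[OF assms(1,2) this B(3)] sdim_span_lin_indpt[OF B(1-3)] B(4)
  show ?thesis by simp
qed

end

lemma fin_dim_subspace_iff:
  assumes "vectorspace K V"
  shows "fin_dim_subspace K W V \<longleftrightarrow> (\<exists>S. finite S \<and> S \<subseteq> carrier V \<and> W = module.span K V S)"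
proof -
  interpret V: vectorspace K V by fact
  show ?thesis
  proof
    assume W: "fin_dim_subspace K W V"
    hence sub: "subspace K W V" by (simp add: fin_dim_subspace_def)
    hence subm: "LinearCombinations.submodule K W V" by simp
    interpret W: vectorspace K "V.vs W" by (rule V.subspace_is_vs[OF sub])
    from W obtain S where S: "finite S" "S \<subseteq> W" "W.gen_set S"
      by (auto simp: fin_dim_subspace_def W.fin_dim_def)
    thus "\<exists>S. finite S \<and> S \<subseteq> carrier V \<and> W = V.span S"
      using V.span_li_not_depend(1)[OF S(2) subm] V.subspaceD(1)[OF sub] by (intro exI[of _ S]) auto
  next
    assume "\<exists>S. finite S \<and> S \<subseteq> carrier V \<and> W = V.span S"
    then obtain S where S: "finite S" "S \<subseteq> carrier V" "W = V.span S" by blast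
    have sub: "subspace K W V" using S V.span_is_subspace by simp
    hence subm: "LinearCombinations.submodule K W V" by simp
    interpret W: vectorspace K "V.vs W" by (rule V.subspace_is_vs[OF sub])
    have "S \<subseteq> W" using S V.in_own_span by simp
    hence "W.fin_dim" unfolding W.fin_dim_def
      using S V.span_li_not_depend(1)[OF _ subm, of S] by auto
    thus "fin_dim_subspace K W V" using sub by (simp add: fin_dim_subspace_def)
  qed
qed

text \<open>Rank-nullity for the restriction of T to a finite-dimensional subspace. Applied to each
  filtration step it is the source of additivity on exact sequences.\<close>

lemma (in linear_map) sdim_rank_nullity:
  assumes "finite S" "S \<subseteq> carrier V"
  shows "sdim K V (V.module.span S) = sdim K W (T ` V.module.span S) + sdim K V {x \<in> V.module.span S. T x = \<zero>\<^bsub>W\<^esub>}"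
proof -
  let ?U = "V.module.span S"
  have sub: "subspace K ?U V" using assms by (intro V.span_is_subspace)
  hence subm: "LinearCombinations.submodule K ?U V" by simp
  interpret U: vectorspace K "V.vs ?U" by (rule V.subspace_is_vs[OF sub])
  have "T \<in> LinearCombinations.module_hom K (V.vs ?U) W"
    using V.subspaceD(1)[OF sub] f_hom by (auto simp: module_hom_def subset_iff)
  then interpret T: linear_map K "V.vs ?U" W T
    by unfold_locales
  have "U.fin_dim" unfolding U.fin_dim_def
    using V.module.span_li_not_depend(1)[OF V.module.in_own_span[OF assms(2)] subm] V.module.in_own_span[OF assms(2)] assms(1)
    by auto
  from T.rank_nullity[OF this] show ?thesis
    by (simp add: sdim_def T.im_def T.ker_def)
qed

lemma (in linear_map) sdim_inj_image:
  assumes "finite S" "S \<subseteq> carrier V" "inj_on T (carrier V)"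
  shows "sdim K W (T ` V.module.span S) = sdim K V (V.module.span S)"
proof -
  have "{x \<in> V.module.span S. T x = \<zero>\<^bsub>W\<^esub>} = {\<zero>\<^bsub>V\<^esub>}"
    using inj_onD[OF assms(3), of _ "\<zero>\<^bsub>V\<^esub>"] V.span_zero V.module.span_is_subset2[OF assms(2)] by auto
  thus ?thesis using sdim_rank_nullity[OF assms(1,2)] V.sdim_zero by simp
qed

lemma (in linear_map) image_span:
  assumes "S \<subseteq> carrier V"
  shows "T ` V.module.span S = W.module.span (T ` S)"
proof
  have TS: "T ` S \<subseteq> carrier W" using assms by auto
  have "V.module.span S \<subseteq> {x \<in> carrier V. T x \<in> W.module.span (T ` S)}"
  proof (rule V.span_least)
    have sub: "subspace K (W.module.span (T ` S)) W" using TS by (rule W.span_is_subspace)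
    show "subspace K {x \<in> carrier V. T x \<in> W.module.span (T ` S)} V"
      by (rule V.subspaceI) (use W.subspaceD[OF sub] in auto)
    show "S \<subseteq> {x \<in> carrier V. T x \<in> W.module.span (T ` S)}"
      using W.module.in_own_span[OF TS] assms by auto
  qed
  thus "T ` V.module.span S \<subseteq> W.module.span (T ` S)" by auto
  have "subspace K (V.module.span S) V" using assms by (rule V.span_is_subspace)
  note sub = V.subspaceD[OF this]
  show "W.module.span (T ` S) \<subseteq> T ` V.module.span S"
  proof (rule W.span_least)
    show "subspace K (T ` V.module.span S) W"
    proof (rule W.subspaceI)
      show "T ` V.module.span S \<subseteq> carrier W" using sub(1) by auto
      show "\<zero>\<^bsub>W\<^esub> \<in> T ` V.module.span S" using sub(2) T0_is_0 by (metis image_eqI)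
      show "x \<oplus>\<^bsub>W\<^esub> y \<in> T ` V.module.span S" if "x \<in> T ` V.module.span S" "y \<in> T ` V.module.span S" for x y
        using that sub(1,3) f_add by (smt (verit, ccfv_threshold) image_iff subset_iff)
      show "c \<odot>\<^bsub>W\<^esub> x \<in> T ` V.module.span S" if "c \<in> carrier K" "x \<in> T ` V.module.span S" for c x
        using that sub(1,4) f_smult by (smt (verit, ccfv_threshold) image_iff subset_iff)
    qed
    show "T ` S \<subseteq> T ` V.module.span S" using V.module.in_own_span[OF assms] by blast
  qed
qed

section \<open>Filtrations with commutative associated graded algebra\<close>

locale filtered_algebra = assoc_algebra K A
  for K :: "('k, 'x) ring_scheme" and A :: "('k, 'a) module" (structure) +
  fixes F :: "nat \<Rightarrow> 'a set"
  assumes fin_dim_filt: "fin_dim_filtration K A F"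
begin

lemma F_subspace: "subspace K (F i) A"
  using fin_dim_filt by (simp add: fin_dim_filtration_def filtration_def)

lemmas F_carrier = V.subspaceD(1)[OF F_subspace]
  and F_zero = V.subspaceD(2)[OF F_subspace]
  and F_add = V.subspaceD(3)[OF F_subspace]
  and F_smult = V.subspaceD(4)[OF F_subspace]

lemma F_closed: "a \<in> F i \<Longrightarrow> a \<in> carrier A"
  using F_carrier by blast

lemma F_finite_span: "\<exists>S. finite S \<and> S \<subseteq> carrier A \<and> F i = V.span S"
  using fin_dim_filt fin_dim_subspace_iff[OF V.vectorspace_axioms]
  by (simp add: fin_dim_filtration_def)

lemma F_mono: "i \<le> j \<Longrightarrow> F i \<subseteq> F j"
  by (rule lift_Suc_mono_le)
    (use fin_dim_filt in \<open>auto simp: fin_dim_filtration_def filtration_def\<close>)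

lemma F_one: "\<one> \<in> F i"
  using F_mono[of 0 i] fin_dim_filt by (auto simp: fin_dim_filtration_def filtration_def)

lemma F_mult: "a \<in> F i \<Longrightarrow> b \<in> F j \<Longrightarrow> a \<otimes> b \<in> F (i + j)"
  using fin_dim_filt by (auto simp: fin_dim_filtration_def filtration_def)

lemma F_union: "(\<Union>i. F i) = carrier A"
  using fin_dim_filt by (auto simp: fin_dim_filtration_def filtration_def)

lemma F_absorbs_finite:
  assumes "finite S" "S \<subseteq> carrier A"
  shows "\<exists>n. S \<subseteq> F n"
  using assms
proof (induction S rule: finite_induct)
  case (insert a S)
  then obtain m where m: "S \<subseteq> F m" by auto
  obtain n where n: "a \<in> F n" using insert.prems F_union by blast
  have "insert a S \<subseteq> F (max m n)"
    using m n F_mono[of m "max m n"] F_mono[of n "max m n"] by auto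
  thus ?case by blast
qed simp

abbreviation Fpred :: "nat \<Rightarrow> 'a set" where "Fpred \<equiv> filt_pred A F"

lemma Fpred_subspace: "subspace K (Fpred n) A"
  by (cases n) (auto intro!: V.subspaceI simp: F_subspace)

lemma Fpred_le: "Fpred n \<subseteq> F n"
  by (cases n) (use F_zero F_mono in auto)

lemma Fpred_mult_left: "a \<in> Fpred i \<Longrightarrow> b \<in> F j \<Longrightarrow> a \<otimes> b \<in> Fpred (i + j)"
  and Fpred_mult_right: "a \<in> F i \<Longrightarrow> b \<in> Fpred j \<Longrightarrow> a \<otimes> b \<in> Fpred (i + j)"
proof -
  assume *: "a \<in> Fpred i" "b \<in> F j"
  show "a \<otimes> b \<in> Fpred (i + j)"
  proof (cases i)
    case 0
    thus ?thesis using * F_closed[of b j] V.subspaceD(2)[OF Fpred_subspace] by auto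
  next
    case (Suc i')
    thus ?thesis using * F_mult by auto
  qed
next
  assume *: "a \<in> F i" "b \<in> Fpred j"
  show "a \<otimes> b \<in> Fpred (i + j)"
  proof (cases j)
    case 0
    thus ?thesis using * F_closed[of a i] V.subspaceD(2)[OF Fpred_subspace] by auto
  next
    case (Suc i')
    thus ?thesis using * F_mult by auto
  qed
qed

lemma Fpred_abelian_subgroup: "abelian_subgroup (Fpred n) A"
proof (rule abelian_subgroupI3)
  note sub = V.subspaceD[OF Fpred_subspace[of n]]
  have "subgroup (Fpred n) (add_monoid A)"
    by (rule V.M.add.subgroupI)
      (use sub V.subspace_minus(1)[OF Fpred_subspace[of n]] in \<open>auto simp: a_inv_def\<close>)
  thus "additive_subgroup (Fpred n) A" by (rule additive_subgroupI)
qed (rule V.M.abelian_group_axioms)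

section \<open>Multiplication in the associated graded algebra\<close>

abbreviation gr :: "('k, nat \<Rightarrow> 'a set) module" where "gr \<equiv> assoc_graded A F"

lemma coset_mem: "b \<in> Fpred n +> a \<longleftrightarrow> (\<exists>h\<in>Fpred n. b = h \<oplus> a)"
  by (auto simp: a_r_coset_def')

lemma a_rcosets_restrict_iff:
  "X \<in> a_rcosets\<^bsub>A\<lparr>carrier := W\<rparr>\<^esub> H \<longleftrightarrow> (\<exists>a\<in>W. X = H +> a)"
  by (auto simp: A_RCOSETS_def' a_r_coset_def')

lemma gr_coset_rep:
  assumes "x \<in> carrier gr"
  shows "\<exists>a\<in>F n. x n = Fpred n +> a"
  using assms by (simp add: assoc_graded_def a_rcosets_restrict_iff)

lemma gr_rep:
  assumes x: "x \<in> carrier gr" and a: "a \<in> x n"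
  shows "a \<in> F n" "x n = Fpred n +> a"
proof -
  interpret I: abelian_subgroup "Fpred n" A by (rule Fpred_abelian_subgroup)
  obtain b where b: "b \<in> F n" "x n = Fpred n +> b" using gr_coset_rep[OF x] by blast
  with a show "a \<in> F n" using coset_mem[of a n b] F_add subsetD[OF Fpred_le] by auto
  have "a \<in> Fpred n +> b" using a b by simp
  thus "x n = Fpred n +> a"
    using I.a_repr_independence'[of a b] b F_closed by simp
qed

lemma gr_rep_exists:
  assumes x: "x \<in> carrier gr"
  shows "\<exists>a. a \<in> x n"
proof -
  interpret I: abelian_subgroup "Fpred n" A by (rule Fpred_abelian_subgroup)
  obtain b where b: "b \<in> F n" "x n = Fpred n +> b" using gr_coset_rep[OF x] by blast
  thus ?thesis using I.a_rcos_self[of b] F_closed by auto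
qed

text \<open>Well-definedness of the product of classes: replacing a by h + a and b by k + b changes
  ab by h(k + b) + ak, which lies one step lower. All cosets in the union that defines
  \<open>rcoset_mult\<close> therefore coincide.\<close>

lemma rcoset_mult_rep:
  assumes "a \<in> F i" "b \<in> F j"
  shows "rcoset_mult A (Fpred (i + j)) (Fpred i +> a) (Fpred j +> b) = Fpred (i + j) +> a \<otimes> b"
proof -
  interpret I: abelian_subgroup "Fpred (i + j)" A by (rule Fpred_abelian_subgroup)
  note sub = V.subspaceD[OF Fpred_subspace]
  have ab: "a \<in> carrier A" "b \<in> carrier A" using assms F_closed by auto
  have "Fpred (i + j) +> (a' \<otimes> b') = Fpred (i + j) +> a \<otimes> b"
    if rep: "a' \<in> Fpred i +> a" "b' \<in> Fpred j +> b" for a' b'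
  proof -
    obtain h k where h: "h \<in> Fpred i" "a' = h \<oplus> a" and k: "k \<in> Fpred j" "b' = k \<oplus> b"
      using rep by (auto simp: coset_mem)
    have hk: "h \<in> F i" "k \<in> F j" using h(1) k(1) subsetD[OF Fpred_le] by auto
    hence hk': "h \<in> carrier A" "k \<in> carrier A" using F_closed by auto
    have "a' \<otimes> b' = (h \<otimes> (k \<oplus> b) \<oplus> a \<otimes> k) \<oplus> a \<otimes> b"
      using h k ab hk' by (simp add: A.l_distr A.r_distr V.M.a_ac)
    moreover have "h \<otimes> (k \<oplus> b) \<oplus> a \<otimes> k \<in> Fpred (i + j)"
      using sub(3) Fpred_mult_left[OF h(1) F_add[OF hk(2) assms(2)]]
        Fpred_mult_right[OF assms(1) k(1)] by blast
    ultimately have "a' \<otimes> b' \<in> Fpred (i + j) +> a \<otimes> b" by (auto simp: coset_mem)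
    thus ?thesis using I.a_repr_independence'[of "a' \<otimes> b'" "a \<otimes> b"] ab by simp
  qed
  moreover have "a \<in> Fpred i +> a" "b \<in> Fpred j +> b"
    using sub(2) ab by (auto simp: coset_mem intro!: bexI[of _ \<zero>])
  ultimately show ?thesis unfolding rcoset_mult_def by blast
qed

lemma coset_in_A_Mod: "a \<in> carrier A \<Longrightarrow> Fpred n +> a \<in> carrier (A A_Mod Fpred n)"
  by (auto simp: A_FactGroup_def' A_RCOSETS_def')

lemma finprod_cosets:
  assumes "finite N" "\<And>i. i \<in> N \<Longrightarrow> f i \<in> carrier A"
  shows "finprod (A A_Mod Fpred n) (\<lambda>i. Fpred n +> f i) N = Fpred n +> finsum A f N"
proof -
  interpret I: abelian_subgroup "Fpred n" A by (rule Fpred_abelian_subgroup)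
  interpret Q: comm_group "A A_Mod Fpred n" by (rule I.a_factorgroup_is_comm_group)
  show ?thesis using assms
  proof (induction N rule: finite_induct)
    case empty
    show ?case
      unfolding Q.finprod_empty using V.M.a_coset_add_zero[OF I.a_subset]
      by (simp add: A_FactGroup_def')
  next
    case (insert i N)
    have "finprod (A A_Mod Fpred n) (\<lambda>i. Fpred n +> f i) (insert i N) =
        (Fpred n +> f i) \<otimes>\<^bsub>A A_Mod Fpred n\<^esub> finprod (A A_Mod Fpred n) (\<lambda>i. Fpred n +> f i) N"
      using insert by (intro Q.finprod_insert) (auto intro!: coset_in_A_Mod)
    also have "\<dots> = (Fpred n +> f i) <+> (Fpred n +> finsum A f N)"
      using insert by simp
    also have "\<dots> = Fpred n +> (f i \<oplus> finsum A f N)"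
      using insert.prems by (intro I.a_rcos_sum) (auto intro!: V.M.finsum_closed)
    also have "f i \<oplus> finsum A f N = finsum A f (insert i N)"
      using insert by (intro V.M.finsum_insert[symmetric]) auto
    finally show ?case .
  qed
qed

text \<open>Representatives may be chosen freely in each degree, which reduces the graded product to
  a Cauchy product in A.\<close>

lemma gr_mult:
  assumes "x \<in> carrier gr" "y \<in> carrier gr" "\<And>i. a i \<in> x i" "\<And>i. b i \<in> y i"
  shows "(x \<otimes>\<^bsub>gr\<^esub> y) n = Fpred n +> (\<Oplus>i\<in>{..n}. a i \<otimes> b (n - i))"
proof -
  have a: "a i \<in> F i" "x i = Fpred i +> a i" for i using gr_rep assms by auto
  have b: "b i \<in> F i" "y i = Fpred i +> b i" for i using gr_rep assms by auto
  have "(x \<otimes>\<^bsub>gr\<^esub> y) n = finprod (A A_Mod Fpred n) (\<lambda>i. rcoset_mult A (Fpred n) (x i) (y (n - i))) {..n}"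
    by (simp add: assoc_graded_def)
  also have "\<dots> = finprod (A A_Mod Fpred n) (\<lambda>i. Fpred n +> a i \<otimes> b (n - i)) {..n}"
  proof -
    interpret I: abelian_subgroup "Fpred n" A by (rule Fpred_abelian_subgroup)
    interpret Q: comm_group "A A_Mod Fpred n" by (rule I.a_factorgroup_is_comm_group)
    show ?thesis
    proof (rule Q.finprod_cong')
      show "rcoset_mult A (Fpred n) (x i) (y (n - i)) = Fpred n +> a i \<otimes> b (n - i)"
        if "i \<in> {..n}" for i
        using rcoset_mult_rep[OF a(1) b(1), of i "n - i"] that a(2)[of i] b(2)[of "n - i"] by simp
      show "(\<lambda>i. Fpred n +> a i \<otimes> b (n - i)) \<in> {..n} \<rightarrow> carrier (A A_Mod Fpred n)"
        using F_closed[OF a(1)] F_closed[OF b(1)] by (auto intro!: coset_in_A_Mod)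
    qed simp
  qed
  also have "\<dots> = Fpred n +> (\<Oplus>i\<in>{..n}. a i \<otimes> b (n - i))"
    using F_closed[OF a(1)] F_closed[OF b(1)] by (intro finprod_cosets) auto
  finally show ?thesis .
qed

text \<open>The symbol of a in degree i. It is the zero element of the graded algebra when a already
  lies in \<open>Fpred i\<close>.\<close>

definition homog :: "nat \<Rightarrow> 'a \<Rightarrow> nat \<Rightarrow> 'a set" where
  "homog i a = (\<lambda>n. if n = i then Fpred n +> a else Fpred n)"

lemma homog_rep:
  assumes "a \<in> carrier A"
  shows "(if n = i then a else \<zero>) \<in> homog i a n"
  using assms V.subspaceD(2)[OF Fpred_subspace] by (auto simp: homog_def coset_mem intro!: bexI[of _ \<zero>])

lemma homog_in_gr:
  assumes "a \<in> F i"
  shows "homog i a \<in> carrier gr"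
proof -
  have "Fpred n +> \<zero> = Fpred n" for n
    using V.M.a_coset_add_zero V.subspaceD(1)[OF Fpred_subspace] by blast
  hence "homog i a n = Fpred n +> (if n = i then a else \<zero>)" for n
    by (simp add: homog_def)
  moreover have "(if n = i then a else \<zero>) \<in> F n" for n
    using assms F_zero by simp
  ultimately have "homog i a n \<in> a_rcosets\<^bsub>A\<lparr>carrier := F n\<rparr>\<^esub> (Fpred n)" for n
    unfolding a_rcosets_restrict_iff by (intro bexI)
  moreover have "{n. homog i a n \<noteq> Fpred n} \<subseteq> {i}" by (auto simp: homog_def)
  ultimately show ?thesis by (auto simp: assoc_graded_def intro: finite_subset)
qed

lemma homog_mult:
  assumes a: "a \<in> F i" and b: "b \<in> F j"
  shows "(homog i a \<otimes>\<^bsub>gr\<^esub> homog j b) (i + j) = Fpred (i + j) +> a \<otimes> b"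
proof -
  have ab: "a \<in> carrier A" "b \<in> carrier A" using a b F_closed by auto
  have "(homog i a \<otimes>\<^bsub>gr\<^esub> homog j b) (i + j) = Fpred (i + j) +>
      (\<Oplus>k\<in>{..i + j}. (if k = i then a else \<zero>) \<otimes> (if i + j - k = j then b else \<zero>))"
    by (intro gr_mult homog_in_gr homog_rep a b ab)
  also have "(\<Oplus>k\<in>{..i + j}. (if k = i then a else \<zero>) \<otimes> (if i + j - k = j then b else \<zero>)) =
      (\<Oplus>k\<in>{..i + j}. if i = k then a \<otimes> b else \<zero>)"
    using ab by (intro V.M.finsum_cong') auto
  also have "\<dots> = a \<otimes> b"
    using ab by (intro V.M.finsum_singleton) auto
  finally show ?thesis .
qed

text \<open>The two products of the symbols of a and b agree; their components in degree i + j are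
  the classes of ab and ba.\<close>

lemma gr_commutative_imp:
  assumes "cring gr" and a: "a \<in> F i" and b: "b \<in> F j"
  shows "a \<otimes> b \<ominus> b \<otimes> a \<in> Fpred (i + j)"
proof -
  interpret I: abelian_subgroup "Fpred (i + j)" A by (rule Fpred_abelian_subgroup)
  have ab: "a \<in> carrier A" "b \<in> carrier A" using a b F_closed by auto
  have "homog i a \<otimes>\<^bsub>gr\<^esub> homog j b = homog j b \<otimes>\<^bsub>gr\<^esub> homog i a"
    using assms(1) homog_in_gr[OF a] homog_in_gr[OF b]
    by (simp add: cring.cring_simprules(14))
  hence "Fpred (i + j) +> a \<otimes> b = Fpred (i + j) +> b \<otimes> a"
    using homog_mult[OF a b] homog_mult[OF b a] by (simp add: add.commute)
  hence "a \<otimes> b \<in> Fpred (i + j) +> b \<otimes> a" using I.a_rcos_self[of "a \<otimes> b"] ab by simp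
  thus ?thesis using I.a_rcos_module_minus[of "b \<otimes> a" "a \<otimes> b"] A.ring_axioms ab by simp
qed

text \<open>The elements of \<open>F n\<close> whose class in degree \<open>n\<close> lies in the subalgebra of the associated
  graded algebra generated in degrees at most \<open>D\<close>.\<close>

inductive generated_upto :: "nat \<Rightarrow> nat \<Rightarrow> 'a \<Rightarrow> bool" for D where
  base: "n \<le> D \<Longrightarrow> a \<in> F n \<Longrightarrow> generated_upto D n a"
| lower: "a \<in> F n \<Longrightarrow> generated_upto D (Suc n) a"
| mult: "1 \<le> i \<Longrightarrow> i \<le> D \<Longrightarrow> a \<in> F i \<Longrightarrow> generated_upto D m b \<Longrightarrow> generated_upto D (i + m) (a \<otimes> b)"
| add: "generated_upto D n a \<Longrightarrow> generated_upto D n b \<Longrightarrow> generated_upto D n (a \<oplus> b)"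

lemma generated_upto_F: "generated_upto D n a \<Longrightarrow> a \<in> F n"
proof (induction rule: generated_upto.induct)
  case (lower a n)
  thus ?case using F_mono[of n "Suc n"] by auto
qed (auto intro: F_mult F_add)

lemma generated_upto_closed: "generated_upto D n a \<Longrightarrow> a \<in> carrier A"
  using generated_upto_F F_closed by blast

lemma generated_upto_Fpred: "a \<in> Fpred n \<Longrightarrow> generated_upto D n a"
  by (cases n) (auto intro: generated_upto.intros F_zero)

lemma generated_upto_smult:
  assumes "generated_upto D n a" "c \<in> carrier K"
  shows "generated_upto D n (c \<odot> a)"
  using assms
proof (induction rule: generated_upto.induct)
  case (mult i a m b)
  have "c \<odot> (a \<otimes> b) = (c \<odot> a) \<otimes> b"
    using mult F_closed generated_upto_closed by (intro smult_mult_left) auto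
  thus ?case using mult by (auto intro!: generated_upto.mult F_smult)
next
  case (add n a b)
  have "c \<odot> (a \<oplus> b) = c \<odot> a \<oplus> c \<odot> b"
    using add F_closed generated_upto_closed by (intro V.smult_r_distr) auto
  thus ?case using add by (auto intro!: generated_upto.add)
qed (auto intro: generated_upto.intros F_smult)

text \<open>The rule \<open>mult\<close> admits only factors of positive degree, so a factor from
  \<open>F 0\<close> has to be merged into the first factor: a(xb) = (ax)b, with ax in the same step
  as x.\<close>

lemma generated_upto_mult_F0:
  assumes "generated_upto D n b" "a \<in> F 0"
  shows "generated_upto D n (a \<otimes> b)"
  using assms
proof (induction rule: generated_upto.induct)
  case (base n b)
  thus ?case using F_mult[of a 0 b n] by (auto intro: generated_upto.base)
next
  case (lower b n)
  thus ?case using F_mult[of a 0 b n] by (auto intro: generated_upto.lower)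
next
  case (mult i x m b)
  have "a \<otimes> (x \<otimes> b) = (a \<otimes> x) \<otimes> b"
    using mult F_closed generated_upto_closed by (intro A.m_assoc[symmetric]) auto
  moreover have "a \<otimes> x \<in> F i" using F_mult[of a 0 x i] mult by simp
  ultimately show ?case using mult by (auto intro!: generated_upto.mult)
next
  case (add n x y)
  have "a \<otimes> (x \<oplus> y) = a \<otimes> x \<oplus> a \<otimes> y"
    using add F_closed generated_upto_closed by (intro A.r_distr) auto
  thus ?case using add by (auto intro!: generated_upto.add)
qed

lemma generated_upto_mult:
  assumes "generated_upto D i a" "generated_upto D j b"
  shows "generated_upto D (i + j) (a \<otimes> b)"
  using assms
proof (induction rule: generated_upto.induct)
  case (base n a)
  thus ?case by (cases "n = 0") (auto intro: generated_upto_mult_F0 generated_upto.mult)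
next
  case (lower a n)
  thus ?case using F_mult[of a n b j] generated_upto_F[of D j b] by (auto intro: generated_upto.lower)
next
  case (mult i x m y)
  have "(x \<otimes> y) \<otimes> b = x \<otimes> (y \<otimes> b)"
    using mult F_closed generated_upto_closed by (intro A.m_assoc) auto
  thus ?case using mult generated_upto.mult[of i D x "m + j" "y \<otimes> b"] by (auto simp: add.assoc)
next
  case (add n x y)
  have "(x \<oplus> y) \<otimes> b = x \<otimes> b \<oplus> y \<otimes> b"
    using add F_closed generated_upto_closed by (intro A.l_distr) auto
  thus ?case using add by (auto intro!: generated_upto.add)
qed

lemma generated_upto_finsum:
  assumes "finite N" "\<And>i. i \<in> N \<Longrightarrow> generated_upto D n (f i)"
  shows "generated_upto D n (finsum A f N)"
  using assms
proof (induction N rule: finite_induct)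
  case empty
  thus ?case using generated_upto_Fpred V.subspaceD(2)[OF Fpred_subspace] by simp
next
  case (insert i N)
  have "finsum A f (insert i N) = f i \<oplus> finsum A f N"
    using insert generated_upto_closed by (intro V.M.finsum_insert) (auto simp: Pi_def)
  thus ?case using insert by (auto intro!: generated_upto.add)
qed

text \<open>The elements of the graded algebra with only generated representatives form a subalgebra
  containing the finitely many generators, hence everything. Any a in \<open>F n\<close> represents
  its own symbol and is therefore generated.\<close>

lemma generated_upto_all:
  assumes "affine_algebra K gr" "cring gr"
  shows "\<exists>D. \<forall>n. \<forall>a\<in>F n. generated_upto D n a"
proof -
  interpret gr: cring gr by fact
  interpret grA: assoc_algebra K gr using assms by (simp add: affine_algebra_def)
  obtain S where S: "finite S" "alg_generates K gr S"
    using assms by (auto simp: affine_algebra_def)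
  have S_gr: "S \<subseteq> carrier gr" using S by (simp add: alg_generates_def)
  \<comment> \<open>D is the largest degree in which one of the finitely many generators has a
    nonzero component; the generators need not be homogeneous.\<close>
  have "\<exists>D. \<forall>s\<in>S. \<forall>n>D. s n = Fpred n"
  proof -
    have "finite (\<Union>s\<in>S. {n. s n \<noteq> Fpred n})"
      using S(1) S_gr by (auto simp: assoc_graded_def)
    then obtain D where D: "\<forall>n \<in> (\<Union>s\<in>S. {n. s n \<noteq> Fpred n}). n \<le> D"
      unfolding finite_nat_set_iff_bounded_le by blast
    have "s n = Fpred n" if "s \<in> S" "n > D" for s n
    proof (rule ccontr)
      assume "s n \<noteq> Fpred n"
      hence "n \<le> D" using D that(1) by blast
      thus False using that(2) by simp
    qed
    thus ?thesis by (intro exI[of _ D] ballI allI impI)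
  qed
  then obtain D where D: "\<And>s n. s \<in> S \<Longrightarrow> n > D \<Longrightarrow> s n = Fpred n" by metis
  \<comment> \<open>Quantifying over all representatives costs nothing: they differ by elements of
    \<open>Fpred n\<close>, which are always generated, as the fact \<open>coset\<close>
    records.\<close>
  define B where "B = {x \<in> carrier gr. \<forall>n. \<forall>a\<in>x n. generated_upto D n a}"
  have coset: "generated_upto D n b" if "generated_upto D n a" "b \<in> Fpred n +> a" for n a b
    using that by (auto simp: coset_mem intro: generated_upto.add generated_upto_Fpred)
  have B_mult: "x \<otimes>\<^bsub>gr\<^esub> y \<in> B" if "x \<in> B" "y \<in> B" for x y
  proof -
    have xy: "x \<in> carrier gr" "y \<in> carrier gr" using that by (auto simp: B_def)
    obtain a where a: "\<And>i. a i \<in> x i" using gr_rep_exists[OF xy(1)] by metis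
    obtain b where b: "\<And>i. b i \<in> y i" using gr_rep_exists[OF xy(2)] by metis
    have "generated_upto D n (\<Oplus>i\<in>{..n}. a i \<otimes> b (n - i))" for n
    proof (rule generated_upto_finsum)
      fix i assume "i \<in> {..n}"
      moreover have "generated_upto D i (a i)" "generated_upto D (n - i) (b (n - i))" using that a b by (auto simp: B_def)
      ultimately show "generated_upto D n (a i \<otimes> b (n - i))"
        using generated_upto_mult[of D i "a i" "n - i" "b (n - i)"] by simp
    qed simp
    thus ?thesis
      using coset gr_mult[of x y a b] xy a b by (auto simp: B_def)
  qed
  have gr_add: "(x \<oplus>\<^bsub>gr\<^esub> y) n = x n <+> y n" for x y n
    by (simp add: assoc_graded_def)
  have B_add: "x \<oplus>\<^bsub>gr\<^esub> y \<in> B" if "x \<in> B" "y \<in> B" for x y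
    using that by (auto simp: B_def gr_add set_add_def' intro: generated_upto.add)
  have B_smult: "c \<odot>\<^bsub>gr\<^esub> x \<in> B" if "c \<in> carrier K" "x \<in> B" for c x
  proof -
    have x: "x \<in> carrier gr" using that by (simp add: B_def)
    have "generated_upto D n b" if b: "b \<in> (c \<odot>\<^bsub>gr\<^esub> x) n" for n b
    proof -
      obtain a where a: "a \<in> x n" "b \<in> Fpred n +> c \<odot> a" using b by (auto simp: assoc_graded_def)
      hence "generated_upto D n (c \<odot> a)" using \<open>x \<in> B\<close> \<open>c \<in> carrier K\<close> by (auto simp: B_def intro: generated_upto_smult)
      thus ?thesis using coset a(2) by blast
    qed
    moreover have "c \<odot>\<^bsub>gr\<^esub> x \<in> carrier gr" using that x by (intro grA.V.smult_closed)
    ultimately show ?thesis by (auto simp: B_def)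
  qed
  have B_neg: "\<ominus>\<^bsub>gr\<^esub> x \<in> B" if "x \<in> B" for x
  proof -
    have x: "x \<in> carrier gr" using that by (simp add: B_def)
    have "\<ominus>\<^bsub>gr\<^esub> x = (\<ominus>\<^bsub>K\<^esub> \<one>\<^bsub>K\<^esub>) \<odot>\<^bsub>gr\<^esub> x" using x by (simp add: grA.V.smult_minus_1)
    thus ?thesis using B_smult that by simp
  qed
  have "\<one>\<^bsub>gr\<^esub> \<in> B"
  proof -
    have "generated_upto D n a" if "a \<in> \<one>\<^bsub>gr\<^esub> n" for n a
    proof (cases n)
      case 0
      hence "a = \<one>" using that by (simp add: assoc_graded_def a_r_coset_def')
      thus ?thesis using 0 F_one by (simp add: generated_upto.base)
    next
      case (Suc m)
      thus ?thesis using that by (auto simp: assoc_graded_def intro: generated_upto.lower)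
    qed
    thus ?thesis by (auto simp: B_def)
  qed
  hence "subring B gr"
    by (intro gr.subringI B_neg B_mult B_add) (auto simp: B_def)
  moreover from this have "Module.submodule B K gr"
    by (intro Module.submodule.intro submodule_axioms.intro B_smult)
      (auto simp: subring_def)
  moreover have "S \<subseteq> B"
  proof
    fix s assume s: "s \<in> S"
    hence s': "s \<in> carrier gr" using S_gr by blast
    have "generated_upto D n a" if "a \<in> s n" for n a
      using gr_rep(1)[OF s' that] D[OF s, of n] that
      by (cases "n \<le> D") (auto intro: generated_upto.base generated_upto_Fpred)
    thus "s \<in> B" using s' by (simp add: B_def)
  qed
  ultimately have B: "B = carrier gr" using S by (auto simp: alg_generates_def)
  have "generated_upto D n a" if a: "a \<in> F n" for n a
  proof -
    have "homog n a \<in> B" using homog_in_gr[OF a] B by simp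
    moreover have "a \<in> homog n a n" using homog_rep[of a n n] F_closed[OF a] by simp
    ultimately show ?thesis by (auto simp: B_def)
  qed
  thus ?thesis by blast
qed

end

section \<open>Filtered modules\<close>

lemma restrict_scalars_simps [simp]:
  "carrier (restrict_scalars A M) = carrier M"
  "zero (restrict_scalars A M) = zero M"
  "add (restrict_scalars A M) = add M"
  "smult (restrict_scalars A M) = (\<lambda>c x. (c \<odot>\<^bsub>A\<^esub> \<one>\<^bsub>A\<^esub>) \<odot>\<^bsub>M\<^esub> x)"
  by (simp_all add: restrict_scalars_def)

locale algebra_module = assoc_algebra K A + M: left_module A M
  for K :: "('k, 'x) ring_scheme" and A :: "('k, 'a) module" (structure)
    and M :: "('a, 'm) module"
begin

abbreviation R :: "('k, 'm) module" where "R \<equiv> restrict_scalars A M"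

lemma scalar_mult:
  assumes "c \<in> carrier K" "a \<in> carrier A"
  shows "(c \<odot> \<one>) \<otimes> a = c \<odot> a" "a \<otimes> (c \<odot> \<one>) = c \<odot> a"
  using smult_mult_left[of c \<one> a] smult_mult_right[of c a \<one>] assms by simp_all

lemma vectorspace_R: "vectorspace K R"
proof -
  have "abelian_group R"
  proof (rule abelian_groupI)
    show "\<exists>y\<in>carrier R. y \<oplus>\<^bsub>R\<^esub> x = \<zero>\<^bsub>R\<^esub>" if "x \<in> carrier R" for x
      using that M.M.l_neg by (intro bexI[of _ "\<ominus>\<^bsub>M\<^esub> x"]) auto
  qed (auto simp: M.M.a_assoc intro: M.M.a_comm)
  moreover have "module_axioms K R"
  proof
    show "(c \<otimes>\<^bsub>K\<^esub> d) \<odot>\<^bsub>R\<^esub> x = c \<odot>\<^bsub>R\<^esub> (d \<odot>\<^bsub>R\<^esub> x)"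
      if "c \<in> carrier K" "d \<in> carrier K" "x \<in> carrier R" for c d x
      using that scalar_mult(1)[of c "d \<odot> \<one>"] M.smult_assoc[of "c \<odot> \<one>" "d \<odot> \<one>" x]
      by (simp add: V.smult_assoc1)
  qed (auto simp: V.smult_l_distr M.smult_l_distr M.smult_r_distr M.smult_closed M.smult_one)
  ultimately show ?thesis
    by (intro vectorspace.intro Module.module.intro V.R.cring_axioms V.field_axioms)
qed

sublocale R: vectorspace K R by (rule vectorspace_R)

lemma act_scalar:
  assumes "c \<in> carrier K" "a \<in> carrier A" "x \<in> carrier M"
  shows "(c \<odot> a) \<odot>\<^bsub>M\<^esub> x = c \<odot>\<^bsub>R\<^esub> (a \<odot>\<^bsub>M\<^esub> x)" "a \<odot>\<^bsub>M\<^esub> (c \<odot>\<^bsub>R\<^esub> x) = c \<odot>\<^bsub>R\<^esub> (a \<odot>\<^bsub>M\<^esub> x)"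
  using assms by (simp_all add: M.smult_assoc[symmetric] scalar_mult)

lemma act_zero_left: "x \<in> carrier M \<Longrightarrow> \<zero> \<odot>\<^bsub>M\<^esub> x = \<zero>\<^bsub>M\<^esub>"
  using act_scalar(1)[of "\<zero>\<^bsub>K\<^esub>" \<one> x] R.smult_l_null[of x] M.smult_closed[of \<one> x]
  by simp

lemma act_zero_right: "a \<in> carrier A \<Longrightarrow> a \<odot>\<^bsub>M\<^esub> \<zero>\<^bsub>M\<^esub> = \<zero>\<^bsub>M\<^esub>"
  using act_scalar(2)[of "\<zero>\<^bsub>K\<^esub>" a "\<zero>\<^bsub>M\<^esub>"] R.smult_l_null[of "\<zero>\<^bsub>M\<^esub>"]
    R.smult_l_null[of "a \<odot>\<^bsub>M\<^esub> \<zero>\<^bsub>M\<^esub>"] M.smult_closed[of a "\<zero>\<^bsub>M\<^esub>"]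
  by simp

text \<open>Together with its left-hand counterpart below, this reduces every claim that an action
  maps a span into a subspace to a check on generators, by way of \<open>span_least\<close>.\<close>

lemma preimage_act_right_subspace:
  assumes "subspace K U R" "a \<in> carrier A"
  shows "subspace K {x \<in> carrier M. a \<odot>\<^bsub>M\<^esub> x \<in> U} R"
  by (rule R.subspaceI)
    (use assms(2) R.subspaceD[OF assms(1)] act_scalar(2) in
      \<open>auto simp: act_zero_right M.smult_r_distr M.smult_closed\<close>)

lemma preimage_act_left_subspace:
  assumes "subspace K U R" "x \<in> carrier M"
  shows "subspace K {a \<in> carrier A. a \<odot>\<^bsub>M\<^esub> x \<in> U} A"
  by (rule V.subspaceI)
    (use assms(2) R.subspaceD[OF assms(1)] act_scalar(1) in
      \<open>auto simp: act_zero_left M.smult_l_distr\<close>)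

lemma R_minus [simp]: "a_inv R = a_inv M"
  by (rule ext) (simp add: a_inv_def m_inv_def)

section \<open>Products of sets of algebra elements with sets of vectors\<close>

abbreviation act :: "'a set \<Rightarrow> 'm set \<Rightarrow> 'm set" where "act \<equiv> act_space K A M"

lemma act_gens_closed:
  "W \<subseteq> carrier A \<Longrightarrow> S \<subseteq> carrier M \<Longrightarrow> {w \<odot>\<^bsub>M\<^esub> x | w x. w \<in> W \<and> x \<in> S} \<subseteq> carrier R"
  using M.smult_closed by auto

lemma act_subspace:
  "W \<subseteq> carrier A \<Longrightarrow> S \<subseteq> carrier M \<Longrightarrow> subspace K (act W S) R"
  unfolding act_space_def by (intro R.span_is_subspace act_gens_closed)

lemma act_mem:
  assumes "W \<subseteq> carrier A" "S \<subseteq> carrier M" "w \<in> W" "x \<in> S"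
  shows "w \<odot>\<^bsub>M\<^esub> x \<in> act W S"
  using R.in_own_span[OF act_gens_closed[OF assms(1,2)]] assms(3,4) unfolding act_space_def by blast

lemma act_least:
  assumes "subspace K U R" "\<And>w x. w \<in> W \<Longrightarrow> x \<in> S \<Longrightarrow> w \<odot>\<^bsub>M\<^esub> x \<in> U"
  shows "act W S \<subseteq> U"
  unfolding act_space_def using assms by (intro R.span_least) auto

lemma act_mono:
  assumes "W \<subseteq> W'" "S \<subseteq> S'"
  shows "act W S \<subseteq> act W' S'"
  unfolding act_space_def using assms by (intro R.span_is_monotone) auto

lemma act_span_right:
  assumes W: "W \<subseteq> carrier A" and S: "S \<subseteq> carrier M"
  shows "act W (R.span S) = act W S"
proof
  have "R.span S \<subseteq> {x \<in> carrier M. w \<odot>\<^bsub>M\<^esub> x \<in> act W S}" if "w \<in> W" for w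
    using that W S by (intro R.span_least preimage_act_right_subspace act_subspace)
      (auto intro: act_mem)
  thus "act W (R.span S) \<subseteq> act W S"
    by (intro act_least act_subspace W S) auto
  show "act W S \<subseteq> act W (R.span S)"
    using R.in_own_span[of S] S by (intro act_mono) auto
qed

lemma act_span_left:
  assumes W: "W \<subseteq> carrier A" and S: "S \<subseteq> carrier M"
  shows "act (V.span W) S = act W S"
proof
  have "V.span W \<subseteq> {w \<in> carrier A. w \<odot>\<^bsub>M\<^esub> x \<in> act W S}" if "x \<in> S" for x
    using that W S by (intro V.span_least preimage_act_left_subspace act_subspace)
      (auto intro: act_mem)
  thus "act (V.span W) S \<subseteq> act W S"
    by (intro act_least act_subspace W S) auto
  show "act W S \<subseteq> act (V.span W) S"
    using V.in_own_span[of W] W by (intro act_mono) auto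
qed

lemma act_finite_span:
  assumes "finite W" "W \<subseteq> carrier A" "finite S" "S \<subseteq> carrier M"
  shows "\<exists>T. finite T \<and> T \<subseteq> carrier M \<and> act (V.span W) (R.span S) = R.span T"
proof (intro exI conjI)
  show "finite {w \<odot>\<^bsub>M\<^esub> x | w x. w \<in> W \<and> x \<in> S}"
    using finite_image_set2[of "\<lambda>w. w \<in> W" "\<lambda>x. x \<in> S"] assms by simp
  show "{w \<odot>\<^bsub>M\<^esub> x | w x. w \<in> W \<and> x \<in> S} \<subseteq> carrier M"
    using act_gens_closed[OF assms(2,4)] by simp
  show "act (V.span W) (R.span S) = R.span {w \<odot>\<^bsub>M\<^esub> x | w x. w \<in> W \<and> x \<in> S}"
    using act_span_right[of "V.span W" S] act_span_left[of W S] assms V.span_is_subset2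
    by (simp add: act_space_def)
qed

lemma submodule_subspace:
  assumes "Module.submodule N A M"
  shows "subspace K N R"
proof -
  interpret N: Module.submodule N A M by fact
  show ?thesis
    by (rule R.subspaceI) (use N.subset N.m_closed N.one_closed N.smult_closed in auto)
qed

end

locale filtered_module = filtered_algebra K A F + algebra_module K A M
  for K :: "('k, 'x) ring_scheme" and A :: "('k, 'a) module" (structure)
    and F :: "nat \<Rightarrow> 'a set" and M :: "('a, 'm) module"
begin

abbreviation fil :: "'m set \<Rightarrow> nat \<Rightarrow> 'm set" where "fil S n \<equiv> act (F n) S"

lemma fil_subspace: "S \<subseteq> carrier M \<Longrightarrow> subspace K (fil S n) R"
  by (intro act_subspace F_carrier)

lemma fil_closed: "S \<subseteq> carrier M \<Longrightarrow> fil S n \<subseteq> carrier M"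
  using R.subspaceD(1)[OF fil_subspace] by simp

lemma fil_mono: "i \<le> j \<Longrightarrow> fil S i \<subseteq> fil S j"
  by (intro act_mono F_mono) auto

lemma fil_base: "S \<subseteq> carrier M \<Longrightarrow> S \<subseteq> fil S n"
  using act_mem[OF F_carrier[of n], of S \<one>] F_one[of n] by (auto simp: M.smult_one subset_iff)

lemma fil_act:
  assumes S: "S \<subseteq> carrier M" and a: "a \<in> F p" and x: "x \<in> fil S n"
  shows "a \<odot>\<^bsub>M\<^esub> x \<in> fil S (p + n)"
proof -
  have "fil S n \<subseteq> {x \<in> carrier M. a \<odot>\<^bsub>M\<^esub> x \<in> fil S (p + n)}"
  proof (rule act_least)
    show "subspace K {x \<in> carrier M. a \<odot>\<^bsub>M\<^esub> x \<in> fil S (p + n)} R"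
      using a F_closed S by (intro preimage_act_right_subspace fil_subspace) auto
    show "b \<odot>\<^bsub>M\<^esub> s \<in> {x \<in> carrier M. a \<odot>\<^bsub>M\<^esub> x \<in> fil S (p + n)}" if "b \<in> F n" "s \<in> S" for b s
    proof -
      have "s \<in> carrier M" using that S by blast
      hence "a \<odot>\<^bsub>M\<^esub> (b \<odot>\<^bsub>M\<^esub> s) = (a \<otimes> b) \<odot>\<^bsub>M\<^esub> s"
        using a that F_closed by (intro M.smult_assoc[symmetric]) auto
      moreover have "(a \<otimes> b) \<odot>\<^bsub>M\<^esub> s \<in> fil S (p + n)"
        using a that S by (intro act_mem F_carrier F_mult)
      ultimately show ?thesis using that F_closed[OF that(1)] S by (auto intro: M.smult_closed)
    qed
  qed
  thus ?thesis using x by blast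
qed

lemma fil_finite_span:
  assumes "finite S" "S \<subseteq> carrier M"
  shows "\<exists>T. finite T \<and> T \<subseteq> carrier M \<and> fil S n = R.span T"
proof -
  obtain W where W: "finite W" "W \<subseteq> carrier A" "F n = V.span W" using F_finite_span by blast
  have "fil S n = act (V.span W) (R.span S)"
    using act_span_right[OF F_carrier assms(2), of n] W(3) by simp
  thus ?thesis using act_finite_span[OF W(1,2) assms] by simp
qed

text \<open>Each of two finite generating sets lies in some step of the filtration given by the
  other, so by this inclusion the two filtrations differ by a bounded shift.\<close>

lemma fil_subset_shift:
  assumes "S \<subseteq> carrier M" "T \<subseteq> fil S s"
  shows "fil T n \<subseteq> fil S (n + s)"
  using assms by (intro act_least fil_subspace) (auto intro: fil_act)

lemma fil_Union:
  assumes "mod_generates A M S"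
  shows "(\<Union>n. fil S n) = carrier M"
proof -
  have S: "S \<subseteq> carrier M" using assms by (simp add: mod_generates_def)
  define N where "N = (\<Union>n. fil S n)"
  have N_carrier: "N \<subseteq> carrier M" using fil_closed[OF S] by (auto simp: N_def)
  have N_smult: "a \<odot>\<^bsub>M\<^esub> x \<in> N" if a: "a \<in> carrier A" and x: "x \<in> N" for a x
  proof -
    obtain n where n: "x \<in> fil S n" using x by (auto simp: N_def)
    obtain p where p: "a \<in> F p" using a F_union by blast
    show ?thesis using fil_act[OF S p n] by (auto simp: N_def)
  qed
  have N_add: "x \<oplus>\<^bsub>M\<^esub> y \<in> N" if "x \<in> N" "y \<in> N" for x y
  proof -
    obtain m n where mn: "x \<in> fil S m" "y \<in> fil S n" using \<open>x \<in> N\<close> \<open>y \<in> N\<close> by (auto simp: N_def)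
    have "x \<in> fil S (max m n)" "y \<in> fil S (max m n)"
      using mn fil_mono[of m "max m n" S] fil_mono[of n "max m n" S] by auto
    from R.subspaceD(3)[OF fil_subspace[OF S] this] show ?thesis by (auto simp: N_def)
  qed
  have "Module.submodule N A M"
  proof (intro Module.submodule.intro submodule_axioms.intro N_smult)
    have zero: "\<zero>\<^bsub>M\<^esub> \<in> N"
      using R.subspaceD(2)[OF fil_subspace[OF S]] by (auto simp: N_def)
    have neg: "\<ominus>\<^bsub>M\<^esub> x \<in> N" if x: "x \<in> N" for x
    proof -
      obtain n where n: "x \<in> fil S n" using x by (auto simp: N_def)
      show ?thesis using R.subspace_minus(1)[OF fil_subspace[OF S] n n] by (auto simp: N_def)
    qed
    show "subgroup N (add_monoid M)"
      by (rule M.M.add.subgroupI) (use N_carrier N_add zero neg in \<open>auto simp: a_inv_def\<close>)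
  qed
  moreover have "S \<subseteq> N" using fil_base[OF S] by (auto simp: N_def)
  ultimately show ?thesis using assms by (auto simp: mod_generates_def N_def)
qed

lemma fil_absorbs_finite:
  assumes "mod_generates A M S" "finite T" "T \<subseteq> carrier M"
  shows "\<exists>s. T \<subseteq> fil S s"
  using assms(2,3)
proof (induction T rule: finite_induct)
  case (insert t T)
  then obtain m where m: "T \<subseteq> fil S m" by auto
  obtain n where n: "t \<in> fil S n" using insert.prems fil_Union[OF assms(1)] by blast
  have "insert t T \<subseteq> fil S (max m n)"
    using m n fil_mono[of m "max m n" S] fil_mono[of n "max m n" S] by auto
  thus ?case by blast
qed simp

text \<open>The cumulative Hilbert function: dimensions of the filtration steps, not of their
  successive quotients.\<close>

definition hilb :: "'m set \<Rightarrow> nat \<Rightarrow> nat" where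
  "hilb S n = sdim K R (fil S n)"

lemma sdim_mono_fil:
  assumes "finite S" "S \<subseteq> carrier M" "subspace K W R" "W \<subseteq> fil S n"
  shows "sdim K R W \<le> hilb S n"
proof -
  obtain T where "finite T" "T \<subseteq> carrier M" "fil S n = R.span T"
    using fil_finite_span[OF assms(1,2), of n] by metis
  thus ?thesis using R.sdim_mono[of T W] assms by (simp add: hilb_def)
qed

end

section \<open>Standard monomials and Groebner bases\<close>

text \<open>Adding the vectors in increasing order of their index, the dimension grows exactly at
  those outside the span of their predecessors. Indices are counted rather than vectors because v
  may repeat values. The induction adds a maximal index, which leaves the predecessors of the others
  alone.\<close>

lemma (in vectorspace) sdim_span_standard:
  fixes J :: "'i :: linorder set"
  assumes "finite J" "v ` J \<subseteq> carrier V"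
  shows "sdim K V (span (v ` J)) = card {i\<in>J. v i \<notin> span (v ` {k\<in>J. k < i})}"
  using assms
proof (induction J rule: finite_linorder_max_induct)
  case empty
  thus ?case by (simp add: span_empty sdim_zero)
next
  case (insert b J)
  let ?P = "\<lambda>J i. v i \<notin> span (v ` {k\<in>J. k < i})"
  have below: "{k \<in> insert b J. k < i} = {k\<in>J. k < i}" if "i \<in> J" for i
    using that insert.hyps(2) by (auto dest: less_asym)
  have "{k \<in> insert b J. k < b} = J" using insert.hyps(2) by auto
  hence eq: "{i \<in> insert b J. ?P (insert b J) i} = {i\<in>J. ?P J i} \<union> (if v b \<in> span (v ` J) then {} else {b})"
    using below by (auto simp: conj_commute cong: conj_cong)
  have "b \<notin> J" using insert.hyps(2) by auto
  hence "card {i \<in> insert b J. ?P (insert b J) i} = card {i\<in>J. ?P J i} + (if v b \<in> span (v ` J) then 0 else 1)"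
    unfolding eq using insert.hyps(1) by (subst card_Un_disjoint) auto
  moreover have "sdim K V (span (v ` insert b J)) =
      sdim K V (span (v ` J)) + (if v b \<in> span (v ` J) then 0 else 1)"
    using sdim_span_insert[of "v ` J" "v b"] insert by simp
  ultimately show ?case using insert by simp
qed

text \<open>Variables are provided for degrees 1 to D, where the rule \<open>mult\<close> of
  \<open>generated_upto\<close> calls for them. Degree 0 is taken over by the vectors t: by
  \<open>t_F0\<close> their span is stable under \<open>F 0\<close>, so no variable of weight 0
  arises.\<close>

locale monomial_module = filtered_module K A F M
  for K :: "('k, 'x) ring_scheme" and A :: "('k, 'a) module" (structure)
    and F :: "nat \<Rightarrow> 'a set" and M :: "('a, 'm) module" +
  fixes D :: nat and r :: nat and x :: "nat \<Rightarrow> 'a" and d :: "nat \<Rightarrow> nat"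
    and q :: nat and t :: "nat \<Rightarrow> 'm"
  assumes comm: "\<And>a b i j. a \<in> F i \<Longrightarrow> b \<in> F j \<Longrightarrow> a \<otimes> b \<ominus> b \<otimes> a \<in> Fpred (i + j)"
    and generated_upto: "\<And>a n. a \<in> F n \<Longrightarrow> generated_upto D n a"
    and d_pos: "\<And>i. i < r \<Longrightarrow> 1 \<le> d i"
    and x_F: "\<And>i. i < r \<Longrightarrow> x i \<in> F (d i)"
    and x_span: "\<And>e. 1 \<le> e \<Longrightarrow> e \<le> D \<Longrightarrow> F e \<subseteq> V.span (x ` {i. i < r \<and> d i = e})"
    and t_closed: "\<And>j. j < q \<Longrightarrow> t j \<in> carrier M"
    and t_F0: "\<And>a j. a \<in> F 0 \<Longrightarrow> j < q \<Longrightarrow> a \<odot>\<^bsub>M\<^esub> t j \<in> R.span (t ` {..<q})"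
begin

abbreviation T :: "'m set" where "T \<equiv> t ` {..<q}"

lemma T_closed: "T \<subseteq> carrier M" using t_closed by auto

section \<open>Reordering words modulo terms of lower weight\<close>

definition xprod :: "nat list \<Rightarrow> 'a" where "xprod w = foldr (\<lambda>i a. x i \<otimes> a) w \<one>"

definition word :: "nat list \<Rightarrow> 'm \<Rightarrow> 'm" where "word w m = xprod w \<odot>\<^bsub>M\<^esub> m"

abbreviation words :: "nat list set" where "words \<equiv> {w. set w \<subseteq> {..<r}}"

lemma x_closed: "i < r \<Longrightarrow> x i \<in> carrier A" using x_F F_closed by blast

lemma xprod_F: "w \<in> words \<Longrightarrow> xprod w \<in> F (wt d (mset w))"
proof (induction w)
  case Nil
  show ?case by (simp add: xprod_def F_one)
next
  case (Cons i w)
  thus ?case using F_mult[OF x_F[of i], of "xprod w" "wt d (mset w)"] by (simp add: xprod_def)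
qed

lemma xprod_closed: "w \<in> words \<Longrightarrow> xprod w \<in> carrier A"
  using xprod_F F_closed by blast

lemma word_closed: "w \<in> words \<Longrightarrow> m \<in> carrier M \<Longrightarrow> word w m \<in> carrier M"
  unfolding word_def by (intro M.smult_closed xprod_closed)

lemma word_Nil: "m \<in> carrier M \<Longrightarrow> word [] m = m"
  by (simp add: word_def xprod_def M.smult_one)

lemma word_Cons: "i # w \<in> words \<Longrightarrow> m \<in> carrier M \<Longrightarrow> word (i # w) m = x i \<odot>\<^bsub>M\<^esub> word w m"
  using x_closed[of i] xprod_closed[of w] by (simp add: word_def xprod_def M.smult_assoc)

lemma word_append:
  "u @ w \<in> words \<Longrightarrow> m \<in> carrier M \<Longrightarrow> word (u @ w) m = word u (word w m)"
proof (induction u)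
  case Nil
  thus ?case by (simp add: word_Nil word_closed)
next
  case (Cons i u)
  thus ?case by (simp add: word_Cons word_closed)
qed

lemma word_fil: "w \<in> words \<Longrightarrow> m \<in> fil T k \<Longrightarrow> word w m \<in> fil T (wt d (mset w) + k)"
  unfolding word_def by (intro fil_act T_closed xprod_F)

text \<open>The counterpart of \<open>Fpred\<close> in the module; the index is shifted by one so
  that the zero space lies below degree 0.\<close>

primrec filp :: "nat \<Rightarrow> 'm set" where
  "filp 0 = {\<zero>\<^bsub>M\<^esub>}"
| "filp (Suc n) = fil T n"

lemma filp_subspace: "subspace K (filp n) R"
  by (cases n) (auto intro!: R.subspaceI fil_subspace T_closed simp: act_zero_right)

lemma filp_closed: "u \<in> filp n \<Longrightarrow> u \<in> carrier M"
  using R.subspaceD(1)[OF filp_subspace] by auto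

lemma filp_act:
  assumes "a \<in> F p" "u \<in> filp n"
  shows "a \<odot>\<^bsub>M\<^esub> u \<in> filp (p + n)"
proof (cases n)
  case 0
  thus ?thesis using assms F_closed[OF assms(1)] R.subspaceD(2)[OF filp_subspace]
    by (simp add: act_zero_right)
next
  case (Suc m)
  thus ?thesis using assms fil_act[OF T_closed, of a p u m] by simp
qed

lemma Fpred_act:
  assumes "a \<in> Fpred p" "m \<in> fil T k"
  shows "a \<odot>\<^bsub>M\<^esub> m \<in> filp (p + k)"
proof (cases p)
  case 0
  thus ?thesis using assms fil_closed[OF T_closed, of k] R.subspaceD(2)[OF filp_subspace]
    by (auto simp: act_zero_left)
next
  case (Suc p')
  thus ?thesis using assms fil_act[OF T_closed, of a p' m k] by simp
qed

text \<open>Congruence modulo lower terms, the substitute for equality in degree n of an associated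
  graded module.\<close>

definition cong_lower :: "nat \<Rightarrow> 'm \<Rightarrow> 'm \<Rightarrow> bool" where
  "cong_lower n y z \<longleftrightarrow> z \<in> carrier M \<and> (\<exists>u\<in>filp n. y = z \<oplus>\<^bsub>M\<^esub> u)"

lemma cong_lower_refl: "y \<in> carrier M \<Longrightarrow> cong_lower n y y"
  using R.subspaceD(2)[OF filp_subspace[of n]] by (auto simp: cong_lower_def intro!: bexI[of _ "\<zero>\<^bsub>M\<^esub>"])

lemma cong_lower_trans:
  assumes "cong_lower n y z" "cong_lower n z u"
  shows "cong_lower n y u"
proof -
  obtain v where v: "v \<in> filp n" "y = z \<oplus>\<^bsub>M\<^esub> v" using assms(1) by (auto simp: cong_lower_def)
  obtain w where w: "w \<in> filp n" "z = u \<oplus>\<^bsub>M\<^esub> w" "u \<in> carrier M" using assms(2) by (auto simp: cong_lower_def)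
  have "y = u \<oplus>\<^bsub>M\<^esub> (w \<oplus>\<^bsub>M\<^esub> v)"
    using v w filp_closed by (simp add: M.M.a_assoc)
  moreover have "w \<oplus>\<^bsub>M\<^esub> v \<in> filp n" using R.subspaceD(3)[OF filp_subspace w(1) v(1)] by simp
  ultimately show ?thesis using w(3) unfolding cong_lower_def by blast
qed

lemma cong_lower_act:
  assumes "cong_lower n y z" "a \<in> F p"
  shows "cong_lower (p + n) (a \<odot>\<^bsub>M\<^esub> y) (a \<odot>\<^bsub>M\<^esub> z)"
proof -
  obtain v where v: "v \<in> filp n" "y = z \<oplus>\<^bsub>M\<^esub> v" "z \<in> carrier M" using assms(1) by (auto simp: cong_lower_def)
  have a: "a \<in> carrier A" using assms(2) F_closed by blast
  have "a \<odot>\<^bsub>M\<^esub> y = a \<odot>\<^bsub>M\<^esub> z \<oplus>\<^bsub>M\<^esub> a \<odot>\<^bsub>M\<^esub> v"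
    using v a filp_closed by (simp add: M.smult_r_distr)
  thus ?thesis
    using filp_act[OF assms(2) v(1)] M.smult_closed[OF a v(3)] unfolding cong_lower_def by blast
qed

text \<open>By \<open>comm\<close> the commutator of two variables lies one step below the sum of
  their degrees, so its action lands below the total weight.\<close>

lemma cong_lower_swap:
  assumes "i < r" "j < r" "m \<in> fil T k"
  shows "cong_lower (d i + d j + k) (x i \<odot>\<^bsub>M\<^esub> (x j \<odot>\<^bsub>M\<^esub> m)) (x j \<odot>\<^bsub>M\<^esub> (x i \<odot>\<^bsub>M\<^esub> m))"
proof -
  have m: "m \<in> carrier M" using assms(3) fil_closed[OF T_closed] by blast
  have xs: "x i \<in> carrier A" "x j \<in> carrier A" using assms x_closed by auto
  let ?c = "x i \<otimes> x j \<ominus> x j \<otimes> x i"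
  have "x i \<otimes> x j = x j \<otimes> x i \<oplus> ?c"
    using xs V.M.a_lcomm[of "x j \<otimes> x i" "x i \<otimes> x j" "\<ominus> (x j \<otimes> x i)"]
    by (simp add: a_minus_def V.M.r_neg)
  hence "(x i \<otimes> x j) \<odot>\<^bsub>M\<^esub> m = (x j \<otimes> x i) \<odot>\<^bsub>M\<^esub> m \<oplus>\<^bsub>M\<^esub> ?c \<odot>\<^bsub>M\<^esub> m"
    using xs m M.smult_l_distr[of "x j \<otimes> x i" ?c m] by simp
  moreover have "?c \<odot>\<^bsub>M\<^esub> m \<in> filp (d i + d j + k)"
    using assms by (intro Fpred_act comm x_F)
  ultimately show ?thesis using xs m by (auto simp: cong_lower_def M.smult_assoc M.smult_closed)
qed

lemma word_move_front:
  assumes "u \<in> words" "i < r" "m \<in> fil T k"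
  shows "cong_lower (wt d (mset u) + d i + k) (word (u @ [i]) m) (word (i # u) m)"
  using assms(1)
proof (induction u)
  case Nil
  have "m \<in> carrier M" using assms(3) fil_closed[OF T_closed] by blast
  thus ?case using assms by (auto intro!: cong_lower_refl word_closed)
next
  case (Cons j u)
  have m: "m \<in> carrier M" using assms(3) fil_closed[OF T_closed] by blast
  have j: "j < r" "u \<in> words" using Cons.prems by auto
  have "cong_lower (d j + (wt d (mset u) + d i + k)) (x j \<odot>\<^bsub>M\<^esub> word (u @ [i]) m) (x j \<odot>\<^bsub>M\<^esub> word (i # u) m)"
    using Cons.IH[OF j(2)] x_F[OF j(1)] by (rule cong_lower_act)
  moreover have "cong_lower (d j + d i + (wt d (mset u) + k))
      (x j \<odot>\<^bsub>M\<^esub> (x i \<odot>\<^bsub>M\<^esub> word u m)) (x i \<odot>\<^bsub>M\<^esub> (x j \<odot>\<^bsub>M\<^esub> word u m))"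
    using j assms by (intro cong_lower_swap word_fil)
  moreover have "word (i # u) m = x i \<odot>\<^bsub>M\<^esub> word u m" using j assms m by (intro word_Cons) auto
  moreover have "d j + d i + (wt d (mset u) + k) = d j + (wt d (mset u) + d i + k)" by simp
  ultimately have "cong_lower (d j + (wt d (mset u) + d i + k)) (x j \<odot>\<^bsub>M\<^esub> word (u @ [i]) m)
      (x i \<odot>\<^bsub>M\<^esub> (x j \<odot>\<^bsub>M\<^esub> word u m))"
    using cong_lower_trans by metis
  moreover have "word ((j # u) @ [i]) m = x j \<odot>\<^bsub>M\<^esub> word (u @ [i]) m"
    using word_Cons[of j "u @ [i]" m] j assms m by simp
  moreover have "word (i # j # u) m = x i \<odot>\<^bsub>M\<^esub> (x j \<odot>\<^bsub>M\<^esub> word u m)"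
    using word_Cons[of i "j # u" m] word_Cons[of j u m] j assms m by simp
  moreover have "wt d (mset (j # u)) + d i + k = d j + (wt d (mset u) + d i + k)" by simp
  ultimately show ?case by (simp add: add.assoc)
qed

text \<open>The first letter of w is located in w' and moved to the front of the part before it by
  \<open>word_move_front\<close>; what remains are permutations of each other. Every exchange costs
  terms of \<open>filp\<close> only, so commutativity of the graded algebra is enough.\<close>

lemma word_perm:
  assumes "w \<in> words" "mset w = mset w'" "m \<in> fil T k"
  shows "cong_lower (wt d (mset w) + k) (word w m) (word w' m)"
  using assms(1,2)
proof (induction w arbitrary: w')
  case Nil
  have "m \<in> carrier M" using assms(3) fil_closed[OF T_closed] by blast
  thus ?case using Nil by (auto intro!: cong_lower_refl word_closed)
next
  case (Cons i v)
  have m: "m \<in> carrier M" using assms(3) fil_closed[OF T_closed] by blast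
  have w': "set w' = set (i # v)" using arg_cong[OF Cons.prems(2), of set_mset] by simp
  have "i \<in> set w'" using w' by simp
  from split_list[OF this] obtain u u' where u: "w' = u @ i # u'" by (elim exE)
  have W: "v \<in> words" "u \<in> words" "u' \<in> words" "i < r" using Cons.prems w' u by auto
  have mset: "mset v = mset (u @ u')" using Cons.prems(2) u by simp
  have "cong_lower (d i + (wt d (mset v) + k)) (x i \<odot>\<^bsub>M\<^esub> word v m) (x i \<odot>\<^bsub>M\<^esub> word (u @ u') m)"
    by (rule cong_lower_act[OF Cons.IH[OF W(1) mset] x_F[OF W(4)]])
  hence 1: "cong_lower (wt d (mset (i # v)) + k) (word (i # v) m) (word (i # u) (word u' m))"
    using W m by (simp add: word_Cons word_append word_closed ac_simps)
  have "u' \<in> words" using W by simp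
  hence "cong_lower (wt d (mset u) + d i + (wt d (mset u') + k)) (word (u @ [i]) (word u' m)) (word (i # u) (word u' m))"
    by (intro word_move_front W word_fil assms(3))
  moreover have "word (u @ [i]) (word u' m) = word w' m"
    using W m u word_append[of "u @ [i]" u' m] by simp
  ultimately have 2: "cong_lower (wt d (mset (i # v)) + k) (word w' m) (word (i # u) (word u' m))"
    using mset by (simp add: ac_simps)
  \<comment> \<open>The congruence is wanted in the opposite direction, so the correction z changes
    sides with its sign reversed.\<close>
  obtain z where z: "z \<in> filp (wt d (mset (i # v)) + k)" "word w' m = word (i # u) (word u' m) \<oplus>\<^bsub>M\<^esub> z"
    using 2 by (auto simp: cong_lower_def)
  have c: "word (i # u) (word u' m) \<in> carrier M" "z \<in> carrier M"
    using W m filp_closed[OF z(1)] by (auto intro!: word_closed)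
  have "word (i # u) (word u' m) = word w' m \<oplus>\<^bsub>M\<^esub> \<ominus>\<^bsub>M\<^esub> z"
    using z(2) c by (simp add: M.M.a_assoc M.M.r_neg)
  moreover have "\<ominus>\<^bsub>M\<^esub> z \<in> filp (wt d (mset (i # v)) + k)"
    using R.subspace_minus(1)[OF filp_subspace z(1) z(1)] by simp
  moreover have "word w' m \<in> carrier M" using w' Cons.prems(1) m by (intro word_closed) auto
  ultimately have "cong_lower (wt d (mset (i # v)) + k) (word (i # u) (word u' m)) (word w' m)"
    unfolding cong_lower_def by blast
  with 1 show ?case by (rule cong_lower_trans)
qed

definition mon :: "nat multiset \<Rightarrow> 'm \<Rightarrow> 'm" where
  "mon \<alpha> m = word (sorted_list_of_multiset \<alpha>) m"

definition word_span :: "nat \<Rightarrow> 'm set" where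
  "word_span n = R.span {word w s | w s. w \<in> words \<and> wt d (mset w) \<le> n \<and> s \<in> T}"

lemma word_span_subspace: "subspace K (word_span n) R"
  unfolding word_span_def using T_closed by (intro R.span_is_subspace) (auto intro!: word_closed)

lemma word_span_mem: "w \<in> words \<Longrightarrow> wt d (mset w) \<le> n \<Longrightarrow> s \<in> T \<Longrightarrow> word w s \<in> word_span n"
  unfolding word_span_def using T_closed
  by (intro subsetD[OF R.in_own_span]) (auto intro!: word_closed)

lemma word_span_mono: "m \<le> n \<Longrightarrow> word_span m \<subseteq> word_span n"
  unfolding word_span_def by (intro R.span_is_monotone) (blast intro: order_trans)

lemma word_span_act:
  assumes e: "1 \<le> e" "e \<le> D" and a: "a \<in> F e" and y: "y \<in> word_span m"
  shows "a \<odot>\<^bsub>M\<^esub> y \<in> word_span (e + m)"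
proof -
  have "word_span m \<subseteq> {y \<in> carrier M. a \<odot>\<^bsub>M\<^esub> y \<in> word_span (e + m)}"
    unfolding word_span_def[of m]
  proof (rule R.span_least)
    show "subspace K {y \<in> carrier M. a \<odot>\<^bsub>M\<^esub> y \<in> word_span (e + m)} R"
      using F_closed[OF a] by (intro preimage_act_right_subspace word_span_subspace)
    have "a \<odot>\<^bsub>M\<^esub> word w s \<in> word_span (e + m)" if w: "w \<in> words" "wt d (mset w) \<le> m" "s \<in> T" for w s
    proof -
      have ws: "word w s \<in> carrier M" using w T_closed by (intro word_closed) auto
      have "V.span (x ` {i. i < r \<and> d i = e}) \<subseteq> {b \<in> carrier A. b \<odot>\<^bsub>M\<^esub> word w s \<in> word_span (e + m)}"
      proof (intro V.span_least preimage_act_left_subspace word_span_subspace ws image_subsetI CollectI conjI)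
        fix i assume i: "i \<in> {i. i < r \<and> d i = e}"
        thus "x i \<in> carrier A" using x_closed by auto
        have "x i \<odot>\<^bsub>M\<^esub> word w s = word (i # w) s" using w i T_closed by (intro word_Cons[symmetric]) auto
        also have "\<dots> \<in> word_span (e + m)" using w i by (intro word_span_mem) auto
        finally show "x i \<odot>\<^bsub>M\<^esub> word w s \<in> word_span (e + m)" .
      qed
      thus ?thesis using x_span[OF e] a by blast
    qed
    thus "{word w s |w s. w \<in> words \<and> wt d (mset w) \<le> m \<and> s \<in> T} \<subseteq> {y \<in> carrier M. a \<odot>\<^bsub>M\<^esub> y \<in> word_span (e + m)}"
      using T_closed by (auto intro!: word_closed)
  qed
  thus ?thesis using y by blast
qed

lemma T_word_span: "T \<subseteq> word_span 0"
proof
  fix s assume s: "s \<in> T"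
  hence "word [] s = s" using T_closed by (intro word_Nil) auto
  thus "s \<in> word_span 0" using word_span_mem[of "[]" 0 s] s by simp
qed

text \<open>Rule induction on the derivation of a. Only the rule \<open>lower\<close> produces an
  arbitrary element of a lower step, so the inclusion is assumed below n only, which suits a strong
  induction on n. In degree 0 the element acts within the span of the vectors t.\<close>

lemma generated_upto_word_span:
  assumes "generated_upto D n a" "\<And>m. m < n \<Longrightarrow> fil T m \<subseteq> word_span m" "s \<in> T"
  shows "a \<odot>\<^bsub>M\<^esub> s \<in> word_span n"
  using assms
proof (induction rule: generated_upto.induct)
  case (base n a)
  show ?case
  proof (cases "n = 0")
    case True
    hence "a \<odot>\<^bsub>M\<^esub> s \<in> R.span T" using t_F0 base by auto
    also have "R.span T \<subseteq> word_span 0" by (intro R.span_least word_span_subspace T_word_span)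
    finally show ?thesis using True by simp
  next
    case False
    thus ?thesis using word_span_act[of n a s 0] base T_word_span by auto
  qed
next
  case (lower a n)
  have "a \<odot>\<^bsub>M\<^esub> s \<in> fil T n" using lower by (intro act_mem F_carrier T_closed)
  thus ?case using lower.prems(1)[of n] word_span_mono[of n "Suc n"] by auto
next
  case (mult i a m b)
  have s: "s \<in> carrier M" using mult.prems T_closed by auto
  have "b \<odot>\<^bsub>M\<^esub> s \<in> word_span m" using mult by simp
  hence "a \<odot>\<^bsub>M\<^esub> (b \<odot>\<^bsub>M\<^esub> s) \<in> word_span (i + m)" using mult by (intro word_span_act)
  thus ?case
    using M.smult_assoc[OF F_closed[OF mult.hyps(3)] generated_upto_closed[OF mult.hyps(4)] s] by simp
next
  case (add n a b)
  have s: "s \<in> carrier M" using add.prems T_closed by auto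
  show ?case
    using M.smult_l_distr[OF generated_upto_closed[OF add.hyps(1)] generated_upto_closed[OF add.hyps(2)] s]
      R.subspaceD(3)[OF word_span_subspace add.IH(1)[OF add.prems] add.IH(2)[OF add.prems]] by simp
qed

lemma fil_le_word_span: "fil T n \<subseteq> word_span n"
proof (induction n rule: less_induct)
  case (less n)
  show ?case
  proof (rule act_least[OF word_span_subspace])
    fix a s assume "a \<in> F n" "s \<in> T"
    show "a \<odot>\<^bsub>M\<^esub> s \<in> word_span n"
      by (rule generated_upto_word_span[OF generated_upto[OF \<open>a \<in> F n\<close>] less \<open>s \<in> T\<close>])
  qed
qed

lemma word_mon:
  assumes "w \<in> words" "s \<in> T"
  shows "cong_lower (wt d (mset w)) (word w s) (mon (mset w) s)"
  using word_perm[of w "sorted_list_of_multiset (mset w)" s 0] assms fil_base[OF T_closed, of 0]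
  by (auto simp: mon_def)

section \<open>Monomial order and spanning by ordered monomials\<close>

type_synonym key = "nat \<times> nat multiset \<times> nat"

text \<open>The weight is determined by the multiset but stored in front, so that the lexicographic
  order on triples compares weights first, then multisets, then generator indices. With positive
  weights only finitely many keys lie below a given triple, which makes division terminate.\<close>

definition keys :: "key set" where
  "keys = {(n, \<alpha>, j). n = wt d \<alpha> \<and> set_mset \<alpha> \<subseteq> {..<r} \<and> j < q}"

definition vec :: "key \<Rightarrow> 'm" where "vec = (\<lambda>(n, \<alpha>, j). mon \<alpha> (t j))"

definition low :: "key \<Rightarrow> 'm set" where "low \<kappa> = R.span (vec ` {k\<in>keys. k < \<kappa>})"

lemma vec_closed: "k \<in> keys \<Longrightarrow> vec k \<in> carrier M"
  by (auto simp: keys_def vec_def mon_def intro!: word_closed t_closed)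

lemma vec_image_closed: "vec ` {k\<in>keys. P k} \<subseteq> carrier M"
  using vec_closed by auto

lemma low_subspace: "subspace K (low \<kappa>) R"
  unfolding low_def using vec_image_closed by (intro R.span_is_subspace) simp

lemma low_closed: "y \<in> low \<kappa> \<Longrightarrow> y \<in> carrier M"
  using subsetD[OF R.subspaceD(1)[OF low_subspace[of \<kappa>]]] by simp

lemma low_mono: "\<kappa> \<le> \<kappa>' \<Longrightarrow> low \<kappa> \<subseteq> low \<kappa>'"
  unfolding low_def by (intro R.span_is_monotone) auto

lemma vec_low: "k \<in> keys \<Longrightarrow> k < \<kappa> \<Longrightarrow> vec k \<in> low \<kappa>"
  unfolding low_def using R.in_own_span[of "vec ` {k\<in>keys. k < \<kappa>}"] vec_image_closed by auto

text \<open>The triple on the left is the least one of weight n + 1, since the empty multiset and 0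
  are least. Filtration steps thereby become special cases of \<open>low\<close>.\<close>

lemma key_less_top: "k < (Suc n, {#}, 0) \<longleftrightarrow> fst k \<le> n" for k :: key
  by (cases k) (auto simp: less_prod_def')

lemma finite_keys: "finite {k\<in>keys. fst k \<le> n}"
proof (rule finite_subset)
  show "{k\<in>keys. fst k \<le> n} \<subseteq> {..n} \<times> {\<alpha>. set_mset \<alpha> \<subseteq> {..<r} \<and> wt d \<alpha> \<le> n} \<times> {..<q}"
    by (auto simp: keys_def)
  show "finite ({..n} \<times> {\<alpha>. set_mset \<alpha> \<subseteq> {..<r} \<and> wt d \<alpha> \<le> n} \<times> {..<q})"
    using d_pos by (intro finite_cartesian_product finite_wt_le) auto
qed

lemma finite_keys_less: "finite {k\<in>keys. k < \<kappa>}"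
  by (rule finite_subset[OF _ finite_keys[of "fst \<kappa>"]]) (cases \<kappa>, auto simp: less_prod_def')

text \<open>Sorting a word leaves an error of smaller weight, to which induction on the weight
  applies; hence ordered monomials span as much as all words do. Comparing weights first makes this
  span one of the spaces \<open>low\<close>.\<close>

lemma fil_eq_low: "fil T n = low (Suc n, {#}, 0)"
proof
  show "low (Suc n, {#}, 0) \<subseteq> fil T n"
    unfolding low_def
  proof (intro R.span_least fil_subspace T_closed image_subsetI)
    fix k assume "k \<in> {k\<in>keys. k < (Suc n, {#}, 0)}"
    then obtain m \<alpha> j where k: "k = (m, \<alpha>, j)" "m = wt d \<alpha>" "set_mset \<alpha> \<subseteq> {..<r}" "j < q" "m \<le> n"
      unfolding key_less_top by (auto simp: keys_def)
    have "mon \<alpha> (t j) \<in> fil T (wt d (mset (sorted_list_of_multiset \<alpha>)) + 0)"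
      unfolding mon_def using k fil_base[OF T_closed, of 0] by (intro word_fil) auto
    thus "vec k \<in> fil T n" using k fil_mono[of m n T] by (auto simp: vec_def)
  qed
  have "word_span n \<subseteq> low (Suc n, {#}, 0)"
  proof (induction n rule: less_induct)
    case (less n)
    have "word w s \<in> low (Suc n, {#}, 0)" if w: "w \<in> words" "wt d (mset w) \<le> n" "s \<in> T" for w s
    proof -
      obtain u where u: "u \<in> filp (wt d (mset w))" "word w s = mon (mset w) s \<oplus>\<^bsub>M\<^esub> u"
        using word_mon[OF w(1,3)] by (auto simp: cong_lower_def)
      obtain j where j: "j < q" "s = t j" using w(3) by auto
      have "(wt d (mset w), mset w, j) \<in> keys" using w j by (auto simp: keys_def)
      hence "mon (mset w) s \<in> low (Suc n, {#}, 0)"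
        using vec_low[of "(wt d (mset w), mset w, j)" "(Suc n, {#}, 0)"] w(2) j
        by (simp add: key_less_top vec_def)
      moreover have "u \<in> low (Suc n, {#}, 0)"
      proof (cases "wt d (mset w)")
        case 0
        thus ?thesis using u(1) R.subspaceD(2)[OF low_subspace] by simp
      next
        case (Suc N)
        hence "u \<in> word_span N" using u(1) fil_le_word_span by auto
        also have "word_span N \<subseteq> low (Suc N, {#}, 0)" using Suc w(2) by (intro less) simp
        also have "\<dots> \<subseteq> low (Suc n, {#}, 0)" using Suc w(2) by (intro low_mono) (simp add: less_eq_prod_def)
        finally show ?thesis .
      qed
      ultimately show ?thesis using R.subspaceD(3)[OF low_subspace] u(2) by simp
    qed
    thus ?case unfolding word_span_def by (intro R.span_least low_subspace) auto
  qed
  thus "fil T n \<subseteq> low (Suc n, {#}, 0)" using fil_le_word_span by blast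
qed

lemma filp_low: "filp n \<subseteq> low (n, \<alpha>, j)"
proof (cases n)
  case 0
  thus ?thesis using R.subspaceD(2)[OF low_subspace] by simp
next
  case (Suc m)
  have "low (Suc m, {#}, 0) \<subseteq> low (Suc m, \<alpha>, j)"
    by (intro low_mono) (auto simp: less_eq_prod_def less_le)
  thus ?thesis using Suc by (simp add: fil_eq_low)
qed

end

lemma has_growth_sum:
  assumes "finite I" "\<And>i. i \<in> I \<Longrightarrow> (\<forall>n. f i n = 0) \<or> (\<exists>e c. has_growth (f i) e c)"
  shows "(\<forall>n. (\<Sum>i\<in>I. f i n) = 0) \<or> (\<exists>e c. has_growth (\<lambda>n. \<Sum>i\<in>I. f i n) e c)"
  using assms
proof (induction I rule: finite_induct)
  case (insert i I)
  have sum: "(\<lambda>n. \<Sum>i\<in>insert i I. f i n) = (\<lambda>n. f i n + (\<Sum>i\<in>I. f i n))"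
    using insert.hyps by simp
  consider "\<forall>n. f i n = 0" | e c where "has_growth (f i) e c" using insert.prems[of i] by auto
  thus ?case
  proof cases
    case 1
    thus ?thesis using insert by simp
  next
    case 2
    have "(\<forall>n. (\<Sum>i\<in>I. f i n) = 0) \<or> (\<exists>e c. has_growth (\<lambda>n. \<Sum>i\<in>I. f i n) e c)"
      using insert by simp
    thus ?thesis
    proof
      assume "\<forall>n. (\<Sum>i\<in>I. f i n) = 0"
      hence "has_growth (\<lambda>n. f i n + (\<Sum>i\<in>I. f i n)) e c" using 2 by simp
      thus ?thesis unfolding sum by blast
    next
      assume "\<exists>e c. has_growth (\<lambda>n. \<Sum>i\<in>I. f i n) e c"
      then obtain e' c' where "has_growth (\<lambda>n. \<Sum>i\<in>I. f i n) e' c'" by blast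
      from has_growth_add[OF 2 this] show ?thesis unfolding sum by blast
    qed
  qed
qed simp

lemma (in vectorspace) span_insert_decompose:
  assumes "v \<in> carrier V" "S \<subseteq> carrier V" "m \<in> span (insert v S)"
  shows "\<exists>c\<in>carrier K. \<exists>y\<in>span S. m = c \<odot>\<^bsub>V\<^esub> v \<oplus>\<^bsub>V\<^esub> y"
proof -
  let ?W = "{c \<odot>\<^bsub>V\<^esub> v \<oplus>\<^bsub>V\<^esub> y | c y. c \<in> carrier K \<and> y \<in> span S}"
  note sub = subspaceD[OF span_is_subspace[OF assms(2)]]
  have "span (insert v S) \<subseteq> ?W"
  proof (rule span_least)
    show "subspace K ?W V"
    proof (rule subspaceI)
      show "?W \<subseteq> carrier V" using sub(1) assms(1) by auto
      show "\<zero>\<^bsub>V\<^esub> \<in> ?W" using sub(2) assms(1)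
        by (auto intro!: exI[of _ "\<zero>\<^bsub>K\<^esub>"] exI[of _ "\<zero>\<^bsub>V\<^esub>"])
      show "x \<oplus>\<^bsub>V\<^esub> y \<in> ?W" if xy: "x \<in> ?W" "y \<in> ?W" for x y
      proof -
        obtain a b y1 y2 where *: "x = a \<odot>\<^bsub>V\<^esub> v \<oplus>\<^bsub>V\<^esub> y1" "y = b \<odot>\<^bsub>V\<^esub> v \<oplus>\<^bsub>V\<^esub> y2"
          "a \<in> carrier K" "b \<in> carrier K" "y1 \<in> span S" "y2 \<in> span S" using xy by auto
        have c: "y1 \<in> carrier V" "y2 \<in> carrier V" using *(5,6) sub(1) by auto
        have "x \<oplus>\<^bsub>V\<^esub> y = (a \<oplus>\<^bsub>K\<^esub> b) \<odot>\<^bsub>V\<^esub> v \<oplus>\<^bsub>V\<^esub> (y1 \<oplus>\<^bsub>V\<^esub> y2)"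
          using * c assms(1) by (simp add: smult_l_distr M.a_ac)
        moreover have "a \<oplus>\<^bsub>K\<^esub> b \<in> carrier K" "y1 \<oplus>\<^bsub>V\<^esub> y2 \<in> span S" using * sub(3) by auto
        ultimately show ?thesis by blast
      qed
      show "e \<odot>\<^bsub>V\<^esub> x \<in> ?W" if e: "e \<in> carrier K" and x: "x \<in> ?W" for e x
      proof -
        obtain a y1 where *: "x = a \<odot>\<^bsub>V\<^esub> v \<oplus>\<^bsub>V\<^esub> y1" "a \<in> carrier K" "y1 \<in> span S" using x by auto
        have "y1 \<in> carrier V" using *(3) sub(1) by auto
        hence "e \<odot>\<^bsub>V\<^esub> x = (e \<otimes>\<^bsub>K\<^esub> a) \<odot>\<^bsub>V\<^esub> v \<oplus>\<^bsub>V\<^esub> e \<odot>\<^bsub>V\<^esub> y1"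
          using * e assms(1) by (simp add: smult_r_distr smult_assoc1)
        moreover have "e \<otimes>\<^bsub>K\<^esub> a \<in> carrier K" "e \<odot>\<^bsub>V\<^esub> y1 \<in> span S" using * e sub(4) by auto
        ultimately show ?thesis by blast
      qed
    qed
    have "v \<in> ?W" using sub(2) assms(1)
      by (auto intro!: exI[of _ "\<one>\<^bsub>K\<^esub>"] exI[of _ "\<zero>\<^bsub>V\<^esub>"])
    moreover have "s \<in> ?W" if "s \<in> S" for s
      using that assms(1,2) in_own_span[OF assms(2)]
      by (auto intro!: exI[of _ "\<zero>\<^bsub>K\<^esub>"] exI[of _ s])
    ultimately show "insert v S \<subseteq> ?W" by auto
  qed
  thus ?thesis using assms(3) by blast
qed

context monomial_module
begin

section \<open>Leading and standard monomials\<close>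

definition shift :: "nat multiset \<Rightarrow> key \<Rightarrow> key" where
  "shift \<gamma> = (\<lambda>(n, \<alpha>, j). (wt d \<gamma> + n, \<gamma> + \<alpha>, j))"

lemma shift_keys: "set_mset \<gamma> \<subseteq> {..<r} \<Longrightarrow> k \<in> keys \<Longrightarrow> shift \<gamma> k \<in> keys"
  by (auto simp: keys_def shift_def)

text \<open>Weights and the multiset order are both invariant under adding a fixed multiset. This is
  the property of a monomial order that lets leading terms multiply.\<close>

lemma shift_less: "k < k' \<Longrightarrow> shift \<gamma> k < shift \<gamma> k'"
  by (cases k; cases k') (auto simp: shift_def less_prod_def')

text \<open>Concatenating and sorting introduces an error of smaller weight, and smaller weight
  means smaller key; so reordering never disturbs the leading term.\<close>

lemma word_vec:
  assumes "w \<in> words" "k \<in> keys"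
  shows "\<exists>u\<in>low (shift (mset w) k). word w (vec k) = vec (shift (mset w) k) \<oplus>\<^bsub>M\<^esub> u"
proof -
  obtain n \<alpha> j where k: "k = (n, \<alpha>, j)" by (cases k)
  hence *: "n = wt d \<alpha>" "set_mset \<alpha> \<subseteq> {..<r}" "j < q" using assms(2) by (auto simp: keys_def)
  let ?v = "w @ sorted_list_of_multiset \<alpha>"
  have v: "?v \<in> words" "t j \<in> T" using assms(1) * by auto
  have "word w (vec k) = word ?v (t j)"
    using v t_closed[OF *(3)] by (simp add: k vec_def mon_def word_append)
  moreover have "mset ?v = mset w + \<alpha>" by simp
  ultimately have "cong_lower (wt d (mset w) + n) (word w (vec k)) (vec (shift (mset w) k))"
    using word_mon[OF v] * by (simp add: k shift_def vec_def)
  then obtain u where u: "u \<in> filp (wt d (mset w) + n)" "word w (vec k) = vec (shift (mset w) k) \<oplus>\<^bsub>M\<^esub> u"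
    by (auto simp: cong_lower_def)
  have "filp (wt d (mset w) + n) \<subseteq> low (shift (mset w) k)"
    using filp_low by (simp add: k shift_def)
  thus ?thesis using u by blast
qed

lemma word_low:
  assumes w: "w \<in> words" and y: "y \<in> low \<kappa>"
  shows "word w y \<in> low (shift (mset w) \<kappa>)"
proof -
  have "low \<kappa> \<subseteq> {y \<in> carrier M. xprod w \<odot>\<^bsub>M\<^esub> y \<in> low (shift (mset w) \<kappa>)}"
    unfolding low_def[of \<kappa>]
  proof (intro R.span_least preimage_act_right_subspace low_subspace xprod_closed w image_subsetI)
    fix k assume k: "k \<in> {k\<in>keys. k < \<kappa>}"
    then obtain u where u: "u \<in> low (shift (mset w) k)" "word w (vec k) = vec (shift (mset w) k) \<oplus>\<^bsub>M\<^esub> u"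
      using word_vec[OF w, of k] by auto
    have less: "shift (mset w) k < shift (mset w) \<kappa>" using k shift_less by simp
    have "shift (mset w) k \<in> keys" using k w by (intro shift_keys) auto
    hence "vec (shift (mset w) k) \<in> low (shift (mset w) \<kappa>)" using less by (rule vec_low)
    moreover have "u \<in> low (shift (mset w) \<kappa>)" by (rule subsetD[OF low_mono[OF less_imp_le[OF less]] u(1)])
    ultimately have "word w (vec k) \<in> low (shift (mset w) \<kappa>)"
      using R.subspaceD(3)[OF low_subspace] u(2) by simp
    thus "vec k \<in> {y \<in> carrier M. xprod w \<odot>\<^bsub>M\<^esub> y \<in> low (shift (mset w) \<kappa>)}"
      using k vec_closed by (simp add: word_def)
  qed
  thus ?thesis using y by (auto simp: word_def)
qed

text \<open>The leading monomials of \<open>N\<close>, including those that are already reducible in \<open>M\<close>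
  itself; for \<open>N = 0\<close> the complement is the set of standard monomials of \<open>M\<close>.\<close>

definition lead :: "'m set \<Rightarrow> key set" where
  "lead N = {k\<in>keys. \<exists>g\<in>N. \<exists>z\<in>low k. g = vec k \<oplus>\<^bsub>M\<^esub> z}"

text \<open>\<open>word_vec\<close> takes care of the leading vector and \<open>word_low\<close> of
  the tail, so leading terms behave as over a commutative polynomial ring.\<close>

lemma lead_shift_word:
  assumes N: "Module.submodule N A M" and w: "w \<in> words" and k: "k \<in> keys"
    and g: "g \<in> N" "z \<in> low k" "g = vec k \<oplus>\<^bsub>M\<^esub> z"
  shows "word w g \<in> N" "\<exists>z'\<in>low (shift (mset w) k). word w g = vec (shift (mset w) k) \<oplus>\<^bsub>M\<^esub> z'"
proof -
  interpret N: Module.submodule N A M by fact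
  show "word w g \<in> N" unfolding word_def by (intro N.smult_closed xprod_closed w g)
  obtain u where u: "u \<in> low (shift (mset w) k)" "word w (vec k) = vec (shift (mset w) k) \<oplus>\<^bsub>M\<^esub> u"
    using word_vec[OF w k] by auto
  have wz: "word w z \<in> low (shift (mset w) k)" by (rule word_low[OF w g(2)])
  have "shift (mset w) k \<in> keys" using k w by (intro shift_keys) auto
  hence "vec (shift (mset w) k) \<in> carrier M" by (rule vec_closed)
  moreover have "word w g = word w (vec k) \<oplus>\<^bsub>M\<^esub> word w z"
    unfolding word_def g(3) using xprod_closed[OF w] vec_closed[OF k] low_closed[OF g(2)]
    by (intro M.smult_r_distr)
  ultimately have "word w g = vec (shift (mset w) k) \<oplus>\<^bsub>M\<^esub> (u \<oplus>\<^bsub>M\<^esub> word w z)"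
    using u low_closed[OF u(1)] low_closed[OF wz] by (simp add: M.M.a_assoc)
  moreover have "u \<oplus>\<^bsub>M\<^esub> word w z \<in> low (shift (mset w) k)"
    using R.subspaceD(3)[OF low_subspace u(1) wz] by simp
  ultimately show "\<exists>z'\<in>low (shift (mset w) k). word w g = vec (shift (mset w) k) \<oplus>\<^bsub>M\<^esub> z'" by blast
qed

lemma lead_shift:
  assumes N: "Module.submodule N A M" and "set_mset \<gamma> \<subseteq> {..<r}" and k: "k \<in> lead N"
  shows "shift \<gamma> k \<in> lead N"
proof -
  let ?w = "sorted_list_of_multiset \<gamma>"
  have w: "?w \<in> words" using assms by simp
  obtain g z where g: "k \<in> keys" "g \<in> N" "z \<in> low k" "g = vec k \<oplus>\<^bsub>M\<^esub> z"
    using k by (auto simp: lead_def)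
  obtain z' where "z' \<in> low (shift (mset ?w) k)" "word ?w g = vec (shift (mset ?w) k) \<oplus>\<^bsub>M\<^esub> z'"
    using lead_shift_word(2)[OF N w g] by (elim bexE)
  moreover have "word ?w g \<in> N" by (rule lead_shift_word(1)[OF N w g])
  moreover have "shift (mset ?w) k \<in> keys" using shift_keys[OF assms(2) g(1)] by simp
  ultimately have "shift (mset ?w) k \<in> lead N" unfolding lead_def by blast
  thus ?thesis by simp
qed

lemma zero_submodule: "Module.submodule {\<zero>\<^bsub>M\<^esub>} A M"
proof (intro Module.submodule.intro submodule_axioms.intro)
  show "subgroup {\<zero>\<^bsub>M\<^esub>} (add_monoid M)"
    by (rule M.M.add.subgroupI) (auto simp: a_inv_def[symmetric])
qed (simp add: act_zero_right)

lemma lead_zero: "k \<in> keys \<Longrightarrow> k \<in> lead {\<zero>\<^bsub>M\<^esub>} \<longleftrightarrow> vec k \<in> low k"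
proof
  assume k: "k \<in> keys" "k \<in> lead {\<zero>\<^bsub>M\<^esub>}"
  then obtain z where z: "z \<in> low k" "\<zero>\<^bsub>M\<^esub> = vec k \<oplus>\<^bsub>M\<^esub> z" by (auto simp: lead_def)
  hence "vec k = \<ominus>\<^bsub>M\<^esub> z"
    using M.M.minus_equality[of "vec k" z] vec_closed[OF k(1)] low_closed[OF z(1)] by simp
  thus "vec k \<in> low k" using R.subspace_minus(1)[OF low_subspace z(1) z(1)] by simp
next
  assume k: "k \<in> keys" "vec k \<in> low k"
  have "\<ominus>\<^bsub>M\<^esub> vec k \<in> low k" using R.subspace_minus(1)[OF low_subspace k(2) k(2)] by simp
  moreover have "\<zero>\<^bsub>M\<^esub> = vec k \<oplus>\<^bsub>M\<^esub> \<ominus>\<^bsub>M\<^esub> vec k" using vec_closed[OF k(1)] by (simp add: M.M.r_neg)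
  ultimately show "k \<in> lead {\<zero>\<^bsub>M\<^esub>}" using k(1) by (auto simp: lead_def)
qed

text \<open>Macaulay's basis theorem: the monomials not expressible by smaller ones are counted by
  the dimension, and by \<open>lead_zero\<close> they are the non-leading monomials of the zero
  submodule.\<close>

lemma hilb_eq_card: "hilb T n = card {k\<in>keys. fst k \<le> n \<and> k \<notin> lead {\<zero>\<^bsub>M\<^esub>}}"
proof -
  let ?top = "(Suc n, {#}, 0) :: key"
  let ?J = "{k\<in>keys. k < ?top}"
  have "hilb T n = sdim K R (R.span (vec ` ?J))" by (simp add: hilb_def fil_eq_low low_def)
  also have "\<dots> = card {i\<in>?J. vec i \<notin> R.span (vec ` {k\<in>?J. k < i})}"
    by (rule R.sdim_span_standard) (use finite_keys_less vec_closed in auto)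
  also have "{i\<in>?J. vec i \<notin> R.span (vec ` {k\<in>?J. k < i})} = {k\<in>keys. fst k \<le> n \<and> k \<notin> lead {\<zero>\<^bsub>M\<^esub>}}"
  proof (rule Collect_cong)
    fix i
    show "i \<in> ?J \<and> vec i \<notin> R.span (vec ` {k\<in>?J. k < i}) \<longleftrightarrow>
        i \<in> keys \<and> fst i \<le> n \<and> i \<notin> lead {\<zero>\<^bsub>M\<^esub>}"
    proof (cases "i \<in> ?J")
      case True
      hence "{k\<in>?J. k < i} = {k\<in>keys. k < i}" using less_trans[of _ i ?top] by blast
      hence "R.span (vec ` {k\<in>?J. k < i}) = low i" by (simp only: low_def)
      thus ?thesis using True lead_zero[of i] unfolding key_less_top by auto
    next
      case False
      thus ?thesis by (auto simp: key_less_top)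
    qed
  qed
  finally show ?thesis .
qed

text \<open>Leading monomials are closed under multiples by \<open>lead_shift\<close>, so standard
  ones are closed under divisors. This holds for each generator index j separately;
  \<open>C j\<close> collects the standard monomials attached to \<open>t j\<close>, and the Hilbert
  function is the sum of their counting functions.\<close>

lemma hilb_growth: "(\<forall>n. hilb T n = 0) \<or> (\<exists>e c. has_growth (hilb T) e c)"
proof -
  let ?L = "lead {\<zero>\<^bsub>M\<^esub>}"
  define C where "C j = {\<alpha>. set_mset \<alpha> \<subseteq> {..<r} \<and> (wt d \<alpha>, \<alpha>, j) \<notin> ?L}" for j
  have fin: "finite {\<alpha>\<in>C j. wt d \<alpha> \<le> n}" for j n
    by (rule finite_subset[OF _ finite_wt_le[of "{..<r}" d n]]) (use d_pos in \<open>auto simp: C_def\<close>)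
  have hilb: "hilb T n = (\<Sum>j<q. card {\<alpha>\<in>C j. wt d \<alpha> \<le> n})" for n
  proof -
    have "{k\<in>keys. fst k \<le> n \<and> k \<notin> ?L} =
        (\<lambda>(j, \<alpha>). (wt d \<alpha>, \<alpha>, j)) ` (SIGMA j:{..<q}. {\<alpha>\<in>C j. wt d \<alpha> \<le> n})"
      by (auto simp: keys_def C_def image_iff)
    hence "hilb T n = card (SIGMA j:{..<q}. {\<alpha>\<in>C j. wt d \<alpha> \<le> n})"
      unfolding hilb_eq_card by (simp add: card_image inj_on_def)
    thus ?thesis using fin by simp
  qed
  have "(\<forall>n. card {\<alpha>\<in>C j. wt d \<alpha> \<le> n} = 0) \<or> (\<exists>e c. has_growth (\<lambda>n. card {\<alpha>\<in>C j. wt d \<alpha> \<le> n}) e c)" for j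
  proof (cases "C j = {}")
    case True
    thus ?thesis by simp
  next
    case False
    have "\<exists>e c. has_growth (\<lambda>n. card {\<alpha>\<in>C j. wt d \<alpha> \<le> n}) e c"
    proof (rule has_growth_down_closed[where V = "{..<r}"])
      show "\<beta> \<in> C j" if \<alpha>: "\<alpha> \<in> C j" "\<beta> \<subseteq># \<alpha>" for \<alpha> \<beta>
      proof -
        have sub: "set_mset \<beta> \<subseteq> {..<r}" "set_mset (\<alpha> - \<beta>) \<subseteq> {..<r}"
          using \<alpha>(1) set_mset_mono[OF \<alpha>(2)] set_mset_mono[OF diff_subset_eq_self, of \<alpha> \<beta>]
          unfolding C_def by (metis (no_types, lifting) mem_Collect_eq subset_trans)+
        have "(wt d \<beta>, \<beta>, j) \<notin> ?L"
        proof
          assume "(wt d \<beta>, \<beta>, j) \<in> ?L"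
          hence "shift (\<alpha> - \<beta>) (wt d \<beta>, \<beta>, j) \<in> ?L" by (rule lead_shift[OF zero_submodule sub(2)])
          moreover have "\<alpha> - \<beta> + \<beta> = \<alpha>" using \<alpha>(2) by simp
          hence "shift (\<alpha> - \<beta>) (wt d \<beta>, \<beta>, j) = (wt d \<alpha>, \<alpha>, j)"
            using wt_union[of d "\<alpha> - \<beta>" \<beta>] by (simp add: shift_def)
          ultimately show False using \<alpha>(1) by (simp add: C_def)
        qed
        thus ?thesis using sub by (simp add: C_def)
      qed
    qed (use d_pos False in \<open>auto simp: C_def\<close>)
    thus ?thesis by blast
  qed
  hence "(\<forall>n. (\<Sum>j<q. card {\<alpha>\<in>C j. wt d \<alpha> \<le> n}) = 0) \<or>
      (\<exists>e c. has_growth (\<lambda>n. \<Sum>j<q. card {\<alpha>\<in>C j. wt d \<alpha> \<le> n}) e c)"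
    by (intro has_growth_sum) auto
  thus ?thesis unfolding hilb[symmetric] .
qed

text \<open>Division by a Groebner basis replaces the Artin--Rees lemma.\<close>

lemma submodule_fil_bound:
  assumes N: "Module.submodule N A M"
  shows "\<exists>G. finite G \<and> G \<subseteq> N \<and> (\<forall>n. N \<inter> fil T n \<subseteq> fil G n)"
proof -
  interpret N: Module.submodule N A M by fact
  have N_sub: "subspace K N R" by (rule submodule_subspace[OF N])
  \<comment> \<open>For each generator index, Dickson's lemma yields finitely many leading monomials
    that divide all others. Elements of N with these leading terms make up the Groebner basis
    G.\<close>
  have "\<forall>j. \<exists>B. finite B \<and> B \<subseteq> {\<alpha>. (wt d \<alpha>, \<alpha>, j) \<in> lead N} \<and>
      (\<forall>\<alpha>\<in>{\<alpha>. (wt d \<alpha>, \<alpha>, j) \<in> lead N}. \<exists>\<beta>\<in>B. \<beta> \<subseteq># \<alpha>)"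
    by (intro allI dickson[of "{..<r}"]) (auto simp: lead_def keys_def)
  then obtain B where B: "\<And>j. finite (B j)" "\<And>j \<beta>. \<beta> \<in> B j \<Longrightarrow> (wt d \<beta>, \<beta>, j) \<in> lead N"
    "\<And>j \<alpha>. (wt d \<alpha>, \<alpha>, j) \<in> lead N \<Longrightarrow> \<exists>\<beta>\<in>B j. \<beta> \<subseteq># \<alpha>"
    unfolding choice_iff by (elim exE) (blast dest: spec)
  have "\<forall>k\<in>lead N. \<exists>g z. g \<in> N \<and> z \<in> low k \<and> g = vec k \<oplus>\<^bsub>M\<^esub> z" by (auto simp: lead_def)
  then obtain g z where g: "\<And>k. k \<in> lead N \<Longrightarrow> g k \<in> N \<and> z k \<in> low k \<and> g k = vec k \<oplus>\<^bsub>M\<^esub> z k"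
    by metis
  have gN: "g k \<in> N" if "k \<in> lead N" for k using g[OF that] by blast
  define G where "G = (\<lambda>(j, \<beta>). g (wt d \<beta>, \<beta>, j)) ` (SIGMA j:{..<q}. B j)"
  have G: "finite G" "G \<subseteq> N" using B(1) gN[OF B(2)] by (auto simp: G_def)
  have G_closed: "G \<subseteq> carrier M" using G(2) R.subspaceD(1)[OF N_sub] by simp
  \<comment> \<open>The induction lowers the bound \<kappa> on the keys while n stays fixed: every
    reduction subtracts an element of \<open>fil G n\<close> for one and the same n.\<close>
  have "N \<inter> low \<kappa> \<subseteq> fil G n" if "\<kappa> \<le> (Suc n, {#}, 0)" for \<kappa> n
    using that
  proof (induction \<kappa> rule: less_induct)
    case (less \<kappa>)
    show ?case
    proof
      fix m assume m: "m \<in> N \<inter> low \<kappa>"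
      show "m \<in> fil G n"
      proof (cases "{k\<in>keys. k < \<kappa>} = {}")
        case True
        hence "low \<kappa> = {\<zero>\<^bsub>M\<^esub>}" unfolding low_def True using R.span_empty by simp
        hence "m = \<zero>\<^bsub>M\<^esub>" using m by simp
        thus ?thesis using R.subspaceD(2)[OF fil_subspace[OF G_closed]] by simp
      next
        case False
        \<comment> \<open>Finitely many keys lie below \<kappa>, so a largest one exists, and
          \<open>low \<kappa>\<close> is spanned by \<open>low k\<close> together with the single
          vector \<open>vec k\<close>.\<close>
        define k where "k = Max {k\<in>keys. k < \<kappa>}"
        have "k \<in> {k\<in>keys. k < \<kappa>}" unfolding k_def by (rule Max_in[OF finite_keys_less False])
        hence k: "k \<in> keys" "k < \<kappa>" by auto
        have kmax: "k' \<le> k" if "k' \<in> keys" "k' < \<kappa>" for k'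
          unfolding k_def by (rule Max_ge[OF finite_keys_less]) (use that in auto)
        have k_top: "k < (Suc n, {#}, 0)" using k(2) less.prems by simp
        have IH: "N \<inter> low k \<subseteq> fil G n" using less.IH[OF k(2)] k_top by simp
        have "{k'\<in>keys. k' < \<kappa>} = insert k {k'\<in>keys. k' < k}"
          using k kmax by (auto dest: less_trans simp: less_le)
        hence "low \<kappa> = R.span (insert (vec k) (vec ` {k'\<in>keys. k' < k}))" by (simp add: low_def)
        hence "m \<in> R.span (insert (vec k) (vec ` {k'\<in>keys. k' < k}))" using m by simp
        hence "\<exists>c\<in>carrier K. \<exists>y\<in>low k. m = c \<odot>\<^bsub>R\<^esub> vec k \<oplus>\<^bsub>R\<^esub> y"
          unfolding low_def using vec_closed[OF k(1)] vec_image_closed[of "\<lambda>k'. k' < k"]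
          by (intro R.span_insert_decompose) simp_all
        then obtain c y where "c \<in> carrier K" "y \<in> low k" "m = c \<odot>\<^bsub>R\<^esub> vec k \<oplus>\<^bsub>R\<^esub> y"
          by (elim bexE)
        hence c: "c \<in> carrier K" "y \<in> low k" "m = c \<odot>\<^bsub>R\<^esub> vec k \<oplus>\<^bsub>M\<^esub> y" by simp_all
        show ?thesis
        proof (cases "c = \<zero>\<^bsub>K\<^esub>")
          case True
          hence "m = y"
            using c low_closed[OF c(2)] vec_closed[OF k(1)] R.smult_l_null[of "vec k"] by simp
          thus ?thesis using IH m c(2) by auto
        next
          \<comment> \<open>In this case k is a leading key of N: \<open>lead\<close> expects the
            coefficient 1, which division of m by c provides.\<close>
          case c0: False
          have c_inv: "inv\<^bsub>K\<^esub> c \<in> carrier K" "inv\<^bsub>K\<^esub> c \<otimes>\<^bsub>K\<^esub> c = \<one>\<^bsub>K\<^esub>"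
            using V.field_Units c(1) c0 V.R.Units_inv_closed V.R.Units_l_inv by auto
          have "inv\<^bsub>K\<^esub> c \<odot>\<^bsub>R\<^esub> m = inv\<^bsub>K\<^esub> c \<odot>\<^bsub>R\<^esub> (c \<odot>\<^bsub>R\<^esub> vec k) \<oplus>\<^bsub>R\<^esub> inv\<^bsub>K\<^esub> c \<odot>\<^bsub>R\<^esub> y"
            unfolding c(3) using R.smult_r_distr[of "inv\<^bsub>K\<^esub> c" "c \<odot>\<^bsub>R\<^esub> vec k" y]
              R.smult_closed[of c "vec k"] c c_inv vec_closed[OF k(1)] low_closed[OF c(2)] by simp
          also have "inv\<^bsub>K\<^esub> c \<odot>\<^bsub>R\<^esub> (c \<odot>\<^bsub>R\<^esub> vec k) = vec k"
            using R.smult_assoc1[of "inv\<^bsub>K\<^esub> c" c "vec k"] R.smult_one[of "vec k"]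
              c c_inv vec_closed[OF k(1)] by simp
          finally have "inv\<^bsub>K\<^esub> c \<odot>\<^bsub>R\<^esub> m = vec k \<oplus>\<^bsub>M\<^esub> inv\<^bsub>K\<^esub> c \<odot>\<^bsub>R\<^esub> y" by simp
          moreover have "inv\<^bsub>K\<^esub> c \<odot>\<^bsub>R\<^esub> m \<in> N" using R.subspaceD(4)[OF N_sub c_inv(1)] m by simp
          moreover have "inv\<^bsub>K\<^esub> c \<odot>\<^bsub>R\<^esub> y \<in> low k" using R.subspaceD(4)[OF low_subspace c_inv(1) c(2)] .
          ultimately have "k \<in> lead N" using k(1) unfolding lead_def by blast
          obtain \<alpha> j where \<alpha>: "k = (wt d \<alpha>, \<alpha>, j)" "set_mset \<alpha> \<subseteq> {..<r}" "j < q"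
            using k(1) by (auto simp: keys_def)
          obtain \<beta> where \<beta>: "\<beta> \<in> B j" "\<beta> \<subseteq># \<alpha>" using B(3)[of \<alpha> j] \<open>k \<in> lead N\<close> \<alpha>(1) by auto
          \<comment> \<open>The basis element belonging to \<beta>, multiplied by the monomial
            \<alpha> - \<beta>, has leading key k; c times it cancels the leading term of m.\<close>
          let ?b = "(wt d \<beta>, \<beta>, j)"
          let ?w = "sorted_list_of_multiset (\<alpha> - \<beta>)"
          have w: "?w \<in> words" using \<alpha>(2) by (auto dest: in_diffD)
          have \<alpha>\<beta>: "\<alpha> - \<beta> + \<beta> = \<alpha>" using \<beta>(2) by simp
          have wt: "wt d \<alpha> = wt d (\<alpha> - \<beta>) + wt d \<beta>" using wt_union[of d "\<alpha> - \<beta>" \<beta>] \<alpha>\<beta> by simp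
          have shift: "shift (mset ?w) ?b = k" using wt \<alpha>\<beta> \<alpha>(1) by (simp add: shift_def)
          have b: "?b \<in> lead N" by (rule B(2)[OF \<beta>(1)])
          hence b': "?b \<in> keys" by (simp add: lead_def)
          have gb: "g ?b \<in> N" "z ?b \<in> low ?b" "g ?b = vec ?b \<oplus>\<^bsub>M\<^esub> z ?b" using g[OF b] by auto
          obtain z' where z': "z' \<in> low k" "word ?w (g ?b) = vec k \<oplus>\<^bsub>M\<^esub> z'"
            using lead_shift_word(2)[OF N w b' gb] unfolding shift by (elim bexE)
          have wg_N: "word ?w (g ?b) \<in> N" by (rule lead_shift_word(1)[OF N w b' gb])
          have "g ?b \<in> G" unfolding G_def using \<alpha>(3) \<beta>(1) by (intro image_eqI[of _ _ "(j, \<beta>)"]) auto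
          hence "word ?w (g ?b) \<in> fil G (wt d (mset ?w))"
            unfolding word_def by (intro act_mem F_carrier G_closed xprod_F w)
          \<comment> \<open>The cofactor weighs no more than k does, and k has weight at most n
            because the order compares weights first. For this reason the bound involves no
            shift.\<close>
          moreover have "wt d (mset ?w) \<le> n"
            using k_top wt unfolding key_less_top \<alpha>(1) by simp
          ultimately have wg: "word ?w (g ?b) \<in> fil G n" using fil_mono[of "wt d (mset ?w)" n G] by auto
          let ?h = "c \<odot>\<^bsub>R\<^esub> word ?w (g ?b)"
          have h: "?h \<in> N" "?h \<in> fil G n"
            using R.subspaceD(4)[OF N_sub c(1) wg_N] R.subspaceD(4)[OF fil_subspace[OF G_closed] c(1) wg] by auto
          have h_eq: "?h = c \<odot>\<^bsub>R\<^esub> vec k \<oplus>\<^bsub>M\<^esub> c \<odot>\<^bsub>R\<^esub> z'"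
            using R.smult_r_distr[of c "vec k" z'] c vec_closed[OF k(1)] low_closed[OF z'(1)] z'(2) by simp
          have cz: "c \<odot>\<^bsub>R\<^esub> z' \<in> low k" by (rule R.subspaceD(4)[OF low_subspace c(1) z'(1)])
          have cv: "c \<odot>\<^bsub>R\<^esub> vec k \<in> carrier M" using R.smult_closed[of c "vec k"] c vec_closed[OF k(1)] by simp
          have h_closed: "?h \<in> carrier M" using h(1) R.subspaceD(1)[OF N_sub] by auto
          have m_closed: "m \<in> carrier M" using m R.subspaceD(1)[OF N_sub] by auto
          have "m \<ominus>\<^bsub>M\<^esub> ?h = y \<ominus>\<^bsub>M\<^esub> c \<odot>\<^bsub>R\<^esub> z'"
          proof -
            have "m \<ominus>\<^bsub>M\<^esub> ?h = (y \<oplus>\<^bsub>M\<^esub> c \<odot>\<^bsub>R\<^esub> vec k) \<oplus>\<^bsub>M\<^esub> (\<ominus>\<^bsub>M\<^esub> (c \<odot>\<^bsub>R\<^esub> vec k) \<oplus>\<^bsub>M\<^esub> \<ominus>\<^bsub>M\<^esub> (c \<odot>\<^bsub>R\<^esub> z'))"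
              unfolding h_eq c(3) a_minus_def using cv low_closed[OF c(2)] low_closed[OF cz]
              by (simp only: M.M.minus_add M.M.a_comm[of "c \<odot>\<^bsub>R\<^esub> vec k" y])
            also have "\<dots> = y \<oplus>\<^bsub>M\<^esub> (c \<odot>\<^bsub>R\<^esub> vec k \<oplus>\<^bsub>M\<^esub> \<ominus>\<^bsub>M\<^esub> (c \<odot>\<^bsub>R\<^esub> vec k)) \<oplus>\<^bsub>M\<^esub> \<ominus>\<^bsub>M\<^esub> (c \<odot>\<^bsub>R\<^esub> z')"
              using cv low_closed[OF c(2)] low_closed[OF cz]
              by (simp only: M.M.a_assoc M.M.a_inv_closed M.M.a_closed)
            also have "\<dots> = y \<ominus>\<^bsub>M\<^esub> c \<odot>\<^bsub>R\<^esub> z'"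
              unfolding a_minus_def M.M.r_neg[OF cv] using low_closed[OF c(2)] by (simp only: M.M.r_zero)
            finally show ?thesis .
          qed
          also have "\<dots> \<in> low k" using R.subspace_minus(2)[OF low_subspace c(2) cz] by (simp add: a_minus_def)
          finally have "m \<ominus>\<^bsub>M\<^esub> ?h \<in> low k" .
          moreover have "m \<ominus>\<^bsub>M\<^esub> ?h \<in> N"
            using R.subspace_minus(2)[OF N_sub _ h(1), of m] m by (simp add: a_minus_def)
          ultimately have "m \<ominus>\<^bsub>M\<^esub> ?h \<in> fil G n" using IH by blast
          from R.subspaceD(3)[OF fil_subspace[OF G_closed] this h(2)]
          have "(m \<ominus>\<^bsub>M\<^esub> ?h) \<oplus>\<^bsub>M\<^esub> ?h \<in> fil G n" by simp
          moreover have "(m \<ominus>\<^bsub>M\<^esub> ?h) \<oplus>\<^bsub>M\<^esub> ?h = m"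
            unfolding a_minus_def using m_closed h_closed
            by (simp only: M.M.a_assoc M.M.a_inv_closed M.M.l_neg M.M.r_zero)
          ultimately show ?thesis by simp
        qed
      qed
    qed
  qed
  hence "N \<inter> fil T n \<subseteq> fil G n" for n unfolding fil_eq_low by simp
  thus ?thesis using G by blast
qed

end

section \<open>Gelfand-Kirillov dimension\<close>

lemma (in vectorspace) sdim_mono_subspace:
  assumes "finite S" "S \<subseteq> carrier V" "subspace K U V" "subspace K W V" "U \<subseteq> W" "W \<subseteq> span S"
  shows "sdim K V U \<le> sdim K V W"
proof -
  obtain B where "finite B" "B \<subseteq> carrier V" "W = span B"
    using subspace_of_span_finite[OF assms(1,2,4,6)] by metis
  thus ?thesis using sdim_mono[of B U] assms(3,5) by simp
qed

locale almost_commutative_algebra = filtered_algebra K A F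
  for K :: "('k, 'x) ring_scheme" and A :: "('k, 'a) module" (structure) and F :: "nat \<Rightarrow> 'a set" +
  fixes D :: nat
  assumes comm: "\<And>a b i j. a \<in> F i \<Longrightarrow> b \<in> F j \<Longrightarrow> a \<otimes> b \<ominus> b \<otimes> a \<in> Fpred (i + j)"
    and generated_upto: "\<And>a n. a \<in> F n \<Longrightarrow> generated_upto D n a"
begin

text \<open>Finite spanning sets of \<open>F 1\<close>, ..., \<open>F D\<close> are listed with
  their degrees attached. As the filtration increases, an element may occur in several degrees, and
  it then counts as several variables.\<close>

lemma homogeneous_generators:
  "\<exists>(r :: nat) x d. (\<forall>i<r. 1 \<le> d i \<and> x i \<in> F (d i)) \<and>
    (\<forall>e. 1 \<le> e \<longrightarrow> e \<le> D \<longrightarrow> F e \<subseteq> V.span (x ` {i. i < r \<and> d i = e}))"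
proof -
  obtain W where W: "\<And>e. finite (W e)" "\<And>e. W e \<subseteq> carrier A" "\<And>e. F e = V.span (W e)"
    using F_finite_span by metis
  have "finite (SIGMA e:{1..D}. W e)" using W(1) by simp
  then obtain xs where xs: "set xs = (SIGMA e:{1..D}. W e)" using finite_list by blast
  have 1: "1 \<le> fst (xs ! i) \<and> snd (xs ! i) \<in> F (fst (xs ! i))" if "i < length xs" for i
  proof -
    have "xs ! i \<in> (SIGMA e:{1..D}. W e)" using xs that nth_mem by blast
    moreover have "w \<in> F e" if "w \<in> W e" for w e
      using subsetD[OF V.in_own_span[OF W(2), of e] that] W(3) by simp
    ultimately show ?thesis by auto
  qed
  have 2: "F e \<subseteq> V.span ((\<lambda>i. snd (xs ! i)) ` {i. i < length xs \<and> fst (xs ! i) = e})"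
    if "1 \<le> e" "e \<le> D" for e
  proof -
    have "w \<in> (\<lambda>i. snd (xs ! i)) ` {i. i < length xs \<and> fst (xs ! i) = e}" if "w \<in> W e" for w
    proof -
      have "(e, w) \<in> set xs" using xs that \<open>1 \<le> e\<close> \<open>e \<le> D\<close> by simp
      then obtain i where "i < length xs" "xs ! i = (e, w)" by (auto simp: in_set_conv_nth)
      thus ?thesis by (intro image_eqI[of _ _ i]) auto
    qed
    thus ?thesis unfolding W(3) by (intro V.span_is_monotone) auto
  qed
  show ?thesis
    by (intro exI[of _ "length xs"] exI[of _ "\<lambda>i. snd (xs ! i)"] exI[of _ "\<lambda>i. fst (xs ! i)"])
      (use 1 2 in auto)
qed

end

locale almost_commutative_module = almost_commutative_algebra K A F D + filtered_module K A F M
  for K :: "('k, 'x) ring_scheme" and A :: "('k, 'a) module" (structure)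
    and F :: "nat \<Rightarrow> 'a set" and D :: nat and M :: "('a, 'm) module"
begin

text \<open>S is replaced by the products P of a finite spanning set of \<open>F 0\<close> with S.
  The span of P is \<open>fil S 0\<close>, which is stable under \<open>F 0\<close>, and the
  filtration is the same: \<open>F n\<close> times \<open>F 0\<close> stays in \<open>F n\<close>,
  and S itself lies in the span of P.\<close>

lemma monomial_structure:
  assumes "finite S" "S \<subseteq> carrier M"
  shows "\<exists>r x d q t. monomial_module K A F M D r x d q t \<and>
    (\<forall>n. fil (t ` {..<q}) n = fil S n)"
proof -
  from homogeneous_generators obtain r :: nat and x d where x: "\<forall>i<r. 1 \<le> d i \<and> x i \<in> F (d i)"
    "\<forall>e. 1 \<le> e \<longrightarrow> e \<le> D \<longrightarrow> F e \<subseteq> V.span (x ` {i. i < r \<and> d i = e})"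
    by (elim exE conjE)
  obtain W where W: "finite W" "W \<subseteq> carrier A" "F 0 = V.span W" using F_finite_span by metis
  define P where "P = {w \<odot>\<^bsub>M\<^esub> s | w s. w \<in> W \<and> s \<in> S}"
  have P: "finite P" "P \<subseteq> carrier M"
    using finite_image_set2[of "\<lambda>w. w \<in> W" "\<lambda>s. s \<in> S"] assms W act_gens_closed[OF W(2) assms(2)]
    by (auto simp: P_def)
  obtain ts where ts: "set ts = P" using finite_list[OF P(1)] by blast
  let ?T = "(!) ts ` {..<length ts}"
  have T: "?T = P" using ts by (auto simp: set_conv_nth)
  have span_P: "R.span P = fil S 0"
    using act_span_left[OF W(2) assms(2)] W(3) by (simp add: act_space_def P_def)
  have P_fil: "P \<subseteq> fil S 0" using R.in_own_span[of P] P(2) span_P by simp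
  have "monomial_module K A F M D r x d (length ts) ((!) ts)"
  proof unfold_locales
    show "ts ! j \<in> carrier M" if "j < length ts" for j using ts P(2) nth_mem[OF that] by auto
    show "a \<odot>\<^bsub>M\<^esub> ts ! j \<in> R.span ?T" if "a \<in> F 0" "j < length ts" for a j
    proof -
      have "ts ! j \<in> fil S 0" using ts P_fil nth_mem[OF that(2)] by auto
      from fil_act[OF assms(2) that(1) this] show ?thesis unfolding T span_P by simp
    qed
  qed (use x comm generated_upto in auto)
  moreover have "fil ?T n = fil S n" for n
  proof
    show "fil ?T n \<subseteq> fil S n" using fil_subset_shift[OF assms(2) P_fil, of n] T by simp
    have "fil S n \<subseteq> act (F n) (R.span P)"
      unfolding span_P by (intro act_mono fil_base assms) auto
    thus "fil S n \<subseteq> fil ?T n" using act_span_right[OF F_carrier P(2)] T by simp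
  qed
  ultimately show ?thesis by blast
qed

lemma hilb_zero_or_growth:
  assumes "finite S" "S \<subseteq> carrier M"
  shows "(\<forall>n. hilb S n = 0) \<or> (\<exists>e c. has_growth (hilb S) e c)"
proof -
  obtain r x d q t where "monomial_module K A F M D r x d q t"
    and fil: "\<And>n. fil (t ` {..<q}) n = fil S n"
    using monomial_structure[OF assms] by metis
  then interpret C: monomial_module K A F M D r x d q t by simp
  have "hilb S = hilb (t ` {..<q})" by (intro ext) (simp add: hilb_def fil)
  thus ?thesis using C.hilb_growth by simp
qed

lemma artin_rees:
  assumes "finite S" "S \<subseteq> carrier M" "Module.submodule N A M"
  shows "\<exists>G. finite G \<and> G \<subseteq> N \<and> (\<forall>n. N \<inter> fil S n \<subseteq> fil G n)"
proof -
  obtain r x d q t where "monomial_module K A F M D r x d q t"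
    and fil: "\<And>n. fil (t ` {..<q}) n = fil S n"
    using monomial_structure[OF assms(1,2)] by metis
  then interpret C: monomial_module K A F M D r x d q t by simp
  show ?thesis using C.submodule_fil_bound[OF assms(3)] unfolding fil .
qed

lemma hilb_shift:
  assumes "mod_generates A M S" "finite S" "finite S'" "S' \<subseteq> carrier M"
  shows "\<exists>s. \<forall>n. hilb S' n \<le> hilb S (n + s)"
proof -
  have S: "S \<subseteq> carrier M" using assms(1) by (simp add: mod_generates_def)
  obtain s where s: "S' \<subseteq> fil S s" using fil_absorbs_finite[OF assms(1,3,4)] by blast
  have "hilb S' n \<le> hilb S (n + s)" for n
    unfolding hilb_def[of S'] using fil_subset_shift[OF S s] assms S
    by (intro sdim_mono_fil fil_subspace)
  thus ?thesis by blast
qed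

lemma hilb_mono:
  assumes "finite S" "S \<subseteq> carrier M" "m \<le> n"
  shows "hilb S m \<le> hilb S n"
  unfolding hilb_def[of S m] using assms by (intro sdim_mono_fil fil_subspace fil_mono)

lemma has_growth_hilb_independent:
  assumes S: "mod_generates A M S" "finite S" and S': "mod_generates A M S'" "finite S'"
    and g: "has_growth (hilb S) e c"
  shows "has_growth (hilb S') e c"
proof -
  have c: "S \<subseteq> carrier M" "S' \<subseteq> carrier M" using S S' by (auto simp: mod_generates_def)
  obtain s where s: "\<And>n. hilb S' n \<le> hilb S (n + s)" using hilb_shift[OF S S'(2) c(2)] by blast
  obtain s' where s': "\<And>n. hilb S n \<le> hilb S' (n + s')" using hilb_shift[OF S' S(2) c(1)] by blast
  show ?thesis
  proof (rule has_growth_sandwich[OF g, of _ "s + s'"])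
    fix n
    show "hilb S' n \<le> hilb S (n + (s + s'))"
      using s[of n] hilb_mono[OF S(2) c(1), of "n + s" "n + (s + s')"] by simp
    show "hilb S n \<le> hilb S' (n + (s + s'))"
      using s'[of n] hilb_mono[OF S'(2) c(2), of "n + s'" "n + (s + s')"] by simp
  qed
qed

lemma carrier_zero_iff_hilb:
  assumes "mod_generates A M S" "finite S"
  shows "carrier M = {\<zero>\<^bsub>M\<^esub>} \<longleftrightarrow> (\<forall>n. hilb S n = 0)"
proof
  have S: "S \<subseteq> carrier M" using assms(1) by (simp add: mod_generates_def)
  show "\<forall>n. hilb S n = 0" if zero: "carrier M = {\<zero>\<^bsub>M\<^esub>}"
  proof
    fix n
    have "fil S n = {\<zero>\<^bsub>M\<^esub>}"
      using R.subspaceD(1,2)[OF fil_subspace[OF S, of n]] zero by auto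
    thus "hilb S n = 0" using R.sdim_zero by (simp add: hilb_def)
  qed
  show "carrier M = {\<zero>\<^bsub>M\<^esub>}" if zero: "\<forall>n. hilb S n = 0"
  proof -
    have "y = \<zero>\<^bsub>M\<^esub>" if y: "y \<in> carrier M" for y
    proof (rule ccontr)
      assume "y \<noteq> \<zero>\<^bsub>M\<^esub>"
      obtain n where n: "y \<in> fil S n" using y fil_Union[OF assms(1)] by blast
      have "sdim K R (R.span (insert y {})) = sdim K R (R.span {}) + 1"
        using R.sdim_span_insert[of "{}" y] y R.span_empty \<open>y \<noteq> \<zero>\<^bsub>M\<^esub>\<close> by simp
      moreover have "sdim K R (R.span {y}) \<le> hilb S n"
        using n y by (intro sdim_mono_fil assms S R.span_is_subspace R.span_least fil_subspace) auto
      ultimately show False using zero by simp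
    qed
    moreover have "\<zero>\<^bsub>M\<^esub> \<in> carrier M" by simp
    ultimately show ?thesis by blast
  qed
qed

lemma growth_exists:
  assumes "mod_generates A M S" "finite S" "carrier M \<noteq> {\<zero>\<^bsub>M\<^esub>}"
  shows "\<exists>e c. has_growth (hilb S) e c"
  using hilb_zero_or_growth[OF assms(2)] carrier_zero_iff_hilb[OF assms(1,2)] assms(1,3)
  by (auto simp: mod_generates_def)

end

section \<open>Powers of a generating subspace compared with the filtration\<close>

context almost_commutative_algebra
begin

lemma preimage_mult_left_subspace:
  assumes "subspace K U A" "b \<in> carrier A"
  shows "subspace K {a \<in> carrier A. a \<otimes> b \<in> U} A"
  by (rule V.subspaceI)
    (use assms(2) V.subspaceD[OF assms(1)] in \<open>auto simp: A.l_distr smult_mult_left[symmetric]\<close>)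

context
  fixes W :: "'a set"
  assumes W: "fin_dim_subspace K W A" "\<one> \<in> W" "alg_generates K A W"
begin

abbreviation P :: "nat \<Rightarrow> 'a set" where "P \<equiv> alg_power K A W"

lemma W_subspace: "subspace K W A" using W(1) by (simp add: fin_dim_subspace_def)

lemma W_closed: "W \<subseteq> carrier A" using V.subspaceD(1)[OF W_subspace] .

lemma P_subspace: "subspace K (P n) A"
proof (induction n)
  case (Suc n)
  show ?case
    using W_closed V.subspaceD(1)[OF Suc] by (auto intro!: V.span_is_subspace)
qed (auto intro!: V.span_is_subspace)

lemma P_closed: "P n \<subseteq> carrier A" using V.subspaceD(1)[OF P_subspace] .

lemma P_Suc_mem: "w \<in> W \<Longrightarrow> a \<in> P n \<Longrightarrow> w \<otimes> a \<in> P (Suc n)"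
  using V.in_own_span[of "{w \<otimes> a | w a. w \<in> W \<and> a \<in> P n}"] W_closed P_closed[of n] by auto

lemma P_Suc_least:
  assumes "subspace K U A" "\<And>w a. w \<in> W \<Longrightarrow> a \<in> P n \<Longrightarrow> w \<otimes> a \<in> U"
  shows "P (Suc n) \<subseteq> U"
  unfolding alg_power.simps using assms by (intro V.span_least) auto

lemma P_mono: "m \<le> n \<Longrightarrow> P m \<subseteq> P n"
proof (rule lift_Suc_mono_le)
  show "P n \<subseteq> P (Suc n)" for n
  proof
    fix a assume a: "a \<in> P n"
    hence "a \<in> carrier A" using P_closed by blast
    thus "a \<in> P (Suc n)" using P_Suc_mem[OF W(2) a] by (simp del: alg_power.simps)
  qed
qed

lemma one_P: "\<one> \<in> P n"
  using P_mono[of 0 n] V.in_own_span[of "{\<one>}"] by auto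

lemma W_P: "W \<subseteq> P 1"
proof
  fix w assume w: "w \<in> W"
  hence "w \<in> carrier A" using W_closed by blast
  thus "w \<in> P 1" using P_Suc_mem[OF w one_P, of 0] by (simp del: alg_power.simps)
qed

lemma P_mult:
  assumes "a \<in> P m" "b \<in> P n"
  shows "a \<otimes> b \<in> P (m + n)"
proof -
  have b: "b \<in> carrier A" using assms(2) P_closed by blast
  have "P m \<subseteq> {a \<in> carrier A. a \<otimes> b \<in> P (m + n)}"
  proof (induction m)
    case 0
    have "V.span {\<one>} \<subseteq> {a \<in> carrier A. a \<otimes> b \<in> P n}"
      using b assms(2) by (intro V.span_least preimage_mult_left_subspace P_subspace) auto
    thus ?case by simp
  next
    case (Suc m)
    show ?case
    proof (intro P_Suc_least preimage_mult_left_subspace P_subspace b)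
      fix w a assume wa: "w \<in> W" "a \<in> P m"
      hence "w \<otimes> (a \<otimes> b) \<in> P (Suc (m + n))" using Suc by (intro P_Suc_mem) auto
      moreover have c: "w \<in> carrier A" "a \<in> carrier A" using wa W_closed P_closed by auto
      ultimately show "w \<otimes> a \<in> {a \<in> carrier A. a \<otimes> b \<in> P (Suc m + n)}"
        using b by (simp add: A.m_assoc del: alg_power.simps)
    qed
  qed
  thus ?thesis using assms(1) by blast
qed

lemma P_Union: "(\<Union>n. P n) = carrier A"
proof -
  define B where "B = (\<Union>n. P n)"
  have common: "\<exists>n. a \<in> P n \<and> b \<in> P n" if ab: "a \<in> B" "b \<in> B" for a b
  proof -
    obtain m n where "a \<in> P m" "b \<in> P n" using ab by (auto simp: B_def)
    thus ?thesis using P_mono[of m "max m n"] P_mono[of n "max m n"] by (intro exI[of _ "max m n"]) auto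
  qed
  have B_carrier: "B \<subseteq> carrier A" using P_closed by (auto simp: B_def)
  have B_one: "\<one> \<in> B" using one_P by (auto simp: B_def)
  have B_mult: "a \<otimes> b \<in> B" if ab: "a \<in> B" "b \<in> B" for a b
  proof -
    obtain n where "a \<in> P n" "b \<in> P n" using common[OF ab] by blast
    thus ?thesis using P_mult[of a n b n] by (auto simp: B_def)
  qed
  have B_add: "a \<oplus> b \<in> B" if ab: "a \<in> B" "b \<in> B" for a b
    using common[OF ab] V.subspaceD(3)[OF P_subspace] by (auto simp: B_def)
  have B_neg: "\<ominus> a \<in> B" if "a \<in> B" for a
    using that V.subspace_minus(1)[OF P_subspace] by (auto simp: B_def)
  have B_smult: "c \<odot> a \<in> B" if "c \<in> carrier K" "a \<in> B" for c a
    using that V.subspaceD(4)[OF P_subspace] by (auto simp: B_def)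
  have "subring B A" by (rule A.subringI[OF B_carrier B_one B_neg B_mult B_add])
  moreover from this have "Module.submodule B K A"
    by (intro Module.submodule.intro submodule_axioms.intro B_smult) (auto simp: subring_def)
  moreover have "W \<subseteq> B" using W_P unfolding B_def by (meson UN_upper UNIV_I subset_trans)
  ultimately have "B = carrier A" using W(3) by (auto simp: alg_generates_def)
  thus ?thesis by (simp add: B_def)
qed

text \<open>W lies in some \<open>F a\<close>, and filtration degrees add under multiplication.
  Taking a successor for a keeps it positive.\<close>

lemma P_le_F: "\<exists>a\<ge>1. \<forall>n. P n \<subseteq> F (a * n)"
proof -
  obtain X where X: "finite X" "X \<subseteq> carrier A" "W = V.span X"
    using W(1) fin_dim_subspace_iff[OF V.vectorspace_axioms] by blast
  obtain a0 where a0: "X \<subseteq> F a0" using F_absorbs_finite[OF X(1,2)] by blast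
  define a where "a = Suc a0"
  have "F a0 \<subseteq> F a" by (rule F_mono) (simp add: a_def)
  hence W_F: "W \<subseteq> F a" unfolding X(3) using a0 by (intro V.span_least F_subspace) auto
  have "P n \<subseteq> F (a * n)" for n
  proof (induction n)
    case 0
    have "V.span {\<one>} \<subseteq> F 0" using F_one by (intro V.span_least F_subspace) auto
    thus ?case by simp
  next
    case (Suc n)
    show ?case
    proof (rule P_Suc_least[OF F_subspace])
      fix w b assume "w \<in> W" "b \<in> P n"
      hence "w \<otimes> b \<in> F (a + a * n)" using W_F Suc by (intro F_mult) auto
      thus "w \<otimes> b \<in> F (a * Suc n)" by simp
    qed
  qed
  moreover have "a \<ge> 1" by (simp add: a_def)
  ultimately show ?thesis by blast
qed

text \<open>This direction depends on generation in bounded degree: an element of degree n is built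
  from products of at most n factors of positive degree and one further factor, each of them in
  \<open>F D\<close> and hence in \<open>P b\<close>.\<close>

lemma F_le_P: "\<exists>b\<ge>1. \<forall>n. F n \<subseteq> P (b * (n + 1))"
proof -
  obtain X where X: "finite X" "X \<subseteq> carrier A" "F D = V.span X" using F_finite_span by metis
  have "\<exists>b. X \<subseteq> P b" using X(1,2)
  proof (induction X rule: finite_induct)
    case (insert v X)
    then obtain m where m: "X \<subseteq> P m" by auto
    obtain n where n: "v \<in> P n" using insert.prems P_Union by blast
    have "insert v X \<subseteq> P (max m n)"
      using m n P_mono[of m "max m n"] P_mono[of n "max m n"] by auto
    thus ?case by blast
  qed simp
  then obtain b0 where b0: "X \<subseteq> P b0" by blast
  define b where "b = Suc b0"
  have b: "b \<ge> 1" by (simp add: b_def)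
  have "P b0 \<subseteq> P b" by (rule P_mono) (simp add: b_def)
  hence F_D: "F D \<subseteq> P b" unfolding X(3) using b0 by (intro V.span_least P_subspace) auto
  have low: "F i \<subseteq> P b" if "i \<le> D" for i using F_mono[OF that] F_D by blast
  have "F n \<subseteq> P (b * (n + 1))" for n
  proof (induction n rule: less_induct)
    case (less n)
    have "a \<in> P (b * (n + 1))" if "generated_upto D n a" for a
      using that less
    proof (induction rule: generated_upto.induct)
      case (base n a)
      have "P b \<subseteq> P (b * (n + 1))" by (rule P_mono) simp
      thus ?case using low[OF base(1)] base(2) by auto
    next
      case (lower a n)
      have "P (b * (n + 1)) \<subseteq> P (b * (Suc n + 1))" by (rule P_mono) simp
      thus ?case using lower.prems[of n] lower.hyps by auto
    next
      case (mult i a m c)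
      have "c \<in> P (b * (m + 1))" using mult.prems[of m] mult.hyps generated_upto_F[OF mult.hyps(4)] by auto
      moreover have "a \<in> P b" using low[OF mult.hyps(2)] mult.hyps(3) by blast
      ultimately have "a \<otimes> c \<in> P (b + b * (m + 1))" by (intro P_mult)
      also have "b + b * (m + 1) = b * (1 + m + 1)" by (simp add: algebra_simps)
      \<comment> \<open>The degree i of the new factor is at least 1, which pays for the additional
        factor from \<open>P b\<close>.\<close>
      also have "P (b * (1 + m + 1)) \<subseteq> P (b * (i + m + 1))"
        using mult.hyps(1) by (intro P_mono mult_le_mono) auto
      finally show ?case .
    next
      case (add n a c)
      show ?case using V.subspaceD(3)[OF P_subspace add.IH(1)[OF add.prems] add.IH(2)[OF add.prems]] by simp
    qed
    thus ?case using generated_upto by blast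
  qed
  thus ?thesis using b by blast
qed

end

end

section \<open>Gelfand-Kirillov dimension as the exponent of growth\<close>

context almost_commutative_module
begin

text \<open>The spaces generated from S by powers of W are caught between filtration steps whose
  indices are linear in n. Linear changes of the index alter only the multiplicative constant, which
  the logarithm to base n forgets.\<close>

lemma GK_growth_eq:
  assumes W: "fin_dim_subspace K W A" "\<one> \<in> W" "alg_generates K A W"
    and S: "finite S" "mod_generates A M S" and g: "has_growth (hilb S) e c"
  shows "GK_growth K A M W (R.span S) = ereal (real e)"
proof -
  let ?P = "alg_power K A W"
  let ?h = "\<lambda>n. sdim K R (act (?P n) S)"
  have Sc: "S \<subseteq> carrier M" using S by (simp add: mod_generates_def)
  note Pc = P_closed[OF W]
  obtain a where a: "a \<ge> 1" "\<And>n. ?P n \<subseteq> F (a * n)" using P_le_F[OF W] by blast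
  obtain b where b: "b \<ge> 1" "\<And>n. F n \<subseteq> ?P (b * (n + 1))" using F_le_P[OF W] by blast
  have up: "?h n \<le> hilb S (a * n)" for n
    using a(2) by (intro sdim_mono_fil S Sc act_subspace Pc act_mono) auto
  have lo: "hilb S m \<le> ?h n" if "b * (m + 1) \<le> n" for m n
  proof -
    obtain X where X: "finite X" "X \<subseteq> carrier M" "fil S (a * n) = R.span X"
      using fil_finite_span[OF S(1) Sc] by metis
    have "fil S m \<subseteq> act (?P n) S"
      using b(2)[of m] P_mono[OF W that] by (intro act_mono) auto
    moreover have "act (?P n) S \<subseteq> R.span X"
      unfolding X(3)[symmetric] using a(2) by (intro act_mono) auto
    ultimately show ?thesis unfolding hilb_def
      using X by (intro R.sdim_mono_subspace[of X] fil_subspace act_subspace Pc Sc) auto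
  qed
  obtain C where C: "C > 0" "eventually (\<lambda>n. real (hilb S n) \<le> C * real n ^ e) sequentially"
    using has_growth_eventually_bounds(1)[OF g] by blast
  obtain C' where C': "C' > 0" "eventually (\<lambda>n. C' * real n ^ e \<le> real (hilb S n)) sequentially"
    using has_growth_eventually_bounds(2)[OF g] by blast
  obtain N where N: "\<And>n. n \<ge> N \<Longrightarrow> real (hilb S n) \<le> C * real n ^ e"
    using C(2) unfolding eventually_sequentially by blast
  obtain N' where N': "\<And>n. n \<ge> N' \<Longrightarrow> C' * real n ^ e \<le> real (hilb S n)"
    using C'(2) unfolding eventually_sequentially by blast
  have upper: "eventually (\<lambda>n. real (?h n) \<le> (C * real a ^ e) * real n ^ e) sequentially"
    unfolding eventually_sequentially
  proof (intro exI allI impI)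
    fix n assume "n \<ge> N"
    hence "a * n \<ge> N" using a(1) by (metis le_trans mult_le_mono1 nat_mult_1)
    thus "real (?h n) \<le> (C * real a ^ e) * real n ^ e"
      using N[of "a * n"] up[of n] by (simp add: power_mult_distrib mult.assoc)
  qed
  have lower: "eventually (\<lambda>n. (C' / (4 * real b) ^ e) * real n ^ e \<le> real (?h n)) sequentially"
    unfolding eventually_sequentially
  proof (intro exI allI impI)
    fix n assume n: "n \<ge> b * (N' + 4)"
    \<comment> \<open>The largest m with b(m + 1) at most n. The summand 4 in the threshold makes m
      at least 3, so that n div b = m + 1 is at most 2m and n is at most 4bm.\<close>
    define m where "m = n div b - 1"
    have nb: "n div b \<ge> N' + 4" using n b(1) by (simp add: less_eq_div_iff_mult_less_eq mult.commute)
    hence m: "m + 1 = n div b" "m \<ge> N'" "n div b \<le> 2 * m" by (auto simp: m_def)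
    have "b * (m + 1) \<le> n" unfolding m(1) by simp
    hence "hilb S m \<le> ?h n" by (rule lo)
    have "n < b * (n div b) + b" using b(1) mod_less_divisor[of b n] mult_div_mod_eq[of b n] by linarith
    also have "\<dots> \<le> b * (2 * m) + b * (2 * m)" using m nb by (intro add_mono mult_le_mono) auto
    finally have "n \<le> 4 * b * m" by simp
    hence "real n \<le> real (4 * b * m)" by (simp only: of_nat_le_iff)
    hence "real n / (4 * real b) \<le> real m" using b(1) by (simp add: field_simps)
    hence "(real n / (4 * real b)) ^ e \<le> real m ^ e" by (intro power_mono) auto
    hence "C' * (real n / (4 * real b)) ^ e \<le> C' * real m ^ e" using C'(1) by simp
    also have "\<dots> \<le> real (hilb S m)" using N' m by simp
    also have "\<dots> \<le> real (?h n)" using \<open>hilb S m \<le> ?h n\<close> by simp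
    finally show "(C' / (4 * real b) ^ e) * real n ^ e \<le> real (?h n)" by (simp add: power_divide)
  qed
  have "limsup (\<lambda>n. ereal (log (real n) (real (?h n)))) = ereal (real e)"
    by (rule limsup_log_polynomial_growth[OF _ _ lower upper]) (use a(1) b(1) C(1) C'(1) in auto)
  thus ?thesis
    using act_span_right[OF Pc Sc] by (simp add: GK_growth_def sdim_def)
qed

text \<open>The definite description in \<open>GK\<close> requires one admissible pair and the same
  value for all of them. The witness is the span of 1 and of finitely many algebra generators,
  together with the span of S; uniqueness is the independence of choices.\<close>

lemma GK_eq:
  assumes aff: "affine_algebra K A" and S: "finite S" "mod_generates A M S"
    and g: "has_growth (hilb S) e c" and nz: "carrier M \<noteq> {\<zero>\<^bsub>M\<^esub>}"
  shows "GK K A M = ereal (real e)"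
proof -
  have Sc: "S \<subseteq> carrier M" using S by (simp add: mod_generates_def)
  obtain X where X: "finite X" "alg_generates K A X" using aff by (auto simp: affine_algebra_def)
  have Xc: "X \<subseteq> carrier A" using X by (simp add: alg_generates_def)
  have "(THE gr. \<exists>V Y. fin_dim_subspace K V A \<and> \<one> \<in> V \<and> alg_generates K A V \<and>
        fin_dim_subspace K Y R \<and> mod_generates A M Y \<and> gr = GK_growth K A M V Y) = ereal (real e)"
  proof (rule the_equality)
    let ?V = "V.span (insert \<one> X)"
    have sub: "insert \<one> X \<subseteq> ?V" using Xc by (intro V.in_own_span) auto
    have "fin_dim_subspace K ?V A"
      using X(1) Xc by (subst fin_dim_subspace_iff[OF V.vectorspace_axioms]) auto
    moreover have "\<one> \<in> ?V" using sub by auto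
    moreover have "?V \<subseteq> carrier A" using Xc by (intro V.span_is_subset2) auto
    hence "alg_generates K A ?V" using X(2) sub unfolding alg_generates_def by blast
    moreover have "fin_dim_subspace K (R.span S) R"
      using S(1) Sc by (subst fin_dim_subspace_iff[OF R.vectorspace_axioms]) auto
    moreover have "R.span S \<subseteq> carrier M" "S \<subseteq> R.span S"
      using R.span_is_subset2[of S] R.in_own_span[of S] Sc by auto
    hence "mod_generates A M (R.span S)" using S(2) unfolding mod_generates_def by blast
    moreover have "GK_growth K A M ?V (R.span S) = ereal (real e)"
      by (rule GK_growth_eq) (use calculation S g in auto)
    ultimately show "\<exists>V Y. fin_dim_subspace K V A \<and> \<one> \<in> V \<and> alg_generates K A V \<and>
        fin_dim_subspace K Y R \<and> mod_generates A M Y \<and> ereal (real e) = GK_growth K A M V Y"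
      by (intro exI[of _ ?V] exI[of _ "R.span S"]) simp
  next
    fix g' assume "\<exists>V Y. fin_dim_subspace K V A \<and> \<one> \<in> V \<and> alg_generates K A V \<and>
        fin_dim_subspace K Y R \<and> mod_generates A M Y \<and> g' = GK_growth K A M V Y"
    then obtain V Y where V: "fin_dim_subspace K V A" "\<one> \<in> V" "alg_generates K A V"
      and Y: "fin_dim_subspace K Y R" "mod_generates A M Y" and g': "g' = GK_growth K A M V Y" by blast
    \<comment> \<open>A finite-dimensional generating subspace Y is traded for a finite spanning
      set. That set also generates M, because a submodule containing it is a subspace and so
      contains Y.\<close>
    obtain S' where S': "finite S'" "S' \<subseteq> carrier M" "Y = R.span S'"
      using Y(1) fin_dim_subspace_iff[OF R.vectorspace_axioms] by auto
    have "mod_generates A M S'"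
      unfolding mod_generates_def
    proof (intro conjI allI impI S'(2))
      fix N assume N: "Module.submodule N A M \<and> S' \<subseteq> N"
      hence "Y \<subseteq> N" unfolding S'(3) by (intro R.span_least submodule_subspace) auto
      thus "N = carrier M" using Y(2) N by (auto simp: mod_generates_def)
    qed
    hence "has_growth (hilb S') e c" using has_growth_hilb_independent[OF S(2,1) _ S'(1) g] by blast
    thus "g' = ereal (real e)"
      unfolding g' S'(3) using V S'(1) \<open>mod_generates A M S'\<close> by (intro GK_growth_eq)
  qed
  thus ?thesis using nz by (simp add: GK_def)
qed

end

section \<open>Exact sequences\<close>

lemma restrict_scalars_linear_map:
  fixes A :: "('k, 'a) module" and M :: "('a, 'm) module" and N :: "('a, 'n) module"
  assumes "algebra_module K A M" "algebra_module K A N" "f \<in> LinearCombinations.module_hom A M N"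
  shows "linear_map K (restrict_scalars A M) (restrict_scalars A N) f"
proof -
  interpret M: algebra_module K A M by fact
  interpret N: algebra_module K A N by fact
  have "f \<in> LinearCombinations.module_hom K (restrict_scalars A M) (restrict_scalars A N)"
    using assms(3) by (auto simp: module_hom_def)
  thus ?thesis
    by (intro linear_map.intro mod_hom.intro mod_hom_axioms.intro
        M.R.vectorspace_axioms N.R.vectorspace_axioms M.R.module_axioms N.R.module_axioms)
qed

lemma image_act_space:
  fixes A :: "('k, 'a) module" and M :: "('a, 'm) module" and N :: "('a, 'n) module"
  assumes "algebra_module K A M" "algebra_module K A N" and f: "f \<in> LinearCombinations.module_hom A M N"
    and W: "W \<subseteq> carrier A" and S: "S \<subseteq> carrier M"
  shows "f ` act_space K A M W S = act_space K A N W (f ` S)"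
proof -
  interpret M: algebra_module K A M by fact
  interpret f: linear_map K "restrict_scalars A M" "restrict_scalars A N" f
    by (rule restrict_scalars_linear_map) fact+
  have "f ` {w \<odot>\<^bsub>M\<^esub> x | w x. w \<in> W \<and> x \<in> S} = {w \<odot>\<^bsub>N\<^esub> x | w x. w \<in> W \<and> x \<in> f ` S}"
    using module_hom_smult[OF f] W S by (auto simp: image_iff subset_iff) (metis+)
  thus ?thesis
    unfolding act_space_def using f.image_span[OF M.act_gens_closed[OF W S]] by simp
qed

section \<open>Growth data as invariants of a module\<close>

context almost_commutative_algebra
begin

text \<open>Stated through \<open>sdim\<close> rather than \<open>hilb\<close>, which belongs to the
  locale of a single module, so that all terms of an exact sequence can be compared. By
  \<open>module_growthD\<close> the generating set could equally be quantified universally for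
  finitely generated M.\<close>

definition module_growth :: "('a, 'm) module \<Rightarrow> nat \<Rightarrow> rat \<Rightarrow> bool" where
  "module_growth M e c \<longleftrightarrow> (\<exists>S. finite S \<and> mod_generates A M S \<and>
     has_growth (\<lambda>n. sdim K (restrict_scalars A M) (act_space K A M (F n) S)) e c)"

lemma almost_commutative_moduleI: "left_module A M \<Longrightarrow> almost_commutative_module K A F D M"
  by (intro almost_commutative_module.intro almost_commutative_algebra_axioms filtered_module.intro
      filtered_algebra_axioms algebra_module.intro assoc_algebra_axioms)

lemma fg_almost_commutative_module: "M \<in> fg_modules A \<Longrightarrow> almost_commutative_module K A F D M"
  by (rule almost_commutative_moduleI) (simp add: fg_modules_def)

lemma module_growth_exists:
  assumes "M \<in> fg_modules A" "carrier M \<noteq> {\<zero>\<^bsub>M\<^esub>}"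
  shows "\<exists>e c. module_growth M e c"
proof -
  interpret M: almost_commutative_module K A F D M by (rule fg_almost_commutative_module) fact
  obtain S where S: "finite S" "mod_generates A M S" using assms(1) by (auto simp: fg_modules_def)
  obtain e c where "has_growth (M.hilb S) e c" using M.growth_exists[OF S(2,1) assms(2)] by blast
  thus ?thesis using S unfolding module_growth_def M.hilb_def by blast
qed

lemma module_growthD:
  assumes "M \<in> fg_modules A" "module_growth M e c" "finite S" "mod_generates A M S"
  shows "has_growth (\<lambda>n. sdim K (restrict_scalars A M) (act_space K A M (F n) S)) e c"
proof -
  interpret M: almost_commutative_module K A F D M by (rule fg_almost_commutative_module) fact
  obtain S' where S': "finite S'" "mod_generates A M S'" "has_growth (M.hilb S') e c"
    using assms(2) unfolding module_growth_def M.hilb_def by blast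
  have "has_growth (M.hilb S) e c"
    by (rule M.has_growth_hilb_independent[OF S'(2,1) assms(4,3) S'(3)])
  thus ?thesis unfolding M.hilb_def .
qed

lemma module_growth_unique:
  assumes "M \<in> fg_modules A" "module_growth M e c" "module_growth M e' c'"
  shows "e = e' \<and> c = c'"
proof -
  obtain S where S: "finite S" "mod_generates A M S" using assms(1) by (auto simp: fg_modules_def)
  show ?thesis
    using has_growth_unique[OF module_growthD[OF assms(1,2) S] module_growthD[OF assms(1,3) S]] .
qed

lemma GK_module_growth:
  assumes "affine_algebra K A" "M \<in> fg_modules A" "carrier M \<noteq> {\<zero>\<^bsub>M\<^esub>}" "module_growth M e c"
  shows "GK K A M = ereal (real e)"
proof -
  interpret M: almost_commutative_module K A F D M by (rule fg_almost_commutative_module) fact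
  obtain S where S: "finite S" "mod_generates A M S" "has_growth (M.hilb S) e c"
    using assms(4) unfolding module_growth_def M.hilb_def by blast
  show ?thesis by (rule M.GK_eq[OF assms(1) S assms(3)])
qed

text \<open>The bare leading coefficient, without the factorial of the dimension that is customary
  for multiplicities. That factor depends on the dimension alone, so additivity among modules of
  equal dimension holds with or without it.\<close>

definition module_mult :: "('a, 'm) module \<Rightarrow> rat" where
  "module_mult M = (if carrier M = {\<zero>\<^bsub>M\<^esub>} then 0 else (THE c. \<exists>e. module_growth M e c))"

lemma module_mult_eq:
  assumes "M \<in> fg_modules A" "carrier M \<noteq> {\<zero>\<^bsub>M\<^esub>}" "module_growth M e c"
  shows "module_mult M = c"
proof -
  have "(THE c. \<exists>e. module_growth M e c) = c"
    using assms(3) module_growth_unique[OF assms(1,3)] by (intro the_equality) blast+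
  thus ?thesis using assms(2) by (simp add: module_mult_def)
qed

lemma module_growth_pos: "module_growth M e c \<Longrightarrow> c > 0"
  by (auto simp: module_growth_def has_growth_def)

lemma module_mult_pos:
  assumes "M \<in> fg_modules A" "carrier M \<noteq> {\<zero>\<^bsub>M\<^esub>}"
  shows "module_mult M > 0"
proof -
  obtain e c where "module_growth M e c" using module_growth_exists[OF assms] by blast
  thus ?thesis using module_mult_eq[OF assms] module_growth_pos by simp
qed

text \<open>Here \<open>k\<close> is the Hilbert function of the filtration that \<open>M\<close> induces on \<open>M'\<close>.\<close>

lemma exact_hilbert_functions:
  fixes M' M M'' :: "('a, 'm) module"
  assumes fg: "M' \<in> fg_modules A" "M \<in> fg_modules A" "M'' \<in> fg_modules A"
    and ex: "short_exact A M' M M''"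
  shows "\<exists>S S' S'' k s. finite S \<and> mod_generates A M S \<and> finite S' \<and> mod_generates A M' S' \<and>
    finite S'' \<and> mod_generates A M'' S'' \<and>
    (\<forall>n. sdim K (restrict_scalars A M) (act_space K A M (F n) S) =
      k n + sdim K (restrict_scalars A M'') (act_space K A M'' (F n) S'')) \<and>
    (\<forall>n. k n \<le> sdim K (restrict_scalars A M') (act_space K A M' (F n) S')) \<and>
    (\<forall>n. sdim K (restrict_scalars A M') (act_space K A M' (F n) S') \<le> k (n + s))"
proof -
  interpret M': almost_commutative_module K A F D M' by (rule fg_almost_commutative_module) fact
  interpret M: almost_commutative_module K A F D M by (rule fg_almost_commutative_module) fact
  interpret M'': almost_commutative_module K A F D M'' by (rule fg_almost_commutative_module) fact
  obtain f g where f: "f \<in> LinearCombinations.module_hom A M' M" "inj_on f (carrier M')"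
    and g: "g \<in> LinearCombinations.module_hom A M M''" "g ` carrier M = carrier M''"
    and ker: "f ` carrier M' = a_kernel M M'' g"
    using ex unfolding short_exact_def by blast
  interpret f: linear_map K "restrict_scalars A M'" "restrict_scalars A M" f
    by (rule restrict_scalars_linear_map[OF M'.algebra_module_axioms M.algebra_module_axioms f(1)])
  interpret g: linear_map K "restrict_scalars A M" "restrict_scalars A M''" g
    by (rule restrict_scalars_linear_map[OF M.algebra_module_axioms M''.algebra_module_axioms g(1)])
  obtain S where S: "finite S" "mod_generates A M S" using fg(2) by (auto simp: fg_modules_def)
  have Sc: "S \<subseteq> carrier M" using S by (simp add: mod_generates_def)
  define N where "N = f ` carrier M'"
  have N_ker: "N = {x \<in> carrier M. g x = \<zero>\<^bsub>M''\<^esub>}" unfolding N_def ker by (simp add: a_kernel_def')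
  have N_sub: "subspace K N M.R"
    unfolding N_ker using g.kerT_is_subspace unfolding g.ker_def by simp
  have N: "Module.submodule N A M"
  proof (intro Module.submodule.intro submodule_axioms.intro)
    show "subgroup N (add_monoid M)"
      by (rule M.M.M.add.subgroupI)
        (use M.R.subspaceD[OF N_sub] M.R.subspace_minus(1)[OF N_sub] in \<open>auto simp: a_inv_def[symmetric]\<close>)
    show "a \<odot>\<^bsub>M\<^esub> x \<in> N" if a: "a \<in> carrier A" and x: "x \<in> N" for a x
    proof -
      obtain y where y: "y \<in> carrier M'" "x = f y" using x by (auto simp: N_def)
      have "a \<odot>\<^bsub>M\<^esub> x = f (a \<odot>\<^bsub>M'\<^esub> y)" using module_hom_smult[OF f(1) a y(1)] y(2) by simp
      thus ?thesis using M'.M.smult_closed[OF a y(1)] by (simp add: N_def)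
    qed
  qed
  \<comment> \<open>The division bound is applied to the image N of M' in M. As G lies in this
    image, it pulls back to a finite set S' of generators for M'.\<close>
  obtain G where G: "finite G" "G \<subseteq> N" "\<And>n. N \<inter> M.fil S n \<subseteq> M.fil G n"
    using M.artin_rees[OF S(1) Sc N] by blast
  obtain S' where S': "finite S'" "S' \<subseteq> carrier M'" "G = f ` S'"
    using finite_subset_image[OF G(1)] G(2) unfolding N_def by metis
  have Gc: "G \<subseteq> carrier M" using G(2) N_ker by blast
  have f_fil: "f ` M'.fil S' n = M.fil G n" for n
    using image_act_space[OF M'.algebra_module_axioms M.algebra_module_axioms f(1) F_carrier S'(2)] S'(3) by simp
  \<comment> \<open>Generation follows from the division bound too: f y lies in some
    \<open>M.fil S n\<close>, hence in \<open>M.fil G n\<close>, which is the image of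
    \<open>M'.fil S' n\<close>; injectivity of f recovers y.\<close>
  have S'_gen: "mod_generates A M' S'"
    unfolding mod_generates_def
  proof (intro conjI allI impI S'(2))
    fix U assume U: "Module.submodule U A M' \<and> S' \<subseteq> U"
    interpret U: Module.submodule U A M' using U by blast
    have "carrier M' \<subseteq> U"
    proof
      fix y assume y: "y \<in> carrier M'"
      hence "f y \<in> N" by (simp add: N_def)
      moreover obtain n where "f y \<in> M.fil S n"
        using M.fil_Union[OF S(2)] \<open>f y \<in> N\<close> N_ker by blast
      ultimately have "f y \<in> f ` M'.fil S' n" using G(3) f_fil by blast
      hence "y \<in> M'.fil S' n"
        using inj_onD[OF f(2)] y M'.fil_closed[OF S'(2), of n] by blast
      moreover have "M'.fil S' n \<subseteq> U"
        using U U.smult_closed F_closed by (intro M'.act_least M'.submodule_subspace) auto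
      ultimately show "y \<in> U" by blast
    qed
    thus "U = carrier M'" using U.subset by auto
  qed
  have S''_gen: "mod_generates A M'' (g ` S)"
    unfolding mod_generates_def
  proof (intro conjI allI impI)
    show "g ` S \<subseteq> carrier M''" using Sc g(2) by auto
    fix U assume U: "Module.submodule U A M'' \<and> g ` S \<subseteq> U"
    interpret U: Module.submodule U A M'' using U by blast
    have "carrier M'' \<subseteq> U"
    proof
      fix z assume "z \<in> carrier M''"
      then obtain y where y: "y \<in> carrier M" "z = g y" using g(2) by blast
      obtain n where "y \<in> M.fil S n" using M.fil_Union[OF S(2)] y(1) by blast
      hence "z \<in> M''.fil (g ` S) n"
        using image_act_space[OF M.algebra_module_axioms M''.algebra_module_axioms g(1) F_carrier Sc] y(2) by blast
      moreover have "M''.fil (g ` S) n \<subseteq> U"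
        using U U.smult_closed F_closed by (intro M''.act_least M''.submodule_subspace) auto
      ultimately show "z \<in> U" by blast
    qed
    thus "U = carrier M''" using U.subset by auto
  qed
  define k where "k n = sdim K M.R {x \<in> M.fil S n. g x = \<zero>\<^bsub>M''\<^esub>}" for n
  have k_set: "{x \<in> M.fil S n. g x = \<zero>\<^bsub>M''\<^esub>} = N \<inter> M.fil S n" for n
    using M.fil_closed[OF Sc, of n] N_ker by auto
  have k_sub: "subspace K (N \<inter> M.fil S n) M.R" for n
    by (rule M.R.subspaceI)
      (use M.R.subspaceD[OF N_sub] M.R.subspaceD[OF M.fil_subspace[OF Sc, of n]] in auto)
  have sum: "M.hilb S n = k n + M''.hilb (g ` S) n" for n
  proof -
    obtain X where X: "finite X" "X \<subseteq> carrier M" "M.fil S n = M.R.span X"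
      using M.fil_finite_span[OF S(1) Sc] by metis
    \<comment> \<open>Rank-nullity for g restricted to one filtration step: the kernel is the
      induced step on N, and the image is the step of M'' given by the images of the
      generators.\<close>
    have "M.hilb S n = sdim K M''.R (g ` M.fil S n) + k n"
      unfolding M.hilb_def k_def X(3) using g.sdim_rank_nullity[of X] X(1,2) by simp
    also have "g ` M.fil S n = M''.fil (g ` S) n"
      by (rule image_act_space[OF M.algebra_module_axioms M''.algebra_module_axioms g(1) F_carrier Sc])
    finally show ?thesis by (simp add: M''.hilb_def)
  qed
  have hilb': "M'.hilb S' n = M.hilb G n" for n
  proof -
    obtain X where X: "finite X" "X \<subseteq> carrier M'" "M'.fil S' n = M'.R.span X"
      using M'.fil_finite_span[OF S'(1,2)] by metis
    show ?thesis
      unfolding M'.hilb_def M.hilb_def f_fil[symmetric] X(3)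
      using f.sdim_inj_image[of X] X(1,2) f(2) by simp
  qed
  have k_le: "k n \<le> M'.hilb S' n" for n
    unfolding k_def k_set hilb' using G(1,3) Gc k_sub by (intro M.sdim_mono_fil)
  \<comment> \<open>The level at which the filtration of M has absorbed G becomes the shift between
    the two filtrations of M'.\<close>
  obtain s where s: "G \<subseteq> M.fil S s" using M.fil_absorbs_finite[OF S(2) G(1) Gc] by blast
  have le_k: "M'.hilb S' n \<le> k (n + s)" for n
  proof -
    obtain X where X: "finite X" "X \<subseteq> carrier M" "M.fil S (n + s) = M.R.span X"
      using M.fil_finite_span[OF S(1) Sc] by metis
    have "M.fil G n \<subseteq> N"
    proof (rule M.act_least[OF N_sub])
      interpret N: Module.submodule N A M by (rule N)
      show "w \<odot>\<^bsub>M\<^esub> x \<in> N" if "w \<in> F n" "x \<in> G" for w x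
        using that G(2) F_closed by (intro N.smult_closed) auto
    qed
    moreover have "M.fil G n \<subseteq> M.fil S (n + s)" by (rule M.fil_subset_shift[OF Sc s])
    ultimately show ?thesis
      unfolding hilb' M.hilb_def k_def k_set using X
      by (intro M.R.sdim_mono_subspace[of X] M.fil_subspace Gc k_sub) auto
  qed
  show ?thesis
    using S S'(1) S'_gen S''_gen sum k_le le_k
    unfolding M.hilb_def M'.hilb_def M''.hilb_def
    by (intro exI[of _ S] exI[of _ S'] exI[of _ "g ` S"] exI[of _ k] exI[of _ s]) simp
qed

text \<open>The Hilbert function of M is that of M'' plus k, and k grows like M' because the two
  interleave up to a shift. In a sum the larger exponent wins, and equal exponents add their
  coefficients.\<close>

lemma exact_growth:
  fixes M' M M'' :: "('a, 'm) module"
  assumes fg: "M' \<in> fg_modules A" "M \<in> fg_modules A" "M'' \<in> fg_modules A"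
    and ex: "short_exact A M' M M''"
  shows "carrier M = {\<zero>\<^bsub>M\<^esub>} \<longleftrightarrow> carrier M' = {\<zero>\<^bsub>M'\<^esub>} \<and> carrier M'' = {\<zero>\<^bsub>M''\<^esub>}"
    and "carrier M' = {\<zero>\<^bsub>M'\<^esub>} \<Longrightarrow> module_growth M'' e c \<Longrightarrow> module_growth M e c"
    and "carrier M'' = {\<zero>\<^bsub>M''\<^esub>} \<Longrightarrow> module_growth M' e c \<Longrightarrow> module_growth M e c"
    and "module_growth M' e' c' \<Longrightarrow> module_growth M'' e'' c'' \<Longrightarrow>
      (e' < e'' \<longrightarrow> module_growth M e'' c'') \<and> (e'' < e' \<longrightarrow> module_growth M e' c') \<and>
      (e' = e'' \<longrightarrow> module_growth M e' (c' + c''))"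
proof -
  interpret M': almost_commutative_module K A F D M' by (rule fg_almost_commutative_module) fact
  interpret M: almost_commutative_module K A F D M by (rule fg_almost_commutative_module) fact
  interpret M'': almost_commutative_module K A F D M'' by (rule fg_almost_commutative_module) fact
  from exact_hilbert_functions[OF fg ex]
  obtain S S' S'' k s where S: "finite S" "mod_generates A M S" and S': "finite S'" "mod_generates A M' S'"
    and S'': "finite S''" "mod_generates A M'' S''"
    and sum: "\<forall>n. M.hilb S n = k n + M''.hilb S'' n"
    and k: "\<forall>n. k n \<le> M'.hilb S' n" "\<forall>n. M'.hilb S' n \<le> k (n + s)"
    unfolding M.hilb_def M'.hilb_def M''.hilb_def by (elim exE conjE)
  have hilb: "M.hilb S = (\<lambda>n. k n + M''.hilb S'' n)" using sum by auto
  have zero': "carrier M' = {\<zero>\<^bsub>M'\<^esub>} \<longleftrightarrow> (\<forall>n. k n = 0)"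
  proof -
    have "k n = 0" if "M'.hilb S' n = 0" for n using spec[OF k(1), of n] that by simp
    moreover have "M'.hilb S' n = 0" if "k (n + s) = 0" for n using spec[OF k(2), of n] that by simp
    ultimately have "(\<forall>n. M'.hilb S' n = 0) \<longleftrightarrow> (\<forall>n. k n = 0)" by blast
    thus ?thesis using M'.carrier_zero_iff_hilb[OF S'(2,1)] by simp
  qed
  note zero = M.carrier_zero_iff_hilb[OF S(2,1)] and zero'' = M''.carrier_zero_iff_hilb[OF S''(2,1)]
  show "carrier M = {\<zero>\<^bsub>M\<^esub>} \<longleftrightarrow> carrier M' = {\<zero>\<^bsub>M'\<^esub>} \<and> carrier M'' = {\<zero>\<^bsub>M''\<^esub>}"
    unfolding zero zero' zero'' hilb by auto
  have growth: "module_growth M e c" if "has_growth (M.hilb S) e c" for e c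
    using that S unfolding module_growth_def M.hilb_def by blast
  have growth': "has_growth k e c" if mg: "module_growth M' e c" for e c
  proof (rule has_growth_sandwich)
    show "has_growth (M'.hilb S') e c"
      using module_growthD[OF fg(1) mg S'] unfolding M'.hilb_def .
    have S'c: "S' \<subseteq> carrier M'" using S'(2) by (simp add: mod_generates_def)
    show "k n \<le> M'.hilb S' (n + s)" for n
      by (rule le_trans[OF k(1)[rule_format] M'.hilb_mono[OF S'(1) S'c]]) simp
    show "M'.hilb S' n \<le> k (n + s)" for n using k(2) by simp
  qed
  have growth'': "has_growth (M''.hilb S'') e c" if mg: "module_growth M'' e c" for e c
    using module_growthD[OF fg(3) mg S''] unfolding M''.hilb_def .
  show "module_growth M e c" if "carrier M' = {\<zero>\<^bsub>M'\<^esub>}" "module_growth M'' e c"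
    using growth[of e c] growth''[OF that(2)] that(1) unfolding zero' hilb by simp
  show "module_growth M e c" if "carrier M'' = {\<zero>\<^bsub>M''\<^esub>}" "module_growth M' e c"
    using growth[of e c] growth'[OF that(2)] that(1) unfolding zero'' hilb by simp
  show "(e' < e'' \<longrightarrow> module_growth M e'' c'') \<and> (e'' < e' \<longrightarrow> module_growth M e' c') \<and>
      (e' = e'' \<longrightarrow> module_growth M e' (c' + c''))"
    if "module_growth M' e' c'" "module_growth M'' e'' c''"
  proof (intro conjI impI growth)
    note g' = growth'[OF that(1)] and g'' = growth''[OF that(2)]
    show "has_growth (M.hilb S) e'' c''" if "e' < e''"
      unfolding hilb by (rule has_growth_add_less[OF g' g'' that])
    show "has_growth (M.hilb S) e' c'" if "e'' < e'"
      unfolding hilb using has_growth_add_less[OF g'' g' that] by (simp add: add.commute)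
    show "has_growth (M.hilb S) e' (c' + c'')" if "e' = e''"
      unfolding hilb using has_growth_add_eq[OF g'] g'' that by simp
  qed
qed

text \<open>With dimension minus infinity and multiplicity 0 for the zero module, vanishing end
  terms obey the same case distinction as all others.\<close>

lemma exact_GK_mult:
  fixes M' M M'' :: "('a, 'm) module"
  assumes aff: "affine_algebra K A"
    and fg: "M' \<in> fg_modules A" "M \<in> fg_modules A" "M'' \<in> fg_modules A"
    and ex: "short_exact A M' M M''"
  shows "GK K A M = max (GK K A M') (GK K A M'') \<and>
    module_mult M = (if GK K A M' < GK K A M'' then module_mult M''
      else if GK K A M'' < GK K A M' then module_mult M' else module_mult M' + module_mult M'')"
proof -
  note E = exact_growth[OF fg ex]
  have zero: "GK K A L = - \<infinity> \<and> module_mult L = 0" if "carrier L = {\<zero>\<^bsub>L\<^esub>}" for L :: "('a, 'm) module"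
    using that by (simp add: GK_def module_mult_def)
  have nz: "GK K A L = ereal (real e) \<and> module_mult L = c"
    if "L \<in> fg_modules A" "carrier L \<noteq> {\<zero>\<^bsub>L\<^esub>}" "module_growth L e c" for L :: "('a, 'm) module" and e c
    using GK_module_growth[OF aff that] module_mult_eq[OF that] by simp
  show ?thesis
  proof (cases "carrier M' = {\<zero>\<^bsub>M'\<^esub>}")
    case z': True
    show ?thesis
    proof (cases "carrier M'' = {\<zero>\<^bsub>M''\<^esub>}")
      case True
      hence "carrier M = {\<zero>\<^bsub>M\<^esub>}" using E(1) z' by simp
      thus ?thesis using zero[OF z'] zero[OF True] zero[of M] by simp
    next
      case False
      then obtain e c where g: "module_growth M'' e c" using module_growth_exists[OF fg(3)] by blast
      have "carrier M \<noteq> {\<zero>\<^bsub>M\<^esub>}" using E(1) False by simp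
      thus ?thesis
        using nz[OF fg(2) _ E(2)[OF z' g]] nz[OF fg(3) False g] zero[OF z'] by simp
    qed
  next
    case nz': False
    then obtain e' c' where g': "module_growth M' e' c'" using module_growth_exists[OF fg(1)] by blast
    have nzM: "carrier M \<noteq> {\<zero>\<^bsub>M\<^esub>}" using E(1) nz' by simp
    show ?thesis
    proof (cases "carrier M'' = {\<zero>\<^bsub>M''\<^esub>}")
      case True
      thus ?thesis
        using nz[OF fg(2) nzM E(3)[OF True g']] nz[OF fg(1) nz' g'] zero[OF True] by simp
    next
      case False
      then obtain e'' c'' where g'': "module_growth M'' e'' c''" using module_growth_exists[OF fg(3)] by blast
      note nz'' = nz[OF fg(1) nz' g'] nz[OF fg(3) False g'']
      consider "e' < e''" | "e'' < e'" | "e' = e''" by linarith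
      thus ?thesis
      proof cases
        case 1
        thus ?thesis using nz[OF fg(2) nzM] E(4)[OF g' g''] nz'' by simp
      next
        case 2
        thus ?thesis using nz[OF fg(2) nzM] E(4)[OF g' g''] nz'' by simp
      next
        case 3
        thus ?thesis using nz[OF fg(2) nzM] E(4)[OF g' g''] nz'' by simp
      qed
    qed
  qed
qed

end

section \<open>Passage from vague commutativity to modesty\<close>

lemma vaguely_commutative_imp_almost_commutative:
  assumes "vaguely_commutative K A"
  shows "\<exists>F D. almost_commutative_algebra K A F D"
proof -
  obtain F where F: "fin_dim_filtration K A F" "affine_algebra K (assoc_graded A F)" "cring (assoc_graded A F)"
    and A: "assoc_algebra K A"
    using assms by (auto simp: vaguely_commutative_def affine_algebra_def)
  interpret filtered_algebra K A F
    by (intro filtered_algebra.intro A filtered_algebra_axioms.intro F(1))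
  obtain D where D: "\<And>n a. a \<in> F n \<Longrightarrow> generated_upto D n a" using generated_upto_all[OF F(2,3)] by blast
  have "almost_commutative_algebra K A F D"
    by unfold_locales (use gr_commutative_imp[OF F(3)] D in auto)
  thus ?thesis by blast
qed

theorem theorem4p29:
  fixes K :: "('k, 'x) ring_scheme" and A :: "('k, 'a) module"
  assumes "field K" and "vaguely_commutative K A"
  shows "modest_algebra TYPE('m) K A"
proof -
  obtain F D where "almost_commutative_algebra K A F D"
    using vaguely_commutative_imp_almost_commutative[OF assms(2)] by blast
  then interpret almost_commutative_algebra K A F D .
  have aff: "affine_algebra K A" using assms(2) by (simp add: vaguely_commutative_def)
  have exact: "GK K A M = max (GK K A M') (GK K A M'') \<and>
    module_mult M = (if GK K A M' < GK K A M'' then module_mult M''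
      else if GK K A M'' < GK K A M' then module_mult M' else module_mult M' + module_mult M'')"
    if "M' \<in> fg_modules A" "M \<in> fg_modules A" "M'' \<in> fg_modules A" "short_exact A M' M M''"
    for M' M M'' :: "('a, 'm) module"
    by (rule exact_GK_mult[OF aff that])
  have integer: "\<exists>d :: nat. GK K A M = ereal (real d)"
    if M: "M \<in> fg_modules A" "carrier M \<noteq> {\<zero>\<^bsub>M\<^esub>}" for M :: "('a, 'm) module"
    using module_growth_exists[OF M] GK_module_growth[OF aff M] by blast
  have module_mult_zero: "module_mult M = 0" if "carrier M = {\<zero>\<^bsub>M\<^esub>}" for M :: "('a, 'm) module"
    using that by (simp add: module_mult_def)
  have module_mult: "module_mult M \<ge> 0 \<and> (module_mult M = 0 \<longleftrightarrow> carrier M = {\<zero>\<^bsub>M\<^esub>})"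
    if M: "M \<in> fg_modules A" for M :: "('a, 'm) module"
    using module_mult_pos[OF M] module_mult_zero[of M] by (cases "carrier M = {\<zero>\<^bsub>M\<^esub>}") auto
  show ?thesis
    unfolding modest_algebra_def
  proof (intro conjI ballI impI exI[of _ "module_mult :: ('a, 'm) module \<Rightarrow> rat"])
    fix M' M M'' :: "('a, 'm) module"
    assume fg: "M' \<in> fg_modules A" "M \<in> fg_modules A" "M'' \<in> fg_modules A" "short_exact A M' M M''"
    \<comment> \<open>As the dimension of M is the larger of the two end dimensions, each of the
      conditions (a), (b) and (c) selects one branch of the case distinction in
      \<open>exact\<close>.\<close>
    note E = exact[OF fg]
    show "GK K A M = max (GK K A M') (GK K A M'')" using E by blast
    show "module_mult M = module_mult M''" if "GK K A M' < GK K A M \<and> GK K A M = GK K A M''"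
      using E that by auto
    show "module_mult M = module_mult M'" if "GK K A M' = GK K A M \<and> GK K A M'' < GK K A M"
      using E that by auto
    show "module_mult M = module_mult M' + module_mult M''" if "GK K A M' = GK K A M \<and> GK K A M = GK K A M''"
      using E that by auto
  qed (use aff integer module_mult in auto)
qed

end
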